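(* Let $R$ be the hyperfinite ${\rm II}_1$ factor, let $\theta\in(0,1)$ be irrational, and let $u,v\in R$ be unitary operators with $R=\{u,v\}''$ and $vu=e^{2\pi i\theta}uv$. Let $f\in C(S^1)$. Then the spectrum of $uf(v)$ is given as follows: 1. If $f(v)$ is invertible, then $\sigma(uf(v))=\Delta(f(v))\,S^1$. 2. If $f(v)$ is not invertible, then $\sigma(uf(v))=\overline{\mathbb{B}(0,\Delta(f(v)))}$.
   Context: $S^1$ is the unit circle in $\mathbb{C}$. $f(v)$ is defined by functional calculus of the unitary $v$. $\Delta(f(v))=\exp\left(\int_0^1\ln|f(e^{2\pi ix})|\,dx\right)$ is the Fuglede-Kadison determinant of $f(v)$ with respect to the trace of $R$, with the convention $\exp(-\infty)=0$. $\overline{\mathbb{B}(0,r)}$ is the closed disk of radius $r$ centered at $0$ in $\mathbb{C}$ (equal to $\{0\}$ if $r=0$). *)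

theory Defs
  imports "HOL-Analysis.Analysis"
begin

section \<open>Complex Hilbert spaces\<close>

text \<open>The inner product is conjugate-linear in the first argument.\<close>

class complex_hilbert = banach +
  fixes scaleC :: "complex \<Rightarrow> 'a \<Rightarrow> 'a"
    and cinner :: "'a \<Rightarrow> 'a \<Rightarrow> complex"
  assumes scaleC_add_right: "scaleC a (x + y) = scaleC a x + scaleC a y"
    and scaleC_add_left: "scaleC (a + b) x = scaleC a x + scaleC b x"
    and scaleC_scaleC: "scaleC a (scaleC b x) = scaleC (a * b) x"
    and scaleR_eq_scaleC: "scaleR r x = scaleC (complex_of_real r) x"
    and cinner_commute: "cinner x y = cnj (cinner y x)"
    and cinner_add_left: "cinner (x + y) z = cinner x z + cinner y z"
    and cinner_scaleC_left: "cinner (scaleC a x) y = cnj a * cinner x y"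
    and cinner_self_norm: "cinner x x = complex_of_real ((norm x)\<^sup>2)"

instantiation complex :: complex_hilbert
begin

definition scaleC_complex :: "complex \<Rightarrow> complex \<Rightarrow> complex"
  where "scaleC_complex a x = a * x"

definition cinner_complex :: "complex \<Rightarrow> complex \<Rightarrow> complex"
  where "cinner_complex x y = cnj x * y"

instance
  by standard
    (auto simp: scaleC_complex_def cinner_complex_def algebra_simps scaleR_conv_of_real
      complex_norm_square simp flip: of_real_power)

end

lemma norm_scaleC: "norm (scaleC c x) = cmod c * norm (x :: 'h :: complex_hilbert)"
proof -
  have "complex_of_real ((norm (scaleC c x))\<^sup>2) = cinner (scaleC c x) (scaleC c x)"
    by (simp only: cinner_self_norm)
  also have "\<dots> = cnj c * cnj (cinner (scaleC c x) x)"
    by (simp only: cinner_scaleC_left cinner_commute[of x "scaleC c x"])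
  also have "\<dots> = (c * cnj c) * cinner x x"
    by (simp add: cinner_scaleC_left cinner_self_norm)
  also have "\<dots> = complex_of_real ((cmod c * norm x)\<^sup>2)"
    by (simp add: cinner_self_norm power_mult_distrib flip: complex_norm_square)
  finally have "(norm (scaleC c x))\<^sup>2 = (cmod c * norm x)\<^sup>2"
    by (simp only: of_real_eq_iff)
  then show ?thesis
    by (simp add: power2_eq_iff_nonneg)
qed

section \<open>Bounded operators\<close>

text \<open>Type \<open>'h \<Rightarrow>\<^sub>L 'h\<close> consists of the bounded real-linear maps; \<open>bounded_ops\<close>, the
  algebra \<open>B(H)\<close>, is cut out by commutation with complex scalars. The multiple \<open>c T\<close> of
  an operator is written \<open>scalar_op c o\<^sub>L T\<close>.\<close>

lift_definition scalar_op :: "complex \<Rightarrow> 'h :: complex_hilbert \<Rightarrow>\<^sub>L 'h"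
  is "\<lambda>c x. scaleC c x"
proof -
  fix c :: complex
  show "bounded_linear (\<lambda>x :: 'h. scaleC c x)"
    by (rule bounded_linear_intro[where K = "cmod c"])
      (simp_all add: scaleC_add_right scaleR_eq_scaleC scaleC_scaleC norm_scaleC mult.commute)
qed

definition bounded_ops :: "('h :: complex_hilbert \<Rightarrow>\<^sub>L 'h) set"
  where "bounded_ops = {T. \<forall>c x. blinfun_apply T (scaleC c x) = scaleC c (blinfun_apply T x)}"

definition adj :: "('h :: complex_hilbert \<Rightarrow>\<^sub>L 'h) \<Rightarrow> ('h \<Rightarrow>\<^sub>L 'h)"
  where "adj T = (THE S. \<forall>x y. cinner (blinfun_apply S x) y = cinner x (blinfun_apply T y))"

definition unitary_op :: "('h :: complex_hilbert \<Rightarrow>\<^sub>L 'h) \<Rightarrow> bool"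
  where "unitary_op T \<longleftrightarrow>
    T \<in> bounded_ops \<and> adj T o\<^sub>L T = id_blinfun \<and> T o\<^sub>L adj T = id_blinfun"

definition op_invertible :: "('h :: complex_hilbert \<Rightarrow>\<^sub>L 'h) \<Rightarrow> bool"
  where "op_invertible T \<longleftrightarrow>
    (\<exists>S \<in> bounded_ops. S o\<^sub>L T = id_blinfun \<and> T o\<^sub>L S = id_blinfun)"

definition op_spectrum :: "('h :: complex_hilbert \<Rightarrow>\<^sub>L 'h) \<Rightarrow> complex set"
  where "op_spectrum T = {z. \<not> op_invertible (T - scalar_op z)}"

definition op_positive :: "('h :: complex_hilbert \<Rightarrow>\<^sub>L 'h) \<Rightarrow> bool"
  where "op_positive T \<longleftrightarrow>
    T \<in> bounded_ops \<and> (\<forall>x. cinner x (blinfun_apply T x) \<in> \<real>\<^sub>\<ge>\<^sub>0)"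

definition op_le :: "('h :: complex_hilbert \<Rightarrow>\<^sub>L 'h) \<Rightarrow> ('h \<Rightarrow>\<^sub>L 'h) \<Rightarrow> bool"
  where "op_le S T \<longleftrightarrow> op_positive (T - S)"

section \<open>Continuous functional calculus\<close>

text \<open>For normal \<open>T\<close> there is exactly one isometric unital *-homomorphism from \<open>C(\<sigma>(T))\<close>
  into \<open>B(H)\<close> that sends the identity function to \<open>T\<close>. Elements of \<open>C(\<sigma>(T))\<close> are
  represented by total functions; as \<open>\<Phi>\<close> is additive and isometric, \<open>\<Phi> f\<close> depends only
  on the values of \<open>f\<close> on \<open>\<sigma>(T)\<close>. Thus \<open>fcalc T f\<close> is determined by \<open>T\<close> and \<open>f\<close> when \<open>f\<close>
  is continuous on \<open>\<sigma>(T)\<close>, and is meaningless otherwise.\<close>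

definition is_fcalc ::
    "('h :: complex_hilbert \<Rightarrow>\<^sub>L 'h) \<Rightarrow> ((complex \<Rightarrow> complex) \<Rightarrow> ('h \<Rightarrow>\<^sub>L 'h)) \<Rightarrow> bool"
  where "is_fcalc T \<Phi> \<longleftrightarrow>
    \<Phi> (\<lambda>z. z) = T \<and>
    (\<forall>c. \<Phi> (\<lambda>_. c) = scalar_op c) \<and>
    (\<forall>f. continuous_on (op_spectrum T) f \<longrightarrow>
       \<Phi> f \<in> bounded_ops \<and>
       \<Phi> (\<lambda>z. cnj (f z)) = adj (\<Phi> f) \<and>
       norm (\<Phi> f) = (SUP z\<in>op_spectrum T. cmod (f z))) \<and>
    (\<forall>f g. continuous_on (op_spectrum T) f \<and> continuous_on (op_spectrum T) g \<longrightarrow>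
       \<Phi> (\<lambda>z. f z + g z) = \<Phi> f + \<Phi> g \<and>
       \<Phi> (\<lambda>z. f z * g z) = \<Phi> f o\<^sub>L \<Phi> g)"

definition fcalc ::
    "('h :: complex_hilbert \<Rightarrow>\<^sub>L 'h) \<Rightarrow> (complex \<Rightarrow> complex) \<Rightarrow> ('h \<Rightarrow>\<^sub>L 'h)"
  where "fcalc T = (SOME \<Phi>. is_fcalc T \<Phi>)"

definition op_abs :: "('h :: complex_hilbert \<Rightarrow>\<^sub>L 'h) \<Rightarrow> ('h \<Rightarrow>\<^sub>L 'h)"
  where "op_abs T = fcalc (adj T o\<^sub>L T) (\<lambda>z. complex_of_real (sqrt (Re z)))"

section \<open>The hyperfinite II\<open>\<^sub>1\<close> factor\<close>

definition commutant :: "('h :: complex_hilbert \<Rightarrow>\<^sub>L 'h) set \<Rightarrow> ('h \<Rightarrow>\<^sub>L 'h) set"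
  where "commutant M = {T \<in> bounded_ops. \<forall>A\<in>M. T o\<^sub>L A = A o\<^sub>L T}"

definition von_neumann_algebra :: "('h :: complex_hilbert \<Rightarrow>\<^sub>L 'h) set \<Rightarrow> bool"
  where "von_neumann_algebra R \<longleftrightarrow>
    R \<subseteq> bounded_ops \<and> adj ` R \<subseteq> R \<and> commutant (commutant R) = R"

definition factor :: "('h :: complex_hilbert \<Rightarrow>\<^sub>L 'h) set \<Rightarrow> bool"
  where "factor R \<longleftrightarrow> von_neumann_algebra R \<and> R \<inter> commutant R = range scalar_op"

text \<open>\<open>span\<close> is the real span; real and complex finite-dimensionality agree.\<close>

definition finite_dimensional :: "('h :: complex_hilbert \<Rightarrow>\<^sub>L 'h) set \<Rightarrow> bool"
  where "finite_dimensional A \<longleftrightarrow> (\<exists>B. finite B \<and> A \<subseteq> span B)"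

definition unital_star_subalgebra :: "('h :: complex_hilbert \<Rightarrow>\<^sub>L 'h) set \<Rightarrow> bool"
  where "unital_star_subalgebra A \<longleftrightarrow>
    A \<subseteq> bounded_ops \<and> id_blinfun \<in> A \<and>
    (\<forall>S\<in>A. adj S \<in> A \<and> (\<forall>c. scalar_op c o\<^sub>L S \<in> A)) \<and>
    (\<forall>S\<in>A. \<forall>T\<in>A. S + T \<in> A \<and> S o\<^sub>L T \<in> A)"

definition tracial_state ::
    "('h :: complex_hilbert \<Rightarrow>\<^sub>L 'h) set \<Rightarrow> (('h \<Rightarrow>\<^sub>L 'h) \<Rightarrow> complex) \<Rightarrow> bool"
  where "tracial_state R \<tau> \<longleftrightarrow>
    (\<forall>S\<in>R. \<forall>T\<in>R. \<tau> (S + T) = \<tau> S + \<tau> T) \<and>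
    (\<forall>c. \<forall>T\<in>R. \<tau> (scalar_op c o\<^sub>L T) = c * \<tau> T) \<and>
    \<tau> id_blinfun = 1 \<and>
    (\<forall>T\<in>R. \<tau> (adj T o\<^sub>L T) \<in> \<real>\<^sub>\<ge>\<^sub>0) \<and>
    (\<forall>S\<in>R. \<forall>T\<in>R. \<tau> (S o\<^sub>L T) = \<tau> (T o\<^sub>L S))"

definition faithful_on ::
    "('h :: complex_hilbert \<Rightarrow>\<^sub>L 'h) set \<Rightarrow> (('h \<Rightarrow>\<^sub>L 'h) \<Rightarrow> complex) \<Rightarrow> bool"
  where "faithful_on R \<tau> \<longleftrightarrow> (\<forall>T\<in>R. \<tau> (adj T o\<^sub>L T) = 0 \<longrightarrow> T = 0)"

text \<open>Normality: \<open>\<tau>\<close> preserves suprema of bounded upward directed sets of positive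
  elements.\<close>

definition normal_on ::
    "('h :: complex_hilbert \<Rightarrow>\<^sub>L 'h) set \<Rightarrow> (('h \<Rightarrow>\<^sub>L 'h) \<Rightarrow> complex) \<Rightarrow> bool"
  where "normal_on R \<tau> \<longleftrightarrow>
    (\<forall>D S. D \<noteq> {} \<and> D \<subseteq> {T \<in> R. op_positive T} \<and>
       (\<forall>A\<in>D. \<forall>B\<in>D. \<exists>C\<in>D. op_le A C \<and> op_le B C) \<and>
       S \<in> R \<and> (\<forall>T\<in>D. op_le T S) \<and>
       (\<forall>S'\<in>R. (\<forall>T\<in>D. op_le T S') \<longrightarrow> op_le S S') \<longrightarrow>
       Re (\<tau> S) = (SUP T\<in>D. Re (\<tau> T)))"

definition faithful_normal_tracial_state ::
    "('h :: complex_hilbert \<Rightarrow>\<^sub>L 'h) set \<Rightarrow> (('h \<Rightarrow>\<^sub>L 'h) \<Rightarrow> complex) \<Rightarrow> bool"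
  where "faithful_normal_tracial_state R \<tau> \<longleftrightarrow>
    tracial_state R \<tau> \<and> faithful_on R \<tau> \<and> normal_on R \<tau>"

definition II1_factor :: "('h :: complex_hilbert \<Rightarrow>\<^sub>L 'h) set \<Rightarrow> bool"
  where "II1_factor R \<longleftrightarrow>
    factor R \<and> \<not> finite_dimensional R \<and> (\<exists>\<tau>. faithful_normal_tracial_state R \<tau>)"

definition hyperfinite :: "('h :: complex_hilbert \<Rightarrow>\<^sub>L 'h) set \<Rightarrow> bool"
  where "hyperfinite R \<longleftrightarrow>
    (\<exists>A :: nat \<Rightarrow> ('h \<Rightarrow>\<^sub>L 'h) set.
       (\<forall>n. unital_star_subalgebra (A n) \<and> finite_dimensional (A n) \<and> A n \<subseteq> A (Suc n)) \<and>
       R = commutant (commutant (\<Union>n. A n)))"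

section \<open>Fuglede-Kadison determinant\<close>

text \<open>\<open>\<Delta>(T)\<close> is the limit of \<open>exp (\<tau> (ln (\<bar>T\<bar> + \<epsilon>)))\<close> as \<open>\<epsilon>\<close> decreases to \<open>0\<close>; for
  invertible \<open>T\<close> this is \<open>exp (\<tau> (ln \<bar>T\<bar>))\<close>.\<close>

definition fk_det ::
    "(('h :: complex_hilbert \<Rightarrow>\<^sub>L 'h) \<Rightarrow> complex) \<Rightarrow> ('h \<Rightarrow>\<^sub>L 'h) \<Rightarrow> real"
  where "fk_det \<tau> T =
    Lim (at_right 0)
      (\<lambda>\<epsilon>. exp (Re (\<tau> (fcalc (op_abs T) (\<lambda>z. complex_of_real (ln (Re z + \<epsilon>)))))))"

text \<open>\<open>exp (\<integral>\<^sub>0\<^sup>1 ln \<bar>f(exp(2\<pi>ix))\<bar> dx)\<close> for \<open>f\<close> continuous on the unit circle. The integrand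
  is bounded above, so the integral is \<open>-\<infinity>\<close> exactly when \<open>f\<close> vanishes on a set of positive
  measure (where \<open>ln \<bar>f\<bar>\<close> is \<open>-\<infinity>\<close>, although \<open>ln 0 = 0\<close> in HOL) or \<open>ln \<bar>f\<bar>\<close> is not
  integrable; then the value is \<open>exp (-\<infinity>) = 0\<close>.\<close>

definition exp_circle_log :: "(complex \<Rightarrow> complex) \<Rightarrow> real"
  where "exp_circle_log f =
    (if (AE x in lborel. x \<in> {0..1} \<longrightarrow> f (cis (2 * pi * x)) \<noteq> 0) \<and>
        set_integrable lborel {0..1} (\<lambda>x. ln (cmod (f (cis (2 * pi * x)))))
     then exp (set_lebesgue_integral lborel {0..1} (\<lambda>x. ln (cmod (f (cis (2 * pi * x))))))
     else 0)"

end

theory Submission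
  imports Defs
begin

text \<open>
  Conjugation by \<open>u\<close> rotates the spectrum of \<open>v\<close>, so \<open>\<tau>(g(v))\<close> is the mean of \<open>g\<close> over the
  circle and the functional calculus of \<open>v\<close> is isometric on \<open>C(S\<^sup>1)\<close>. If \<open>h\<close> is continuous, then
  \<open>h\<close> minus its mean is uniformly close to a coboundary \<open>q \<circ> rot - q\<close>. Applied to \<open>ln (\<bar>f\<bar> + \<epsilon>)\<close>,
  this makes \<open>T = u f(v)\<close> similar to an operator of norm at most \<open>\<Delta>(f(v)) + \<epsilon>'\<close>, and likewise
  for the inverse if \<open>f\<close> has no zero. So the spectrum lies in the disk, respectively the circle.

  Conversely, let \<open>0 < r \<le> \<Delta>(f(v))\<close> and suppose that the circle of radius \<open>r\<close> misses the spectrum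
  (as \<open>v T v\<^sup>* = e\<^bsup>2\<pi>i\<theta>\<^esup> T\<close>, it is disjoint from the spectrum as soon as it is not contained in it). The
  Fourier coefficients \<open>E\<^sub>k\<close> of the resolvent \<open>(1 - T / (r z))\<^sup>-\<^sup>1\<close> on the unit circle tend to \<open>0\<close>, and
  \<open>E\<^sub>-\<^sub>n = (T/r)\<^sup>n E\<^sub>0\<close> and \<open>E\<^sub>0 - 1 = (T/r)\<^sup>n E\<^sub>n\<close> for \<open>n \<ge> 1\<close>. Here \<open>E\<^sub>0\<close> commutes with \<open>v\<close> and \<open>T\<close>; since
  \<open>\<Delta>(f(v)) > 0\<close>, the operator \<open>f(v)\<close> is injective in the \<open>2\<close>-norm of \<open>\<tau>\<close>, hence \<open>E\<^sub>0\<close> also commutes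
  with \<open>u\<close> and is a scalar. If \<open>E\<^sub>0 \<noteq> 0\<close>, then \<open>(T/r)\<^sup>n \<rightarrow> 0\<close>, which contradicts
  \<open>\<parallel>T\<^sup>n\<parallel> \<ge> \<Delta>(f(v))\<^sup>n\<close>. If \<open>E\<^sub>0 = 0\<close>, then \<open>T\<close> is invertible and \<open>(T/r)\<^sup>-\<^sup>n \<rightarrow> 0\<close>, which forces
  \<open>f\<close> to have no zero and \<open>r < \<Delta>(f(v))\<close>.
\<close>

section \<open>Hilbert space preliminaries\<close>

text \<open>Behind the case split on \<open>E_0\<close> stands a separation argument. A circle of
  radius r free of spectrum has a Riesz idempotent, and a scalar idempotent is 0 or 1, so the circle
  cannot split the spectrum: all of it lies on one side. Either side is then tested against the
  growth of powers. The link to the determinant is \<open>T^n = u^n g_n(v)\<close>, where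
  \<open>g_n\<close> multiplies f along n points of a rotation orbit: norms of powers are sup norms
  of \<open>g_n\<close>, and the mean of \<open>ln |g_n|\<close> is n times the mean of
  \<open>ln |f|\<close>. Zeros of f are the main obstacle: there \<open>ln |f|\<close> is unbounded
  and f(v) has no inverse to cancel. Logarithms are therefore taken of \<open>|f| + e\<close>, and
  f(v) is cancelled by means of the bounded functions \<open>cnj f / (|f|^2 + d)\<close>, with an
  error that is small only in the 2-norm of the trace. A second obstacle is that
  \<open>fcalc\<close>, and through it \<open>op_abs\<close> and \<open>fk_det\<close>, is given by
  choice. Nothing can be evaluated until some isometric calculus has been constructed and shown to
  be unique; its isometry depends on knowing the full spectrum of v.\<close>

lemma scaleC_one [simp]: "scaleC 1 x = (x :: 'h :: complex_hilbert)"
  by (metis of_real_1 scaleR_eq_scaleC scaleR_one)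

lemma scaleC_zero_left [simp]: "scaleC 0 x = (0 :: 'h :: complex_hilbert)"
  by (metis of_real_0 scaleR_eq_scaleC scaleR_zero_left)

lemma cinner_add_right: "cinner x (y + z :: 'h :: complex_hilbert) = cinner x y + cinner x z"
  by (metis cinner_add_left cinner_commute complex_cnj_add)

lemma cinner_scaleC_right: "cinner x (scaleC a y :: 'h :: complex_hilbert) = a * cinner x y"
  by (metis cinner_scaleC_left cinner_commute complex_cnj_cnj complex_cnj_mult)

lemma cinner_scaleR_left: "cinner (r *\<^sub>R x) (y :: 'h :: complex_hilbert) = r *\<^sub>R cinner x y"
  by (simp add: scaleR_eq_scaleC[of r x] cinner_scaleC_left scaleR_conv_of_real)

lemma cinner_scaleR_right: "cinner x (r *\<^sub>R y :: 'h :: complex_hilbert) = r *\<^sub>R cinner x y"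
  by (simp add: scaleR_eq_scaleC[of r y] cinner_scaleC_right scaleR_conv_of_real)

lemma cinner_minus_left: "cinner (- x) (y :: 'h :: complex_hilbert) = - cinner x y"
  using cinner_scaleR_left[of "- 1" x y] by simp

lemma cinner_minus_right: "cinner x (- y :: 'h :: complex_hilbert) = - cinner x y"
  using cinner_scaleR_right[of x "- 1" y] by simp

lemma cinner_diff_left: "cinner (x - y) (z :: 'h :: complex_hilbert) = cinner x z - cinner y z"
  using cinner_add_left[of x "- y" z] by (simp add: cinner_minus_left)

lemma cinner_diff_right: "cinner x (y - z :: 'h :: complex_hilbert) = cinner x y - cinner x z"
  using cinner_add_right[of x y "- z"] by (simp add: cinner_minus_right)

lemma Re_cinner_self: "Re (cinner x (x :: 'h :: complex_hilbert)) = (norm x)\<^sup>2"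
  by (simp add: cinner_self_norm flip: of_real_power)

text \<open>The quadratic in \<open>a\<close> behind both the Cauchy-Schwarz inequality and the
  orthogonality step of the Riesz representation; each of them inserts the minimizing
  \<open>a\<close>.\<close>

lemma norm_diff_scaleC_square:
  fixes x y :: "'h :: complex_hilbert"
  shows "(norm (y - scaleC a x))\<^sup>2
    = (norm y)\<^sup>2 - 2 * Re (a * cinner y x) + (cmod a)\<^sup>2 * (norm x)\<^sup>2"
proof -
  have "cinner (y - scaleC a x) (y - scaleC a x)
      = cinner y y - (a * cinner y x + cnj (a * cinner y x)) + a * cnj a * cinner x x"
    by (simp add: cinner_diff_left cinner_diff_right cinner_scaleC_left cinner_scaleC_right
        cinner_commute[of x y] algebra_simps)
  then have "Re (cinner (y - scaleC a x) (y - scaleC a x))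
      = Re (cinner y y) - 2 * Re (a * cinner y x) + (cmod a)\<^sup>2 * Re (cinner x x)"
    by (simp add: cinner_self_norm flip: complex_norm_square of_real_power of_real_mult)
  then show ?thesis
    by (simp only: Re_cinner_self)
qed

lemma norm_cinner_le: "cmod (cinner x (y :: 'h :: complex_hilbert)) \<le> norm x * norm y"
proof (cases "x = 0")
  case True
  then show ?thesis
    using cinner_scaleR_left[of 0 x y] by simp
next
  case False
  define a where "a = cinner x y / complex_of_real ((norm x)\<^sup>2)"
  have "a * cinner y x = complex_of_real ((cmod (cinner x y))\<^sup>2 / (norm x)\<^sup>2)"
    using complex_norm_square[of "cinner x y"]
    by (simp add: a_def cinner_commute[of y x])
  moreover have "cmod a = cmod (cinner x y) / (norm x)\<^sup>2"
    by (simp add: a_def norm_divide norm_power)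
  then have "(cmod a)\<^sup>2 * (norm x)\<^sup>2 = (cmod (cinner x y))\<^sup>2 / (norm x)\<^sup>2"
    using False by (simp add: power_divide power2_eq_square)
  ultimately have "(norm (y - scaleC a x))\<^sup>2 = (norm y)\<^sup>2 - (cmod (cinner x y))\<^sup>2 / (norm x)\<^sup>2"
    by (simp add: norm_diff_scaleC_square)
  then have "(cmod (cinner x y))\<^sup>2 / (norm x)\<^sup>2 \<le> (norm y)\<^sup>2"
    using zero_le_power2[of "norm (y - scaleC a x)"] by linarith
  then have "(cmod (cinner x y))\<^sup>2 \<le> (norm x * norm y)\<^sup>2"
    using False by (simp add: divide_le_eq power_mult_distrib mult.commute)
  then show ?thesis
    by (rule power2_le_imp_le) simp
qed

lemma bounded_bilinear_cinner:
  "bounded_bilinear (cinner :: 'h :: complex_hilbert \<Rightarrow> 'h \<Rightarrow> complex)"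
  by (rule bounded_bilinear.intro)
    (auto simp: cinner_add_left cinner_add_right cinner_scaleR_left cinner_scaleR_right
      norm_cinner_le intro!: exI[of _ 1])

interpretation cinner: bounded_bilinear "cinner :: 'h :: complex_hilbert \<Rightarrow> 'h \<Rightarrow> complex"
  by (rule bounded_bilinear_cinner)

lemma cinner_ext:
  fixes x y :: "'h :: complex_hilbert"
  assumes "\<And>z. cinner x z = cinner y z"
  shows "x = y"
proof -
  have "cinner (x - y) (x - y) = 0"
    by (simp add: cinner_diff_left assms)
  then show ?thesis
    by (simp add: cinner_self_norm)
qed

lemma parallelogram:
  fixes x y :: "'h :: complex_hilbert"
  shows "(norm (x + y))\<^sup>2 + (norm (x - y))\<^sup>2 = 2 * (norm x)\<^sup>2 + 2 * (norm y)\<^sup>2"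
  by (simp add: cinner_add_left cinner_add_right cinner_diff_left cinner_diff_right
      flip: Re_cinner_self)

text \<open>The representing vector is a multiple of the element of least norm in the
  hyperplane \<open>{y. \<phi> y = 1}\<close>.\<close>

lemma riesz_representation:
  fixes \<phi> :: "'h :: complex_hilbert \<Rightarrow> complex"
  assumes bl: "bounded_linear \<phi>" and hom: "\<And>c y. \<phi> (scaleC c y) = c * \<phi> y"
  obtains w where "\<And>y. \<phi> y = cinner w y"
proof (cases "\<forall>y. \<phi> y = 0")
  case True
  then show ?thesis
    using that[of 0] by (simp add: cinner.zero_left)
next
  case False
  interpret bounded_linear \<phi> by (rule bl)
  obtain y0 where y0: "\<phi> y0 \<noteq> 0" using False by blast
  define S where "S = {y. \<phi> y = 1}"
  have S_ne: "scaleC (inverse (\<phi> y0)) y0 \<in> S"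
    using y0 by (simp add: S_def hom)
  define d where "d = (INF y\<in>S. norm y)"
  have bdd: "bdd_below (norm ` S)" by (rule bdd_belowI[of _ 0]) auto
  have d_le: "d \<le> norm y" if "y \<in> S" for y
    unfolding d_def by (rule cINF_lower[OF bdd that])
  have d0: "0 \<le> d" unfolding d_def by (rule cINF_greatest) (use S_ne in auto)
  have "\<exists>y\<in>S. norm y < d + 1 / Suc n" for n
  proof -
    have "(INF y\<in>S. norm y) < d + 1 / Suc n"
      by (simp add: d_def)
    then show ?thesis
      using S_ne by (subst (asm) cINF_less_iff[OF _ bdd]) auto
  qed
  then obtain s where s: "\<And>n. s n \<in> S" "\<And>n. norm (s n) < d + 1 / Suc n"
    by metis
  \<comment> \<open>The midpoint stays in the hyperplane, so its norm is at least \<open>d\<close>;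
    the parallelogram law then forces near-minimizers to be close to each other.\<close>
  have mid: "(norm (x - y))\<^sup>2 \<le> 2 * (norm x)\<^sup>2 + 2 * (norm y)\<^sup>2 - 4 * d\<^sup>2" if "x \<in> S" "y \<in> S" for x y
  proof -
    have "(1/2) *\<^sub>R (x + y) \<in> S"
      using that by (simp add: S_def scaleR add scaleR_conv_of_real)
    then have "d \<le> norm (x + y) / 2"
      using d_le by force
    then have "(2 * d)\<^sup>2 \<le> (norm (x + y))\<^sup>2"
      using d0 by (intro power_mono) auto
    then show ?thesis using parallelogram[of x y] by (simp add: power_mult_distrib)
  qed
  have "Cauchy s"
  proof (rule metric_CauchyI)
    fix e :: real assume e: "0 < e"
    \<comment> \<open>Beyond \<open>N\<close> each squared norm exceeds \<open>d\<close> squared by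
      at most \<open>(2 * d + 1) / Suc N\<close>. Two such terms, each doubled in
      \<open>mid\<close>, give \<open>8 * d + 4\<close>.\<close>
    obtain N :: nat where N: "(8 * d + 4) / e\<^sup>2 < real (Suc N)"
      by (metis reals_Archimedean2 less_Suc_eq of_nat_less_iff order_less_trans)
    have "dist (s m) (s n) < e" if "N \<le> m" "N \<le> n" for m n
    proof -
      have *: "(norm (s k))\<^sup>2 \<le> d\<^sup>2 + (2 * d + 1) / Suc N" if "N \<le> k" for k
      proof -
        have "norm (s k) \<le> d + 1 / Suc N"
          using s(2)[of k] that by (smt (verit) frac_le of_nat_0_less_iff of_nat_le_iff zero_less_Suc Suc_le_mono)
        then have "(norm (s k))\<^sup>2 \<le> (d + 1 / Suc N)\<^sup>2"
          by (intro power_mono) auto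
        also have "\<dots> = d\<^sup>2 + 2 * d / Suc N + (1 / Suc N)\<^sup>2"
          by (simp add: power2_sum)
        also have "(1 / real (Suc N))\<^sup>2 \<le> 1 / Suc N"
          by (simp add: power2_eq_square divide_simps)
        finally show ?thesis by (simp add: add_divide_distrib)
      qed
      have "(norm (s m - s n))\<^sup>2 \<le> (8 * d + 4) / Suc N"
        using mid[OF s(1)[of m] s(1)[of n]] *[OF that(1)] *[OF that(2)]
        by (simp add: add_divide_distrib)
      also have "\<dots> < e\<^sup>2"
        using N e by (simp add: divide_simps mult.commute)
      finally show ?thesis
        using e by (simp add: dist_norm power_less_imp_less_base)
    qed
    then show "\<exists>M. \<forall>m\<ge>M. \<forall>n\<ge>M. dist (s m) (s n) < e" by blast
  qed
  then obtain w where w: "s \<longlonglongrightarrow> w"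
    by (auto simp: Cauchy_convergent_iff convergent_def)
  have w1: "\<phi> w = 1"
  proof -
    have "(\<lambda>n. \<phi> (s n)) \<longlonglongrightarrow> \<phi> w" by (rule tendsto[OF w])
    moreover have "(\<lambda>n. \<phi> (s n)) = (\<lambda>n. 1)" using s(1) by (auto simp: S_def)
    ultimately show ?thesis by (simp add: LIMSEQ_const_iff)
  qed
  have wd: "norm w \<le> d"
  proof (rule LIMSEQ_le)
    show "(\<lambda>n. norm (s n)) \<longlonglongrightarrow> norm w" by (rule tendsto_norm[OF w])
    have "(\<lambda>n. d + 1 / real (Suc n)) \<longlonglongrightarrow> d + 0"
      using LIMSEQ_inverse_real_of_nat by (intro tendsto_intros) (simp add: inverse_eq_divide)
    then show "(\<lambda>n. d + 1 / real (Suc n)) \<longlonglongrightarrow> d" by simp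
    show "\<exists>N. \<forall>n\<ge>N. norm (s n) \<le> d + 1 / real (Suc n)" using s(2) less_imp_le by blast
  qed
  have w0: "w \<noteq> 0" using w1 zero by auto
  have orth: "cinner w x = 0" if x: "\<phi> x = 0" for x
  proof (cases "x = 0")
    case True
    then show ?thesis by (simp add: cinner.zero_right)
  next
    case False
    \<comment> \<open>With the minimizing coefficient the norm would drop below that of
      \<open>w\<close> unless \<open>cinner w x\<close> vanishes, while \<open>w - a x\<close> stays
      in the hyperplane.\<close>
    define a where "a = cnj (cinner w x) / complex_of_real ((norm x)\<^sup>2)"
    have "\<phi> (w - scaleC a x) = 1" using w1 x by (simp add: diff hom)
    then have "norm w \<le> norm (w - scaleC a x)"
      using d_le wd by (force simp: S_def)
    then have "(norm w)\<^sup>2 \<le> (norm (w - scaleC a x))\<^sup>2" by (intro power_mono) auto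
    then have "2 * Re (a * cinner w x) \<le> (cmod a)\<^sup>2 * (norm x)\<^sup>2"
      by (simp add: norm_diff_scaleC_square)
    moreover have "a * cinner w x = complex_of_real ((cmod (cinner w x))\<^sup>2 / (norm x)\<^sup>2)"
      using complex_norm_square[of "cinner w x"] by (simp add: a_def mult.commute)
    moreover have "cmod a = cmod (cinner w x) / (norm x)\<^sup>2"
      by (simp add: a_def norm_divide norm_power)
    then have "(cmod a)\<^sup>2 * (norm x)\<^sup>2 = (cmod (cinner w x))\<^sup>2 / (norm x)\<^sup>2"
      using False by (simp add: power_divide power2_eq_square)
    ultimately have "(cmod (cinner w x))\<^sup>2 / (norm x)\<^sup>2 \<le> 0" by simp
    then show ?thesis using False by (simp add: divide_le_0_iff)
  qed
  define w' where "w' = scaleC (complex_of_real (1 / (norm w)\<^sup>2)) w"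
  have "\<phi> y = cinner w' y" for y
  proof -
    have "cinner w (y - scaleC (\<phi> y) w) = 0"
      by (rule orth) (simp add: diff hom w1)
    then have "cinner w y = \<phi> y * complex_of_real ((norm w)\<^sup>2)"
      by (simp add: cinner_diff_right cinner_scaleC_right cinner_self_norm)
    then show ?thesis
      using w0 by (simp add: w'_def cinner_scaleC_left)
  qed
  then show ?thesis by (rule that)
qed

section \<open>Bounded operators and adjoints\<close>

interpretation blinfun_compose: bounded_bilinear
  "blinfun_compose :: ('b :: real_normed_vector \<Rightarrow>\<^sub>L 'c :: real_normed_vector) \<Rightarrow> ('a :: real_normed_vector \<Rightarrow>\<^sub>L 'b) \<Rightarrow> _"
  by (rule bounded_bilinear_blinfun_compose)

lemma blinfun_compose_id [simp]: "id_blinfun o\<^sub>L A = A" "A o\<^sub>L id_blinfun = A"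
  by (auto intro: blinfun_eqI)

lemma blinfun_compose_assoc: "(A o\<^sub>L B) o\<^sub>L C = A o\<^sub>L (B o\<^sub>L C)"
  by (rule blinfun_eqI) simp

lemma blinfun_eq_iff: "A = B \<longleftrightarrow> (\<forall>x. blinfun_apply A x = blinfun_apply B x)"
  by (auto intro: blinfun_eqI)

lemma scalar_op_apply [simp]: "scalar_op c x = scaleC c x"
  by (simp add: scalar_op.rep_eq)

lemma scaleC_diff_right: "scaleC a (x - y :: 'h :: complex_hilbert) = scaleC a x - scaleC a y"
  using blinfun.diff_right[of "scalar_op a" x y] by simp

lemma scaleC_minus_left: "scaleC (- a) (x :: 'h :: complex_hilbert) = - scaleC a x"
proof -
  have "scaleC (- a) x + scaleC a x = 0"
    using scaleC_add_left[of "- a" a x] by simp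
  then show ?thesis by (simp add: eq_neg_iff_add_eq_0)
qed

lemma scalar_op_add: "scalar_op (a + b) = (scalar_op a + scalar_op b :: 'h :: complex_hilbert \<Rightarrow>\<^sub>L 'h)"
  by (rule blinfun_eqI) (simp add: blinfun.add_left scaleC_add_left)

lemma scalar_op_minus: "scalar_op (- a) = (- scalar_op a :: 'h :: complex_hilbert \<Rightarrow>\<^sub>L 'h)"
  by (rule blinfun_eqI) (simp add: blinfun.minus_left scaleC_minus_left)

lemma scalar_op_diff: "scalar_op (a - b) = (scalar_op a - scalar_op b :: 'h :: complex_hilbert \<Rightarrow>\<^sub>L 'h)"
  using scalar_op_add[of a "- b"] by (simp add: scalar_op_minus)

lemma scalar_op_mult: "scalar_op a o\<^sub>L scalar_op b = (scalar_op (a * b) :: 'h :: complex_hilbert \<Rightarrow>\<^sub>L 'h)"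
  by (rule blinfun_eqI) (simp add: scaleC_scaleC)

lemma scalar_op_mult_left:
  "scalar_op a o\<^sub>L (scalar_op b o\<^sub>L A) = (scalar_op (a * b) o\<^sub>L A :: 'h :: complex_hilbert \<Rightarrow>\<^sub>L 'h)"
  by (simp add: scalar_op_mult flip: blinfun_compose_assoc)

lemma scalar_op_one [simp]: "scalar_op 1 = (id_blinfun :: 'h :: complex_hilbert \<Rightarrow>\<^sub>L 'h)"
  by (rule blinfun_eqI) simp

lemma scalar_op_zero [simp]: "scalar_op 0 = (0 :: 'h :: complex_hilbert \<Rightarrow>\<^sub>L 'h)"
  by (rule blinfun_eqI) simp

lemma scalar_op_of_real: "scalar_op (complex_of_real r) = r *\<^sub>R (id_blinfun :: 'h :: complex_hilbert \<Rightarrow>\<^sub>L 'h)"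
  by (rule blinfun_eqI) (simp add: scaleR_eq_scaleC blinfun.scaleR_left)

text \<open>Only an inequality, since the class admits the zero space, where every operator has norm
  0.\<close>

lemma norm_scalar_op_le: "norm (scalar_op c :: 'h :: complex_hilbert \<Rightarrow>\<^sub>L 'h) \<le> cmod c"
  by (rule norm_blinfun_bound) (auto simp: norm_scaleC)

lemma norm_scalar_op_compose: "norm (scalar_op c o\<^sub>L A :: 'h :: complex_hilbert \<Rightarrow>\<^sub>L 'h) = cmod c * norm A"
proof (rule antisym)
  have le: "norm (scalar_op c o\<^sub>L A) \<le> cmod c * norm A" for c and A :: "'h \<Rightarrow>\<^sub>L 'h"
    by (rule order_trans[OF norm_blinfun_compose]) (simp add: norm_scalar_op_le mult_right_mono)
  show "norm (scalar_op c o\<^sub>L A) \<le> cmod c * norm A" by (rule le)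
  show "cmod c * norm A \<le> norm (scalar_op c o\<^sub>L A)"
  proof (cases "c = 0")
    case False
    have "norm A = norm (scalar_op (inverse c) o\<^sub>L (scalar_op c o\<^sub>L A))"
      using False by (simp add: scalar_op_mult_left)
    also have "\<dots> \<le> cmod (inverse c) * norm (scalar_op c o\<^sub>L A)" by (rule le)
    finally have "cmod c * norm A \<le> cmod c * (cmod (inverse c) * norm (scalar_op c o\<^sub>L A))"
      by (rule mult_left_mono) simp
    also have "\<dots> = norm (scalar_op c o\<^sub>L A)"
      using False by (simp add: norm_inverse flip: mult.assoc)
    finally show ?thesis .
  qed simp
qed

lemma bounded_linear_scalar_op: "bounded_linear (scalar_op :: complex \<Rightarrow> 'h :: complex_hilbert \<Rightarrow>\<^sub>L 'h)"
  by (rule bounded_linear_intro[where K = 1])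
    (auto simp: scalar_op_add norm_scalar_op_le scaleR_conv_of_real scalar_op_of_real
      blinfun_compose.scaleR_left simp flip: scalar_op_mult)

lemma bounded_opsI: "(\<And>c x. blinfun_apply T (scaleC c x) = scaleC c (blinfun_apply T x)) \<Longrightarrow> T \<in> bounded_ops"
  by (simp add: bounded_ops_def)

lemma bounded_ops_apply: "T \<in> bounded_ops \<Longrightarrow> blinfun_apply T (scaleC c x) = scaleC c (blinfun_apply T x)"
  by (simp add: bounded_ops_def)

text \<open>In this form membership in \<open>bounded_ops\<close> is a commutation property, so it
  passes to norm limits, to Neumann inverses and to averaged resolvents like any other commutation
  property.\<close>

lemma bounded_ops_eq_commutant: "(bounded_ops :: ('h :: complex_hilbert \<Rightarrow>\<^sub>L 'h) set) = {T. \<forall>c. T o\<^sub>L scalar_op c = scalar_op c o\<^sub>L T}"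
  by (auto simp: bounded_ops_def blinfun_eq_iff)

lemma scalar_op_commute: "T \<in> bounded_ops \<Longrightarrow> T o\<^sub>L scalar_op c = scalar_op c o\<^sub>L T"
  by (auto simp: bounded_ops_def blinfun_eq_iff)

lemma scalar_op_left_commute: "T \<in> bounded_ops \<Longrightarrow> T o\<^sub>L (scalar_op c o\<^sub>L A) = scalar_op c o\<^sub>L (T o\<^sub>L A)"
  by (auto simp: bounded_ops_def blinfun_eq_iff)

lemma scalar_op_in_bounded_ops [simp, intro]: "scalar_op c \<in> bounded_ops"
  by (rule bounded_opsI) (simp add: scaleC_scaleC mult.commute)

lemma id_in_bounded_ops [simp, intro]: "id_blinfun \<in> bounded_ops"
  by (rule bounded_opsI) simp

lemma zero_in_bounded_ops [simp, intro]: "0 \<in> bounded_ops"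
  using scalar_op_in_bounded_ops[of 0] by simp

lemma bounded_ops_compose [simp, intro]: "S \<in> bounded_ops \<Longrightarrow> T \<in> bounded_ops \<Longrightarrow> S o\<^sub>L T \<in> bounded_ops"
  by (simp add: bounded_ops_def)

lemma bounded_ops_add [simp, intro]: "S \<in> bounded_ops \<Longrightarrow> T \<in> bounded_ops \<Longrightarrow> S + T \<in> bounded_ops"
  by (simp add: bounded_ops_def blinfun.add_left scaleC_add_right)

lemma bounded_ops_diff [simp, intro]: "S \<in> bounded_ops \<Longrightarrow> T \<in> bounded_ops \<Longrightarrow> S - T \<in> bounded_ops"
  by (simp add: bounded_ops_def blinfun.diff_left scaleC_diff_right)

lemma bounded_ops_sum: "(\<And>i. i \<in> I \<Longrightarrow> T i \<in> bounded_ops) \<Longrightarrow> sum T I \<in> bounded_ops"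
  by (induction I rule: infinite_finite_induct) auto

section \<open>Closed sets of operators and the adjoint\<close>

lemma closed_commuting: "closed {T :: 'a :: real_normed_vector \<Rightarrow>\<^sub>L 'a. T o\<^sub>L A = A o\<^sub>L T}"
  by (intro closed_Collect_eq continuous_intros)

lemma closed_bounded_ops: "closed (bounded_ops :: ('h :: complex_hilbert \<Rightarrow>\<^sub>L 'h) set)"
proof -
  have "(bounded_ops :: ('h \<Rightarrow>\<^sub>L 'h) set) = (\<Inter>c. {T. T o\<^sub>L scalar_op c = scalar_op c o\<^sub>L T})"
    by (auto simp: bounded_ops_eq_commutant)
  then show ?thesis by (rule ssubst) (intro closed_INT ballI closed_commuting)
qed

text \<open>\<open>adj\<close> is a definite description, so every later fact about it rests on this
  lemma. Existence is Riesz representation of \<open>y\<close> mapped to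
  \<open>cinner x (T y)\<close>; uniqueness is nondegeneracy of the inner product.\<close>

lemma adj_exists:
  assumes "T \<in> bounded_ops"
  shows "\<exists>!S. \<forall>x y. cinner (blinfun_apply S x) y = cinner x (blinfun_apply T y)"
proof -
  have "\<exists>w. \<forall>y. cinner x (blinfun_apply T y) = cinner w y" for x
  proof -
    have "bounded_linear (\<lambda>y. cinner x (blinfun_apply T y))"
      by (intro bounded_linear_compose[OF cinner.bounded_linear_right] blinfun.bounded_linear_right)
    moreover have "cinner x (blinfun_apply T (scaleC c y)) = c * cinner x (blinfun_apply T y)" for c y
      using assms by (simp add: bounded_ops_apply cinner_scaleC_right)
    ultimately obtain w where "\<And>y. cinner x (blinfun_apply T y) = cinner w y"
      using riesz_representation[of "\<lambda>y. cinner x (blinfun_apply T y)"] by metis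
    then show ?thesis by metis
  qed
  then obtain s where s: "\<And>x y. cinner (s x) y = cinner x (blinfun_apply T y)" by metis
  have "bounded_linear s"
  proof (rule bounded_linear_intro[where K = "norm T"])
    show "s (x + y) = s x + s y" for x y
      by (rule cinner_ext) (simp add: cinner_add_left s)
    show "s (r *\<^sub>R x) = r *\<^sub>R s x" for r x
      by (rule cinner_ext) (simp add: cinner_scaleR_left s)
    show "norm (s x) \<le> norm x * norm T" for x
    proof (cases "s x = 0")
      case False
      have "(norm (s x))\<^sup>2 = cmod (cinner (s x) (s x))"
        by (simp add: cinner_self_norm norm_power)
      also have "\<dots> \<le> norm x * norm (blinfun_apply T (s x))"
        by (simp only: s norm_cinner_le)
      also have "\<dots> \<le> norm x * (norm T * norm (s x))"
        by (simp add: mult_left_mono norm_blinfun)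
      finally show ?thesis using False by (simp add: power2_eq_square)
    qed simp
  qed
  then have "\<forall>x y. cinner (blinfun_apply (Blinfun s) x) y = cinner x (blinfun_apply T y)"
    by (simp add: bounded_linear_Blinfun_apply s)
  then show ?thesis
    by (rule ex1I)
      (rule blinfun_eqI, rule cinner_ext, simp add: bounded_linear_Blinfun_apply[OF \<open>bounded_linear s\<close>] s)
qed

lemma cinner_adj_left: "T \<in> bounded_ops \<Longrightarrow> cinner (blinfun_apply (adj T) x) y = cinner x (blinfun_apply T y)"
  using theI'[OF adj_exists, of T] by (simp add: adj_def)

lemma cinner_adj_right: "T \<in> bounded_ops \<Longrightarrow> cinner x (blinfun_apply (adj T) y) = cinner (blinfun_apply T x) y"
  by (metis cinner_adj_left cinner_commute)

lemma adj_eqI: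
  assumes "T \<in> bounded_ops" "\<And>x y. cinner (blinfun_apply S x) y = cinner x (blinfun_apply T y)"
  shows "adj T = S"
  by (rule blinfun_eqI, rule cinner_ext) (simp add: cinner_adj_left assms)

lemma adj_in_bounded_ops [simp, intro]: "T \<in> bounded_ops \<Longrightarrow> adj T \<in> bounded_ops"
  by (rule bounded_opsI, rule cinner_ext) (simp add: cinner_adj_left cinner_scaleC_left)

lemma adj_adj [simp]: "T \<in> bounded_ops \<Longrightarrow> adj (adj T) = T"
  by (rule adj_eqI) (auto simp: cinner_adj_right)

lemma adj_compose: "S \<in> bounded_ops \<Longrightarrow> T \<in> bounded_ops \<Longrightarrow> adj (S o\<^sub>L T) = adj T o\<^sub>L adj S"
  by (rule adj_eqI) (auto simp: cinner_adj_left)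

lemma adj_add: "S \<in> bounded_ops \<Longrightarrow> T \<in> bounded_ops \<Longrightarrow> adj (S + T) = adj S + adj T"
  by (rule adj_eqI) (auto simp: cinner_adj_left blinfun.add_left cinner_add_left cinner_add_right)

lemma adj_diff: "S \<in> bounded_ops \<Longrightarrow> T \<in> bounded_ops \<Longrightarrow> adj (S - T) = adj S - adj T"
  by (rule adj_eqI) (auto simp: cinner_adj_left blinfun.diff_left cinner_diff_left cinner_diff_right)

lemma adj_scalar_op [simp]: "adj (scalar_op c) = scalar_op (cnj c)"
  by (rule adj_eqI) (auto simp: cinner_scaleC_left cinner_scaleC_right)

lemma adj_id [simp]: "adj id_blinfun = id_blinfun"
  by (rule adj_eqI) auto

lemma adj_zero [simp]: "adj 0 = 0"
  by (rule adj_eqI) (auto simp: cinner.zero_left cinner.zero_right)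

lemma adj_sum: "(\<And>i. i \<in> I \<Longrightarrow> T i \<in> bounded_ops) \<Longrightarrow> adj (sum T I) = (\<Sum>i\<in>I. adj (T i))"
  by (induction I rule: infinite_finite_induct) (auto simp: adj_add bounded_ops_sum)

lemma norm_adj_le:
  assumes "T \<in> bounded_ops"
  shows "norm (adj T) \<le> norm T"
proof (rule norm_blinfun_bound)
  fix x
  show "norm (adj T x) \<le> norm T * norm x"
  proof (cases "adj T x = 0")
    case False
    have "(norm (adj T x))\<^sup>2 = cmod (cinner (adj T x) (adj T x))"
      by (simp add: cinner_self_norm norm_power)
    also have "\<dots> \<le> norm x * norm (T (adj T x))"
      by (simp only: cinner_adj_left[OF assms] norm_cinner_le)
    also have "\<dots> \<le> norm x * (norm T * norm (adj T x))"
      by (simp add: mult_left_mono norm_blinfun)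
    finally show ?thesis using False by (simp add: power2_eq_square mult.commute)
  qed simp
qed simp

lemma tendsto_adj:
  assumes "\<And>n. X n \<in> bounded_ops" "X \<longlonglongrightarrow> L"
  shows "(\<lambda>n. adj (X n)) \<longlonglongrightarrow> adj L"
proof -
  have L: "L \<in> bounded_ops"
    using closed_bounded_ops assms by (metis closed_sequentially)
  have "(\<lambda>n. norm (X n - L)) \<longlonglongrightarrow> 0"
    using assms(2) by (simp add: LIM_zero tendsto_norm_zero)
  then have "(\<lambda>n. adj (X n) - adj L) \<longlonglongrightarrow> 0"
    by (rule Lim_null_comparison[rotated])
      (use assms(1) L in \<open>auto simp flip: adj_diff intro!: always_eventually norm_adj_le\<close>)
  then show ?thesis by (simp add: LIM_zero_iff)
qed

section \<open>Invertible operators\<close>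

primrec op_power :: "('a :: real_normed_vector \<Rightarrow>\<^sub>L 'a) \<Rightarrow> nat \<Rightarrow> ('a \<Rightarrow>\<^sub>L 'a)" where
  "op_power T 0 = id_blinfun"
| "op_power T (Suc n) = T o\<^sub>L op_power T n"

lemma op_power_commute:
  assumes "A o\<^sub>L T = T o\<^sub>L A"
  shows "A o\<^sub>L op_power T n = op_power T n o\<^sub>L A"
proof (induction n)
  case (Suc n)
  have "A o\<^sub>L op_power T (Suc n) = (A o\<^sub>L T) o\<^sub>L op_power T n" by (simp add: blinfun_compose_assoc)
  also have "\<dots> = T o\<^sub>L (A o\<^sub>L op_power T n)" by (simp add: assms blinfun_compose_assoc)
  finally show ?case by (simp add: Suc blinfun_compose_assoc)
qed simp

lemma op_power_add: "op_power T (m + n) = op_power T m o\<^sub>L op_power T n"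
  by (induction m) (simp_all add: blinfun_compose_assoc)

lemma op_power_in_bounded_ops [simp, intro]: "T \<in> bounded_ops \<Longrightarrow> op_power T n \<in> bounded_ops"
  by (induction n) auto

text \<open>The geometric series of powers of \<open>X\<close>. The commutation clause is what puts
  the inverse into \<open>bounded_ops\<close>: it commutes with the scalars because \<open>X\<close>
  does.\<close>

lemma neumann:
  fixes X :: "'a :: banach \<Rightarrow>\<^sub>L 'a"
  assumes "norm X < 1"
  obtains S where "S o\<^sub>L (id_blinfun - X) = id_blinfun" "(id_blinfun - X) o\<^sub>L S = id_blinfun"
    "\<And>A. A o\<^sub>L X = X o\<^sub>L A \<Longrightarrow> A o\<^sub>L S = S o\<^sub>L A"
proof -
  define p where "p = op_power X"
  have np: "norm (p n) \<le> norm X ^ n * norm (id_blinfun :: 'a \<Rightarrow>\<^sub>L 'a)" for n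
  proof (induction n)
    case (Suc n)
    have "norm (p (Suc n)) \<le> norm X * norm (p n)" by (simp add: p_def norm_blinfun_compose)
    also have "\<dots> \<le> norm X * (norm X ^ n * norm (id_blinfun :: 'a \<Rightarrow>\<^sub>L 'a))"
      using Suc by (rule mult_left_mono) simp
    finally show ?case by (simp add: mult.assoc)
  qed (simp add: p_def)
  have sg: "summable (\<lambda>n. norm X ^ n * norm (id_blinfun :: 'a \<Rightarrow>\<^sub>L 'a))"
    using assms by (intro summable_mult2 summable_geometric) simp
  have sm: "summable p"
    by (rule summable_comparison_test'[OF sg]) (use np in simp)
  define S where "S = suminf p"
  have comm: "A o\<^sub>L S = S o\<^sub>L A" if "A o\<^sub>L X = X o\<^sub>L A" for A
    unfolding S_def
    using bounded_linear.suminf[OF blinfun_compose.bounded_linear_right sm, of A]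
      bounded_linear.suminf[OF blinfun_compose.bounded_linear_left sm, of A] op_power_commute[OF that]
    by (simp add: p_def)
  have "X o\<^sub>L S = (\<Sum>n. p (Suc n))"
    unfolding S_def
    using bounded_linear.suminf[OF blinfun_compose.bounded_linear_right sm, of X] by (simp add: p_def)
  also have "\<dots> = S - id_blinfun"
    using suminf_split_head[OF sm] by (simp add: S_def p_def)
  finally have XS: "X o\<^sub>L S = S - id_blinfun" .
  have r: "(id_blinfun - X) o\<^sub>L S = id_blinfun"
    by (simp add: blinfun_compose.diff_left XS)
  have "S o\<^sub>L X = S - id_blinfun" using comm[of X] XS by simp
  then have l: "S o\<^sub>L (id_blinfun - X) = id_blinfun"
    by (simp add: blinfun_compose.diff_right)
  show ?thesis by (rule that[OF l r comm])
qed

lemma op_invertibleI: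
  "S \<in> bounded_ops \<Longrightarrow> S o\<^sub>L T = id_blinfun \<Longrightarrow> T o\<^sub>L S = id_blinfun \<Longrightarrow> op_invertible T"
  by (auto simp: op_invertible_def)

lemma op_invertible_one_minus:
  fixes X :: "'h :: complex_hilbert \<Rightarrow>\<^sub>L 'h"
  assumes "X \<in> bounded_ops" "norm X < 1"
  shows "op_invertible (id_blinfun - X)"
proof -
  obtain S where S: "S o\<^sub>L (id_blinfun - X) = id_blinfun" "(id_blinfun - X) o\<^sub>L S = id_blinfun"
    "\<And>A. A o\<^sub>L X = X o\<^sub>L A \<Longrightarrow> A o\<^sub>L S = S o\<^sub>L A"
    using neumann[OF assms(2)] by metis
  have "S \<in> bounded_ops"
    unfolding bounded_ops_eq_commutant using S(3)[of "scalar_op _"] scalar_op_commute[OF assms(1)] by auto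
  then show ?thesis using S by (auto intro: op_invertibleI)
qed

lemma op_invertible_compose:
  assumes "op_invertible S" "op_invertible T"
  shows "op_invertible (S o\<^sub>L T)"
proof -
  obtain S' T' where *: "S' \<in> bounded_ops" "S' o\<^sub>L S = id_blinfun" "S o\<^sub>L S' = id_blinfun"
    "T' \<in> bounded_ops" "T' o\<^sub>L T = id_blinfun" "T o\<^sub>L T' = id_blinfun"
    using assms by (auto simp: op_invertible_def)
  have "(T' o\<^sub>L S') o\<^sub>L (S o\<^sub>L T) = T' o\<^sub>L (S' o\<^sub>L S) o\<^sub>L T"
    by (simp only: blinfun_compose_assoc)
  moreover have "(S o\<^sub>L T) o\<^sub>L (T' o\<^sub>L S') = S o\<^sub>L (T o\<^sub>L T') o\<^sub>L S'"
    by (simp only: blinfun_compose_assoc)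
  ultimately show ?thesis
    using * by (intro op_invertibleI[of "T' o\<^sub>L S'"]) auto
qed

lemma op_invertible_scalar_op: "c \<noteq> 0 \<Longrightarrow> op_invertible (scalar_op c)"
  by (rule op_invertibleI[of "scalar_op (inverse c)"]) (auto simp: scalar_op_mult)

lemma unitary_op_invertible: "unitary_op u \<Longrightarrow> op_invertible u"
  by (auto simp: unitary_op_def intro: op_invertibleI[of "adj u"])

lemma norm_unitary_apply:
  assumes "unitary_op u" shows "norm (blinfun_apply u x) = norm x"
proof -
  have "cinner (u x) (u x) = cinner (adj u (u x)) x"
    using assms by (simp add: unitary_op_def cinner_adj_left)
  also have "adj u (u x) = (adj u o\<^sub>L u) x" by simp
  also have "\<dots> = x" using assms by (simp add: unitary_op_def)
  finally have "(norm (u x))\<^sup>2 = (norm x)\<^sup>2" by (metis Re_cinner_self)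
  then show ?thesis by (simp add: power2_eq_iff_nonneg)
qed

lemma norm_unitary_compose:
  fixes u A :: "'h :: complex_hilbert \<Rightarrow>\<^sub>L 'h"
  assumes "unitary_op u"
  shows "norm (u o\<^sub>L A) = norm A"
proof (rule antisym)
  show "norm (u o\<^sub>L A) \<le> norm A"
    by (rule norm_blinfun_bound) (simp_all add: norm_unitary_apply[OF assms] norm_blinfun)
  show "norm A \<le> norm (u o\<^sub>L A)"
  proof (rule norm_blinfun_bound)
    show "norm (A x) \<le> norm (u o\<^sub>L A) * norm x" for x
      using norm_blinfun[of "u o\<^sub>L A" x] by (simp add: norm_unitary_apply[OF assms])
  qed simp
qed

section \<open>Continuous functions on the circle\<close>

text \<open>Only density and an induction principle are needed, so coefficients are never recorded;
  the three rules reappear as cases of \<open>continuous_circle_induct\<close>.\<close>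

inductive laurent_poly :: "(complex \<Rightarrow> complex) \<Rightarrow> bool" where
  powi: "laurent_poly (\<lambda>z. z powi k)"
| scale: "laurent_poly p \<Longrightarrow> laurent_poly (\<lambda>z. c * p z)"
| add: "laurent_poly p \<Longrightarrow> laurent_poly q \<Longrightarrow> laurent_poly (\<lambda>z. p z + q z)"

lemma continuous_on_powi_circle: "continuous_on (sphere 0 1) (\<lambda>z :: complex. z powi k)"
  by (intro continuous_intros) auto

lemma laurent_poly_continuous: "laurent_poly p \<Longrightarrow> continuous_on (sphere 0 1) p"
  by (induction rule: laurent_poly.induct) (auto intro!: continuous_intros continuous_on_powi_circle simp del: power_int_eq_0_iff)

text \<open>The product is matched only on the circle: the exponent law for \<open>powi\<close>
  fails at 0, for instance for exponents 1 and -1.\<close>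

lemma laurent_poly_mult:
  assumes "laurent_poly p" "laurent_poly q"
  shows "\<exists>r. laurent_poly r \<and> (\<forall>z\<in>sphere 0 1. r z = p z * q z)"
  using assms
proof (induction rule: laurent_poly.induct)
  case (powi k)
  then show ?case
  proof (induction rule: laurent_poly.induct)
    case (powi l)
    have "z powi (k + l) = z powi k * z powi l" if "z \<in> sphere 0 1" for z :: complex
      using that by (intro power_int_add) auto
    then show ?case using laurent_poly.powi[of "k + l"] by blast
  next
    case (scale q c)
    then obtain r where "laurent_poly r" "\<forall>z\<in>sphere 0 1. r z = z powi k * q z" by blast
    then show ?case using laurent_poly.scale[of r c] by (intro exI[of _ "\<lambda>z. c * r z"]) auto
  next
    case (add p q)
    then obtain r s where "laurent_poly r" "\<forall>z\<in>sphere 0 1. r z = z powi k * p z"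
      "laurent_poly s" "\<forall>z\<in>sphere 0 1. s z = z powi k * q z" by blast
    then show ?case using laurent_poly.add[of r s]
      by (intro exI[of _ "\<lambda>z. r z + s z"]) (auto simp: algebra_simps)
  qed
next
  case (scale p c)
  then obtain r where "laurent_poly r" "\<forall>z\<in>sphere 0 1. r z = p z * q z" by blast
  then show ?case using laurent_poly.scale[of r c] by (intro exI[of _ "\<lambda>z. c * r z"]) auto
next
  case (add p p')
  then obtain r s where "laurent_poly r" "\<forall>z\<in>sphere 0 1. r z = p z * q z"
    "laurent_poly s" "\<forall>z\<in>sphere 0 1. s z = p' z * q z" by blast
  then show ?case using laurent_poly.add[of r s]
    by (intro exI[of _ "\<lambda>z. r z + s z"]) (auto simp: algebra_simps)
qed

lemma laurent_poly_const: "laurent_poly (\<lambda>z. c)"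
  using laurent_poly.scale[OF laurent_poly.powi[of 0], of c] by simp

lemma cnj_circle: "z \<in> sphere 0 1 \<Longrightarrow> cnj z = inverse z" for z :: complex
  by (rule inverse_unique[symmetric]) (simp flip: complex_norm_square)

text \<open>Polynomial functions are built from real-linear functionals, and each of these is a
  complex combination of \<open>z\<close> and \<open>cnj z\<close>. This turns Stone-Weierstrass
  into a statement about those two generators, both on the circle and on the spectrum of an
  operator.\<close>

lemma polynomial_function_complex_induct [consumes 1, case_names const id cnj add mult]:
  fixes p :: "complex \<Rightarrow> complex"
  assumes p: "polynomial_function p"
    and const: "\<And>c. P (\<lambda>z. c)" and id: "P (\<lambda>z. z)" and cnj: "P (\<lambda>z. cnj z)"
    and add: "\<And>f g. P f \<Longrightarrow> P g \<Longrightarrow> P (\<lambda>z. f z + g z)"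
    and mult: "\<And>f g. P f \<Longrightarrow> P g \<Longrightarrow> P (\<lambda>z. f z * g z)"
  shows "P p"
proof -
  have real: "P (\<lambda>z. complex_of_real (f z))" if "real_polynomial_function f" for f :: "complex \<Rightarrow> real"
    using that
  proof (induction rule: real_polynomial_function.induct)
    case (linear f)
    interpret bounded_linear f by fact
    \<comment> \<open>From \<open>Re z = (z + cnj z) / 2\<close> and
      \<open>Im z = (z - cnj z) / (2 * \<i>)\<close>.\<close>
    define a b where "a = complex_of_real (f 1) / 2" and "b = complex_of_real (f \<i>) / (2 * \<i>)"
    have "complex_of_real (f z) = a * (z + cnj z) + b * (z + - 1 * cnj z)" for z
    proof -
      have "f z = f (Re z *\<^sub>R 1 + Im z *\<^sub>R \<i>)" by (rule arg_cong[where f = f]) (simp add: complex_eq_iff)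
      also have "\<dots> = Re z * f 1 + Im z * f \<i>" by (simp add: add scaleR)
      finally show ?thesis by (simp add: complex_eq_iff a_def b_def)
    qed
    moreover have "P (\<lambda>z. a * (z + cnj z) + b * (z + - 1 * cnj z))"
      by (intro const id cnj mult assms(5))
    ultimately show ?case by (simp only:)
  qed (simp_all add: const assms(5,6))
  have "real_polynomial_function (Re \<circ> p)" "real_polynomial_function (Im \<circ> p)"
    using p bounded_linear_Re bounded_linear_Im by (auto simp: polynomial_function_def)
  then have "P (\<lambda>z. complex_of_real ((Re \<circ> p) z) + \<i> * complex_of_real ((Im \<circ> p) z))"
    by (intro add mult const real)
  also have "(\<lambda>z. complex_of_real ((Re \<circ> p) z) + \<i> * complex_of_real ((Im \<circ> p) z)) = p"
    by (simp add: complex_eq_iff fun_eq_iff)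
  finally show ?thesis .
qed

text \<open>On the circle \<open>cnj z\<close> equals \<open>z powi (- 1)\<close>, so polynomials in
  \<open>z\<close> and \<open>cnj z\<close> restrict to Laurent polynomials there.\<close>

lemma laurent_poly_dense:
  assumes "continuous_on (sphere 0 1) (g :: complex \<Rightarrow> complex)" "0 < e"
  shows "\<exists>p. laurent_poly p \<and> (\<forall>z\<in>sphere 0 1. cmod (g z - p z) < e)"
proof -
  obtain h where h: "polynomial_function h" "\<forall>z\<in>sphere 0 1. cmod (g z - h z) < e"
    using Stone_Weierstrass_polynomial_function[OF compact_sphere assms] by auto
  have "\<exists>p. laurent_poly p \<and> (\<forall>z\<in>sphere 0 1. p z = h z)"
    using h(1)
  proof (induction rule: polynomial_function_complex_induct)
    case (const c)
    show ?case using laurent_poly_const by blast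
  next
    case id
    show ?case using laurent_poly.powi[of 1] by (intro exI[of _ "\<lambda>z. z powi 1"]) simp
  next
    case cnj
    show ?case using laurent_poly.powi[of "- 1"]
      by (intro exI[of _ "\<lambda>z. z powi (- 1)"]) (simp add: power_int_minus cnj_circle)
  next
    case (add p q)
    then obtain p' q' where "laurent_poly p'" "\<forall>z\<in>sphere 0 1. p' z = p z"
      "laurent_poly q'" "\<forall>z\<in>sphere 0 1. q' z = q z" by blast
    then show ?case using laurent_poly.add[of p' q'] by (intro exI[of _ "\<lambda>z. p' z + q' z"]) auto
  next
    case (mult p q)
    then obtain p' q' where *: "laurent_poly p'" "\<forall>z\<in>sphere 0 1. p' z = p z"
      "laurent_poly q'" "\<forall>z\<in>sphere 0 1. q' z = q z" by blast
    with laurent_poly_mult[OF *(1,3)] show ?case by auto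
  qed
  then show ?thesis using h(2) by metis
qed

text \<open>The common scheme for multiplicativity and rotation of the calculus, for the trace
  formula and for approximate coboundaries: compute on powers, extend linearly, pass to uniform
  limits.\<close>

lemma continuous_circle_induct [consumes 1, case_names powi scale add approx]:
  fixes g :: "complex \<Rightarrow> complex"
  assumes "continuous_on (sphere 0 1) g"
    and powi: "\<And>k. P (\<lambda>z. z powi k)"
    and scale: "\<And>c p. continuous_on (sphere 0 1) p \<Longrightarrow> P p \<Longrightarrow> P (\<lambda>z. c * p z)"
    and add: "\<And>p q. continuous_on (sphere 0 1) p \<Longrightarrow> continuous_on (sphere 0 1) q \<Longrightarrow>
        P p \<Longrightarrow> P q \<Longrightarrow> P (\<lambda>z. p z + q z)"
    and approx: "\<And>g p. continuous_on (sphere 0 1) g \<Longrightarrow> (\<And>n :: nat. continuous_on (sphere 0 1) (p n)) \<Longrightarrow>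
        (\<And>n. P (p n)) \<Longrightarrow> uniform_limit (sphere 0 1) p g sequentially \<Longrightarrow> P g"
  shows "P g"
proof -
  have "\<exists>p. laurent_poly p \<and> (\<forall>z\<in>sphere 0 1. cmod (g z - p z) < 1 / Suc n)" for n
    by (rule laurent_poly_dense[OF assms(1)]) simp
  then obtain p where p: "\<And>n. laurent_poly (p n)" "\<And>n z. z \<in> sphere 0 1 \<Longrightarrow> cmod (g z - p n z) < 1 / Suc n"
    by metis
  have "P q" if "laurent_poly q" for q
    using that by (induction rule: laurent_poly.induct) (auto intro: powi scale add laurent_poly_continuous)
  moreover have "uniform_limit (sphere 0 1) p g sequentially"
  proof (rule uniform_limitI)
    fix e :: real assume "0 < e"
    then have "\<forall>\<^sub>F n in sequentially. 1 / Suc n < e"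
      using order_tendstoD(2)[OF LIMSEQ_inverse_real_of_nat] by (simp add: inverse_eq_divide)
    then show "\<forall>\<^sub>F n in sequentially. \<forall>z\<in>sphere 0 1. dist (p n z) (g z) < e"
    proof eventually_elim
      case (elim n)
      then show ?case
        using p(2)[of _ n] less_trans by (fastforce simp: dist_norm norm_minus_commute)
    qed
  qed
  ultimately show ?thesis
    using p(1) laurent_poly_continuous by (intro approx[OF assms(1), of p]) auto
qed

lemma continuous_circle_bounded:
  fixes g :: "complex \<Rightarrow> complex"
  assumes "continuous_on (sphere 0 1) g"
  obtains B where "0 < B" "\<And>z. z \<in> sphere 0 1 \<Longrightarrow> cmod (g z) \<le> B"
proof -
  have "compact (g ` sphere 0 1)" by (rule compact_continuous_image[OF assms]) simp
  then show ?thesis using that by (auto simp: bounded_pos dest!: compact_imp_bounded)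
qed

lemma continuous_circle_attains_sup:
  fixes g :: "complex \<Rightarrow> real"
  assumes "continuous_on (sphere 0 1) g"
  obtains z where "z \<in> sphere 0 1" "\<And>w. w \<in> sphere 0 1 \<Longrightarrow> g w \<le> g z"
proof -
  have "sphere (0 :: complex) 1 \<noteq> {}" by (auto intro!: exI[of _ 1])
  then show ?thesis using continuous_attains_sup[OF compact_sphere _ assms] that by auto
qed

lemma irrational_rotation_orbit_dense:
  fixes w z :: complex
  assumes "\<theta> \<notin> \<rat>" "w \<in> sphere 0 1" "z \<in> sphere 0 1" "0 < e"
  obtains n :: nat where "cmod (cis (2 * pi * \<theta>) ^ n * w - z) < e"
proof -
  obtain s where s: "z / w = cis (2 * pi * s)"
  proof -
    have "cmod (z / w) = 1" using assms by (simp add: norm_divide)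
    then obtain a where "z / w = cis a" by (metis complex_norm_eq_1_exp cis_conv_exp mult.commute)
    then show ?thesis using that[of "a / (2 * pi)"] by simp
  qed
  have "0 < e / (2 * pi)" using assms by simp
  then obtain h k where hk: "\<bar>of_int h * \<theta> - of_int k - s\<bar> < e / (2 * pi)" "0 < h"
    using sequence_of_fractional_parts_is_dense[OF assms(1)] by metis
  define x where "x = of_int h * \<theta> - of_int k - s"
  have "cis (2 * pi * \<theta>) ^ nat h = cis (2 * pi * (of_int h * \<theta>))"
    using hk(2) by (simp add: Complex.DeMoivre mult_ac)
  also have "of_int h * \<theta> = x + s + of_int k" by (simp add: x_def)
  also have "cis (2 * pi * (x + s + of_int k)) = cis (2 * pi * x) * cis (2 * pi * s)"
  proof -
    have "cis (2 * pi * of_int k) = 1" by (rule cis_multiple_2pi) auto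
    then show ?thesis by (simp add: distrib_left flip: cis_mult)
  qed
  finally have *: "cis (2 * pi * \<theta>) ^ nat h * w - z = (cis (2 * pi * x) - 1) * z"
  proof -
    assume *: "cis (2 * pi * \<theta>) ^ nat h = cis (2 * pi * x) * cis (2 * pi * s)"
    have "w \<noteq> 0" using assms(2) by auto
    then have "z = cis (2 * pi * s) * w" using s by (simp add: field_simps)
    then show ?thesis unfolding * by (simp add: algebra_simps)
  qed
  \<comment> \<open>A chord is no longer than its arc.\<close>
  have "cmod (cis (2 * pi * x) - 1) \<le> \<bar>2 * pi * x\<bar>"
    using dist_exp_i_1[of "2 * pi * x"] abs_sin_x_le_abs_x[of "pi * x"]
    by (simp add: cis_conv_exp abs_mult)
  also have "\<dots> = 2 * pi * \<bar>x\<bar>" by (simp add: abs_mult)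
  also have "\<dots> < e" using hk(1) unfolding x_def[symmetric] by (simp add: field_simps)
  finally show ?thesis
    using that[of "nat h"] assms by (simp add: * norm_mult)
qed

section \<open>Functional calculus of a unitary\<close>

lemma blinfun_norm_le_cinner:
  fixes A :: "'h :: complex_hilbert \<Rightarrow>\<^sub>L 'h"
  assumes "0 \<le> C" "\<And>x y. cmod (cinner x (blinfun_apply A y)) \<le> C * norm x * norm y"
  shows "norm A \<le> C"
proof (rule norm_blinfun_bound[OF assms(1)])
  fix y
  show "norm (blinfun_apply A y) \<le> C * norm y"
  proof (cases "blinfun_apply A y = 0")
    case False
    have "norm (blinfun_apply A y) * norm (blinfun_apply A y) = cmod (cinner (blinfun_apply A y) (blinfun_apply A y))"
      by (simp add: cinner_self_norm norm_power power2_eq_square norm_mult)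
    also have "\<dots> \<le> norm (blinfun_apply A y) * (C * norm y)"
      using assms(2)[of "blinfun_apply A y" y] by (simp add: mult_ac)
    finally show ?thesis using False by simp
  qed (simp add: assms(1))
qed

lemma cis_eq_1_iff: "cis t = 1 \<longleftrightarrow> (\<exists>n :: int. t = 2 * pi * of_int n)"
  by (auto simp: cis_conv_exp exp_eq_1 mult_ac)

text \<open>Discrete orthogonality. The bound on \<open>l\<close> excludes nonzero multiples of
  \<open>M\<close>, for which the sum would again be \<open>M\<close>.\<close>

lemma sum_roots_of_unity_powi:
  assumes "0 < M" "\<bar>l\<bar> < int M"
  shows "(\<Sum>j<M. cis (2 * pi * real j / real M) powi l) = (if l = 0 then of_nat M else 0)"
proof (cases "l = 0")
  case False
  define x where "x = cis (2 * pi * of_int l / real M)"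
  have "x \<noteq> 1"
  proof
    assume "x = 1"
    then obtain n :: int where "2 * pi * of_int l / real M = 2 * pi * of_int n"
      unfolding x_def cis_eq_1_iff by blast
    then have "real_of_int l = of_int (n * int M)" using assms by (simp add: field_simps)
    then have "l = n * int M" by (simp only: of_int_eq_iff)
    then show False using assms False
      by (metis abs_mult abs_of_nat dvd_triv_right zdvd_imp_le abs_dvd_iff dvd_abs_iff not_less zero_less_abs_iff)
  qed
  have "x ^ M = cis (2 * pi * of_int l)" using assms by (simp add: x_def Complex.DeMoivre)
  also have "\<dots> = 1" by (auto simp: cis_eq_1_iff)
  finally have "x ^ M = 1" .
  have "cis (2 * pi * real j / real M) powi l = x ^ j" for j
    by (simp add: cis_power_int x_def Complex.DeMoivre mult_ac)
  then show ?thesis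
    using False geometric_sum[OF \<open>x \<noteq> 1\<close>, of M] \<open>x ^ M = 1\<close> by simp
qed simp

text \<open>The length of the \<open>k\<close>-th diagonal of an \<open>N\<close> by
  \<open>N\<close> array, which becomes the Fejer weight of the power \<open>k\<close>.\<close>

lemma card_shift_inter:
  assumes "\<bar>k\<bar> \<le> int N"
  shows "card {a \<in> {..<N}. 0 \<le> int a + k \<and> int a + k < int N} = N - nat \<bar>k\<bar>"
proof -
  have "{a \<in> {..<N}. 0 \<le> int a + k \<and> int a + k < int N} = {nat (- k)..<min N (nat (int N - k))}"
    by (intro set_eqI iffI) (simp_all, arith+)
  then have "card {a \<in> {..<N}. 0 \<le> int a + k \<and> int a + k < int N} = min N (nat (int N - k)) - nat (- k)"
    by (simp only: card_atLeastLessThan)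
  then show ?thesis using assms by arith
qed

section \<open>Integer powers and Fejer sums of a unitary operator\<close>

locale unitary_operator =
  fixes v :: "'h :: complex_hilbert \<Rightarrow>\<^sub>L 'h"
  assumes unitary: "unitary_op v"
begin

lemma v_bounded [simp, intro]: "v \<in> bounded_ops"
  and adj_v_v: "adj v o\<^sub>L v = id_blinfun"
  and v_adj_v: "v o\<^sub>L adj v = id_blinfun"
  using unitary by (auto simp: unitary_op_def)

definition unitary_power :: "int \<Rightarrow> 'h \<Rightarrow>\<^sub>L 'h"
  where "unitary_power k = (if 0 \<le> k then op_power v (nat k) else adj (op_power v (nat (- k))))"

lemma adj_op_power_op_power: "adj (op_power v n) o\<^sub>L op_power v n = id_blinfun"
proof (induction n)
  case (Suc n)
  have "adj (op_power v (Suc n)) o\<^sub>L op_power v (Suc n)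
      = adj (op_power v n) o\<^sub>L ((adj v o\<^sub>L v) o\<^sub>L op_power v n)"
    by (simp add: adj_compose blinfun_compose_assoc)
  then show ?case by (simp add: adj_v_v Suc)
qed simp

lemma op_power_adj_op_power: "op_power v n o\<^sub>L adj (op_power v n) = id_blinfun"
proof (induction n)
  case (Suc n)
  have "op_power v (Suc n) o\<^sub>L adj (op_power v (Suc n))
      = v o\<^sub>L ((op_power v n o\<^sub>L adj (op_power v n)) o\<^sub>L adj v)"
    by (simp add: adj_compose blinfun_compose_assoc)
  then show ?case by (simp add: v_adj_v Suc)
qed simp

text \<open>Every integer is a difference of naturals, so this normal form spares the sign
  distinctions in \<open>unitary_power_add\<close>; it is also the shape in which the Fejer double
  sum produces its powers.\<close>

lemma adj_op_power_compose_op_power: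
  "adj (op_power v a) o\<^sub>L op_power v b = unitary_power (int b - int a)"
proof (cases "a \<le> b")
  case True
  then have "op_power v b = op_power v a o\<^sub>L op_power v (b - a)"
    by (simp flip: op_power_add)
  then have "adj (op_power v a) o\<^sub>L op_power v b = op_power v (b - a)"
    by (simp add: adj_op_power_op_power flip: blinfun_compose_assoc)
  moreover have "nat (int b - int a) = b - a" by simp
  ultimately show ?thesis using True by (simp add: unitary_power_def)
next
  case False
  then have "op_power v a = op_power v b o\<^sub>L op_power v (a - b)"
    by (simp flip: op_power_add)
  then have "adj (op_power v a) o\<^sub>L op_power v b = adj (op_power v (a - b))"
    by (simp add: adj_compose adj_op_power_op_power blinfun_compose_assoc)
  moreover have "nat (- (int b - int a)) = a - b" by simp
  ultimately show ?thesis using False by (simp add: unitary_power_def)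
qed

lemma op_power_adj_commute:
  "op_power v b o\<^sub>L adj (op_power v a) = adj (op_power v a) o\<^sub>L op_power v b"
proof -
  have c: "op_power v a o\<^sub>L op_power v b = op_power v b o\<^sub>L op_power v a"
    by (simp add: add.commute flip: op_power_add)
  have "op_power v b o\<^sub>L adj (op_power v a)
      = (adj (op_power v a) o\<^sub>L op_power v a) o\<^sub>L op_power v b o\<^sub>L adj (op_power v a)"
    by (simp add: adj_op_power_op_power)
  also have "\<dots> = adj (op_power v a) o\<^sub>L (op_power v a o\<^sub>L op_power v b) o\<^sub>L adj (op_power v a)"
    by (simp add: blinfun_compose_assoc)
  also have "\<dots> = adj (op_power v a) o\<^sub>L op_power v b o\<^sub>L (op_power v a o\<^sub>L adj (op_power v a))"
    by (simp add: c blinfun_compose_assoc)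
  finally show ?thesis by (simp add: op_power_adj_op_power)
qed

lemma unitary_power_bounded [simp, intro]: "unitary_power k \<in> bounded_ops"
  by (auto simp: unitary_power_def)

lemma unitary_power_0 [simp]: "unitary_power 0 = id_blinfun"
  by (simp add: unitary_power_def)

lemma unitary_power_1 [simp]: "unitary_power 1 = v"
  by (simp add: unitary_power_def)

lemma unitary_power_add: "unitary_power (k + l) = unitary_power k o\<^sub>L unitary_power l"
proof -
  have rep: "\<exists>a b. m = int b - int a" for m :: int
    by (rule exI[of _ "nat (- m)"], rule exI[of _ "nat m"]) auto
  obtain a b where k: "k = int b - int a" using rep by blast
  obtain c d where l: "l = int d - int c" using rep by blast
  have "unitary_power k o\<^sub>L unitary_power l
      = adj (op_power v a) o\<^sub>L (op_power v b o\<^sub>L adj (op_power v c)) o\<^sub>L op_power v d"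
    by (simp add: k l blinfun_compose_assoc flip: adj_op_power_compose_op_power)
  also have "\<dots> = adj (op_power v c o\<^sub>L op_power v a) o\<^sub>L (op_power v b o\<^sub>L op_power v d)"
    by (simp add: op_power_adj_commute adj_compose blinfun_compose_assoc)
  also have "\<dots> = unitary_power (int (b + d) - int (c + a))"
    by (simp only: adj_op_power_compose_op_power flip: op_power_add)
  finally show ?thesis by (simp add: k l algebra_simps)
qed

text \<open>Averaging \<open>g\<close> against the Fejer kernel \<open>F\<^sub>N(z\<inverse> v)\<close> over the \<open>2N\<close>-th roots of
  unity \<open>z\<close>. The kernel is positive, hence the average is a contraction in \<open>g\<close>, and no
  statement about trigonometric polynomials in \<open>v\<close> being well defined is needed.\<close>

definition fejer_factor :: "nat \<Rightarrow> complex \<Rightarrow> 'h \<Rightarrow>\<^sub>L 'h"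
  where "fejer_factor N z = (\<Sum>a<N. scalar_op (cnj z ^ a) o\<^sub>L op_power v a)"

definition root_of_unity :: "nat \<Rightarrow> nat \<Rightarrow> complex"
  where "root_of_unity N j = cis (2 * pi * real j / real (2 * N))"

text \<open>The divisor is the number \<open>2 * N\<close> of nodes times the Fejer normalization
  \<open>N\<close>.\<close>

definition fejer_calc :: "nat \<Rightarrow> (complex \<Rightarrow> complex) \<Rightarrow> 'h \<Rightarrow>\<^sub>L 'h"
  where "fejer_calc N g = (\<Sum>j<2 * N. scalar_op (g (root_of_unity N j) / of_nat (2 * N * N))
    o\<^sub>L (adj (fejer_factor N (root_of_unity N j)) o\<^sub>L fejer_factor N (root_of_unity N j)))"

lemma norm_root_of_unity [simp]: "cmod (root_of_unity N j) = 1"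
  by (simp add: root_of_unity_def)

lemma fejer_factor_bounded [simp, intro]: "fejer_factor N z \<in> bounded_ops"
  by (auto simp: fejer_factor_def intro: bounded_ops_sum)

lemma fejer_calc_bounded [simp, intro]: "fejer_calc N g \<in> bounded_ops"
  by (auto simp: fejer_calc_def intro: bounded_ops_sum)

lemma adj_fejer_factor_compose:
  assumes "z \<in> sphere 0 1"
  shows "adj (fejer_factor N z) o\<^sub>L fejer_factor N z
    = (\<Sum>a<N. \<Sum>b<N. scalar_op (z powi (int a - int b)) o\<^sub>L unitary_power (int b - int a))"
proof -
  have z: "z \<noteq> 0" "cnj z = inverse z" using assms cnj_circle by auto
  have "adj (fejer_factor N z) = (\<Sum>a<N. scalar_op (z ^ a) o\<^sub>L adj (op_power v a))"
    unfolding fejer_factor_def by (subst adj_sum) (auto simp: adj_compose scalar_op_commute)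
  then have "adj (fejer_factor N z) o\<^sub>L fejer_factor N z = (\<Sum>a<N. \<Sum>b<N.
      (scalar_op (z ^ a) o\<^sub>L adj (op_power v a)) o\<^sub>L (scalar_op (cnj z ^ b) o\<^sub>L op_power v b))"
    by (simp only: fejer_factor_def blinfun_compose.sum_left blinfun_compose.sum_right)
      (rule sum.swap)
  also have "\<dots> = (\<Sum>a<N. \<Sum>b<N. scalar_op (z powi (int a - int b)) o\<^sub>L unitary_power (int b - int a))"
  proof (intro sum.cong refl)
    fix a b
    have "z ^ a * cnj z ^ b = z powi (int a - int b)"
      using z by (simp add: power_int_diff power_inverse divide_inverse)
    then show "(scalar_op (z ^ a) o\<^sub>L adj (op_power v a)) o\<^sub>L (scalar_op (cnj z ^ b) o\<^sub>L op_power v b)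
      = scalar_op (z powi (int a - int b)) o\<^sub>L unitary_power (int b - int a)"
      by (simp add: blinfun_compose_assoc scalar_op_left_commute scalar_op_mult_left
          adj_op_power_compose_op_power)
  qed
  finally show ?thesis .
qed

text \<open>Summing over the nodes kills every pair of exponents except those with
  \<open>b = a + k\<close>, of which \<open>N - \<bar>k\<bar>\<close> remain. The factor is the
  usual Fejer multiplier and tends to 1.\<close>

lemma fejer_calc_powi:
  assumes "\<bar>k\<bar> \<le> int N" "0 < N"
  shows "fejer_calc N (\<lambda>z. z powi k) = (real (N - nat \<bar>k\<bar>) / real N) *\<^sub>R unitary_power k"
proof -
  let ?z = "root_of_unity N"
  have nz: "?z j \<noteq> 0" for j by (simp add: root_of_unity_def)
  have "fejer_calc N (\<lambda>z. z powi k)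
      = (\<Sum>j<2*N. \<Sum>a<N. \<Sum>b<N. scalar_op (?z j powi (k + int a - int b) / of_nat (2 * N * N))
          o\<^sub>L unitary_power (int b - int a))"
    unfolding fejer_calc_def
  proof (rule sum.cong[OF refl])
    fix j
    have "?z j powi k * ?z j powi (int a - int b) = ?z j powi (k + int a - int b)" for a b
      using nz[of j] by (simp add: add_diff_eq flip: power_int_add)
    then show "scalar_op (?z j powi k / of_nat (2 * N * N)) o\<^sub>L (adj (fejer_factor N (?z j)) o\<^sub>L fejer_factor N (?z j))
      = (\<Sum>a<N. \<Sum>b<N. scalar_op (?z j powi (k + int a - int b) / of_nat (2 * N * N))
          o\<^sub>L unitary_power (int b - int a))"
      by (simp add: adj_fejer_factor_compose blinfun_compose.sum_right scalar_op_mult_left del: of_nat_mult)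
  qed
  also have "\<dots> = (\<Sum>a<N. \<Sum>b<N. \<Sum>j<2*N. scalar_op (?z j powi (k + int a - int b) / of_nat (2 * N * N))
          o\<^sub>L unitary_power (int b - int a))"
    by (subst sum.swap) (intro sum.cong refl sum.swap)
  also have "\<dots> = (\<Sum>a<N. \<Sum>b<N. scalar_op ((\<Sum>j<2*N. ?z j powi (k + int a - int b)) / of_nat (2 * N * N))
          o\<^sub>L unitary_power (int b - int a))"
    by (simp add: linear_sum[OF bounded_linear.linear[OF bounded_linear_scalar_op]]
        sum_divide_distrib blinfun_compose.sum_left)
  also have "\<dots> = (\<Sum>a<N. \<Sum>b<N. if int b = int a + k then scalar_op (1 / of_nat N) o\<^sub>L unitary_power k else 0)"
  proof (intro sum.cong refl)
    fix a b assume "a \<in> {..<N}" "b \<in> {..<N}"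
    \<comment> \<open>With \<open>\<bar>k\<bar> \<le> N\<close> and
      \<open>\<bar>a - b\<bar> < N\<close> the exponent can exceed \<open>N\<close>; this is why
      \<open>2 * N\<close> nodes are used.\<close>
    then have "\<bar>k + int a - int b\<bar> < int (2 * N)" using assms by auto
    moreover have "?z j = cis (2 * pi * real j / real (2 * N))" for j by (simp add: root_of_unity_def)
    ultimately have "(\<Sum>j<2*N. ?z j powi (k + int a - int b)) = (if k + int a - int b = 0 then of_nat (2 * N) else 0)"
      using sum_roots_of_unity_powi[of "2 * N" "k + int a - int b"] assms by simp
    then show "scalar_op ((\<Sum>j<2*N. ?z j powi (k + int a - int b)) / of_nat (2 * N * N)) o\<^sub>L unitary_power (int b - int a)
      = (if int b = int a + k then scalar_op (1 / of_nat N) o\<^sub>L unitary_power k else 0)"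
      using assms by (auto simp: field_simps)
  qed
  also have "\<dots> = (\<Sum>a<N. if 0 \<le> int a + k \<and> int a + k < int N then scalar_op (1 / of_nat N) o\<^sub>L unitary_power k else 0)"
  proof (intro sum.cong refl)
    fix a
    let ?X = "scalar_op (1 / of_nat N) o\<^sub>L unitary_power k"
    have "(\<Sum>b<N. if int b = int a + k then ?X else 0) = (\<Sum>b<N. if nat (int a + k) = b then (if 0 \<le> int a + k then ?X else 0) else 0)"
      by (intro sum.cong refl) auto
    also have "\<dots> = (if 0 \<le> int a + k \<and> int a + k < int N then ?X else 0)"
      by (subst sum.delta') auto
    finally show "(\<Sum>b<N. if int b = int a + k then ?X else 0) = (if 0 \<le> int a + k \<and> int a + k < int N then ?X else 0)" .
  qed
  also have "\<dots> = of_nat (N - nat \<bar>k\<bar>) *\<^sub>R (scalar_op (1 / of_nat N) o\<^sub>L unitary_power k)"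
    by (subst sum.inter_filter[symmetric]) (simp_all only: sum_constant_scaleR card_shift_inter[OF assms(1)] finite_lessThan)
  also have "\<dots> = (real (N - nat \<bar>k\<bar>) / real N) *\<^sub>R unitary_power k"
  proof -
    have "(scalar_op (1 / of_nat N) :: 'h \<Rightarrow>\<^sub>L 'h) = (1 / real N) *\<^sub>R id_blinfun"
      using scalar_op_of_real[of "1 / real N"] by simp
    then show ?thesis by (simp add: blinfun_compose.scaleR_left del: of_nat_diff)
  qed
  finally show ?thesis .
qed

lemma fejer_calc_one: "0 < N \<Longrightarrow> fejer_calc N (\<lambda>z. 1) = id_blinfun"
  using fejer_calc_powi[of 0 N] by simp

lemma fejer_calc_add: "fejer_calc N (\<lambda>z. f z + g z) = fejer_calc N f + fejer_calc N g"
  by (simp add: fejer_calc_def add_divide_distrib scalar_op_add blinfun_compose.add_left sum.distrib)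

lemma fejer_calc_scale: "fejer_calc N (\<lambda>z. c * f z) = scalar_op c o\<^sub>L fejer_calc N f"
  by (simp add: fejer_calc_def blinfun_compose.sum_right scalar_op_mult_left)

lemma fejer_calc_cong:
  "(\<And>z. z \<in> sphere 0 1 \<Longrightarrow> f z = g z) \<Longrightarrow> fejer_calc N f = fejer_calc N g"
  by (simp add: fejer_calc_def)

lemma adj_fejer_calc: "adj (fejer_calc N g) = fejer_calc N (\<lambda>z. cnj (g z))"
  unfolding fejer_calc_def
  by (subst adj_sum) (auto simp: adj_compose scalar_op_commute)

lemma cinner_fejer_calc:
  "cinner x (fejer_calc N g y) = (\<Sum>j<2*N. g (root_of_unity N j) / of_nat (2 * N * N) *
     cinner (fejer_factor N (root_of_unity N j) x) (fejer_factor N (root_of_unity N j) y))"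
  by (simp add: fejer_calc_def blinfun.sum_left cinner.sum_right cinner_scaleC_right cinner_adj_right)

text \<open>The weighted squares \<open>adj F o\<^sub>L F\<close> add up to the identity, by the
  case of the constant function 1. Cauchy-Schwarz over the nodes then bounds the sesquilinear form
  by the supremum of \<open>g\<close>.\<close>

lemma norm_fejer_calc_le:
  assumes "0 < N" "0 \<le> C" "\<And>z. z \<in> sphere 0 1 \<Longrightarrow> cmod (g z) \<le> C"
  shows "norm (fejer_calc N g) \<le> C"
proof (rule blinfun_norm_le_cinner[OF assms(2)])
  fix x y
  let ?z = "root_of_unity N" and ?B = "\<lambda>j x. norm (fejer_factor N (root_of_unity N j) x)"
  have sq: "(\<Sum>j<2*N. (?B j x)\<^sup>2) = real (2 * N * N) * (norm x)\<^sup>2" for x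
  proof -
    have "cinner x x = (\<Sum>j<2*N. complex_of_real ((?B j x)\<^sup>2) / of_nat (2 * N * N))"
      using cinner_fejer_calc[of x N "\<lambda>z. 1" x] by (simp add: fejer_calc_one[OF assms(1)] cinner_self_norm)
    also have "\<dots> = complex_of_real ((\<Sum>j<2*N. (?B j x)\<^sup>2) / real (2 * N * N))"
      by (simp add: sum_divide_distrib)
    finally have "(norm x)\<^sup>2 = (\<Sum>j<2*N. (?B j x)\<^sup>2) / real (2 * N * N)"
      by (simp only: cinner_self_norm of_real_eq_iff)
    then show ?thesis using assms(1) by (simp add: field_simps)
  qed
  have "cmod (cinner x (fejer_calc N g y)) \<le> (\<Sum>j<2*N. C / real (2 * N * N) * (?B j x * ?B j y))"
    unfolding cinner_fejer_calc
  proof (rule sum_norm_le)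
    fix j
    show "cmod (g (?z j) / of_nat (2 * N * N) * cinner (fejer_factor N (?z j) x) (fejer_factor N (?z j) y))
      \<le> C / real (2 * N * N) * (?B j x * ?B j y)"
      unfolding norm_mult norm_divide norm_of_nat
      by (intro mult_mono divide_right_mono norm_cinner_le assms(3)) (auto simp: assms(2))
  qed
  also have "\<dots> = C / real (2 * N * N) * (\<Sum>j<2*N. ?B j x * ?B j y)"
    by (simp add: sum_distrib_left)
  also have "\<dots> \<le> C / real (2 * N * N) * (L2_set (\<lambda>j. ?B j x) {..<2*N} * L2_set (\<lambda>j. ?B j y) {..<2*N})"
    using L2_set_mult_ineq[of "\<lambda>j. ?B j x" "\<lambda>j. ?B j y" "{..<2*N}"] assms(2)
    by (intro mult_left_mono) auto
  also have "\<dots> = C / real (2 * N * N) * (real (2 * N * N) * (norm x * norm y))"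
  proof -
    have "sqrt (K * (norm x)\<^sup>2) * sqrt (K * (norm y)\<^sup>2) = K * (norm x * norm y)" if "0 \<le> K" for K
      using that by (simp add: real_sqrt_mult)
    from this[of "real (2 * N * N)"] show ?thesis by (simp only: L2_set_def sq of_nat_0_le_iff)
  qed
  also have "\<dots> = C * norm x * norm y"
    using assms(1) by simp
  finally show "cmod (cinner x (fejer_calc N g y)) \<le> C * norm x * norm y" .
qed

lemma fejer_calc_diff: "fejer_calc N (\<lambda>z. f z - g z) = fejer_calc N f - fejer_calc N g"
  using fejer_calc_add[of N f "\<lambda>z. - 1 * g z"]
  by (simp only: fejer_calc_scale) (simp add: scalar_op_minus blinfun_compose.minus_left)

lemma fejer_calc_powi_tendsto: "(\<lambda>N. fejer_calc N (\<lambda>z. z powi k)) \<longlonglongrightarrow> unitary_power k"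
proof -
  have "(\<lambda>N. 1 - real (nat \<bar>k\<bar>) / real N) \<longlonglongrightarrow> 1 - 0"
    by (intro tendsto_intros lim_const_over_n)
  then have lim: "(\<lambda>N. (1 - real (nat \<bar>k\<bar>) / real N) *\<^sub>R unitary_power k) \<longlonglongrightarrow> (1 - 0) *\<^sub>R unitary_power k"
    by (intro tendsto_intros)
  have "\<forall>\<^sub>F N in sequentially. (1 - real (nat \<bar>k\<bar>) / real N) *\<^sub>R unitary_power k
      = fejer_calc N (\<lambda>z. z powi k)"
    using eventually_ge_at_top[of "nat \<bar>k\<bar>"] eventually_gt_at_top[of 0]
  proof eventually_elim
    case (elim N)
    then show ?case by (subst fejer_calc_powi) (auto simp: of_nat_diff diff_divide_distrib)
  qed
  from Lim_transform_eventually[OF lim this] show ?thesis by simp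
qed

lemma fejer_calc_convergent:
  assumes "continuous_on (sphere 0 1) g"
  shows "convergent (\<lambda>N. fejer_calc N g)"
  using assms
proof (induction rule: continuous_circle_induct)
  case (powi k)
  show ?case by (rule convergentI[OF fejer_calc_powi_tendsto])
next
  case (scale c p)
  then obtain L where "(\<lambda>N. fejer_calc N p) \<longlonglongrightarrow> L" by (auto simp: convergent_def)
  then have "(\<lambda>N. scalar_op c o\<^sub>L fejer_calc N p) \<longlonglongrightarrow> (scalar_op c o\<^sub>L L)"
    by (intro blinfun_compose.tendsto tendsto_const)
  then show ?case unfolding fejer_calc_scale by (rule convergentI)
next
  case (add p q)
  then show ?case by (simp add: fejer_calc_add convergent_add)
next
  case (approx g p)
  have "Cauchy (\<lambda>N. fejer_calc N g)"
  proof (rule metric_CauchyI)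
    fix e :: real assume "0 < e"
    then have "\<forall>\<^sub>F n in sequentially. \<forall>z\<in>sphere 0 1. dist (p n z) (g z) < e / 3"
      by (intro uniform_limitD[OF approx(3)]) simp
    then obtain n where n: "\<forall>z\<in>sphere 0 1. dist (p n z) (g z) < e / 3"
      unfolding eventually_sequentially by blast
    \<comment> \<open>The contraction bound does not depend on \<open>N\<close>, so one approximant
      serves for the whole sequence.\<close>
    have d: "dist (fejer_calc N (p n)) (fejer_calc N g) \<le> e / 3" if "0 < N" for N
      unfolding dist_norm using n \<open>0 < e\<close> that
      by (simp only: fejer_calc_diff[symmetric], intro norm_fejer_calc_le) (auto simp: dist_norm less_imp_le)
    have "Cauchy (\<lambda>N. fejer_calc N (p n))" using approx(4) convergent_Cauchy by blast
    then obtain M where M: "\<And>m k. m \<ge> M \<Longrightarrow> k \<ge> M \<Longrightarrow> dist (fejer_calc m (p n)) (fejer_calc k (p n)) < e / 3"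
      using \<open>0 < e\<close> by (metis metric_CauchyD divide_pos_pos zero_less_numeral)
    have "dist (fejer_calc m g) (fejer_calc k g) < e" if "m \<ge> Suc M" "k \<ge> Suc M" for m k
    proof -
      have "0 < m" "0 < k" "M \<le> m" "M \<le> k" using that by auto
      then show ?thesis
        using d[of m] d[of k] M[of m k]
          dist_triangle[of "fejer_calc m g" "fejer_calc k g" "fejer_calc m (p n)"]
          dist_triangle[of "fejer_calc m (p n)" "fejer_calc k g" "fejer_calc k (p n)"]
          dist_commute[of "fejer_calc m g" "fejer_calc m (p n)"]
        by linarith
    qed
    then show "\<exists>M. \<forall>m\<ge>M. \<forall>n\<ge>M. dist (fejer_calc m g) (fejer_calc n g) < e" by blast
  qed
  then show ?case by (simp add: Cauchy_convergent_iff)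
qed


text \<open>Defined on functions on the whole circle before the spectrum of \<open>v\<close> is
  known. It is a contractive homomorphism in any case; that it is isometric is proved later with the
  help of \<open>u\<close>.\<close>

definition calc :: "(complex \<Rightarrow> complex) \<Rightarrow> 'h \<Rightarrow>\<^sub>L 'h"
  where "calc g = lim (\<lambda>N. fejer_calc N g)"

lemma fejer_calc_tendsto: "continuous_on (sphere 0 1) g \<Longrightarrow> (\<lambda>N. fejer_calc N g) \<longlonglongrightarrow> calc g"
  using fejer_calc_convergent by (simp add: calc_def convergent_LIMSEQ_iff)

lemma calc_eqI: "(\<lambda>N. fejer_calc N g) \<longlonglongrightarrow> A \<Longrightarrow> calc g = A"
  by (simp add: calc_def limI)

lemma calc_powi: "calc (\<lambda>z. z powi k) = unitary_power k"
  by (rule calc_eqI[OF fejer_calc_powi_tendsto])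

lemma calc_cong: "(\<And>z. z \<in> sphere 0 1 \<Longrightarrow> f z = g z) \<Longrightarrow> calc f = calc g"
  using fejer_calc_cong[of f g] by (simp add: calc_def)

lemma calc_add:
  "continuous_on (sphere 0 1) f \<Longrightarrow> continuous_on (sphere 0 1) g \<Longrightarrow> calc (\<lambda>z. f z + g z) = calc f + calc g"
  by (rule calc_eqI) (simp add: fejer_calc_add tendsto_add fejer_calc_tendsto)

lemma calc_scale:
  "continuous_on (sphere 0 1) f \<Longrightarrow> calc (\<lambda>z. c * f z) = scalar_op c o\<^sub>L calc f"
  by (rule calc_eqI) (simp add: fejer_calc_scale blinfun_compose.tendsto fejer_calc_tendsto)

lemma calc_diff:
  "continuous_on (sphere 0 1) f \<Longrightarrow> continuous_on (sphere 0 1) g \<Longrightarrow> calc (\<lambda>z. f z - g z) = calc f - calc g"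
  by (rule calc_eqI) (simp add: fejer_calc_diff tendsto_diff fejer_calc_tendsto)

lemma calc_id: "calc (\<lambda>z. z) = v"
  using calc_powi[of 1] by simp

lemma calc_one: "calc (\<lambda>z. 1) = id_blinfun"
  using calc_powi[of 0] by simp

lemma calc_const: "calc (\<lambda>z. c) = scalar_op c"
  using calc_scale[of "\<lambda>z. 1" c] by (simp add: calc_one)

lemma calc_bounded [simp, intro]: "continuous_on (sphere 0 1) g \<Longrightarrow> calc g \<in> bounded_ops"
  by (rule closed_sequentially[OF closed_bounded_ops fejer_calc_bounded fejer_calc_tendsto])

lemma adj_calc:
  assumes "continuous_on (sphere 0 1) g"
  shows "adj (calc g) = calc (\<lambda>z. cnj (g z))"
proof -
  have "(\<lambda>N. adj (fejer_calc N g)) \<longlonglongrightarrow> adj (calc g)"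
    by (rule tendsto_adj[OF fejer_calc_bounded fejer_calc_tendsto[OF assms]])
  then show ?thesis by (simp add: adj_fejer_calc calc_eqI)
qed

lemma norm_calc_le:
  assumes "continuous_on (sphere 0 1) g" "0 \<le> C" "\<And>z. z \<in> sphere 0 1 \<Longrightarrow> cmod (g z) \<le> C"
  shows "norm (calc g) \<le> C"
proof (rule LIMSEQ_le_const2[OF tendsto_norm[OF fejer_calc_tendsto[OF assms(1)]]])
  show "\<exists>N. \<forall>n\<ge>N. norm (fejer_calc n g) \<le> C"
    by (rule exI[of _ 1]) (auto intro!: norm_fejer_calc_le assms(2,3))
qed

lemma calc_tendsto:
  assumes "continuous_on (sphere 0 1) g" "\<And>n. continuous_on (sphere 0 1) (p n)"
    "uniform_limit (sphere 0 1) p g sequentially"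
  shows "(\<lambda>n. calc (p n)) \<longlonglongrightarrow> calc g"
proof (rule tendstoI)
  fix e :: real assume "0 < e"
  then have "\<forall>\<^sub>F n in sequentially. \<forall>z\<in>sphere 0 1. dist (p n z) (g z) < e / 2"
    by (intro uniform_limitD[OF assms(3)]) simp
  then show "\<forall>\<^sub>F n in sequentially. dist (calc (p n)) (calc g) < e"
  proof eventually_elim
    case (elim n)
    have "norm (calc (\<lambda>z. p n z - g z)) \<le> e / 2"
      using elim \<open>0 < e\<close> by (intro norm_calc_le continuous_intros assms) (auto simp: dist_norm less_imp_le)
    then show ?case using \<open>0 < e\<close> by (simp add: dist_norm calc_diff[OF assms(2,1)])
  qed
qed

text \<open>Induction over \<open>f\<close>, and for powers a second induction over
  \<open>g\<close>; at the bottom lies the exponent law \<open>unitary_power_add\<close>.\<close>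

lemma calc_mult:
  assumes "continuous_on (sphere 0 1) f" "continuous_on (sphere 0 1) g"
  shows "calc (\<lambda>z. f z * g z) = calc f o\<^sub>L calc g"
  using assms(1)
proof (induction rule: continuous_circle_induct)
  case (powi k)
  show ?case
    using assms(2)
  proof (induction rule: continuous_circle_induct)
    case (powi l)
    have "calc (\<lambda>z. z powi k * z powi l) = calc (\<lambda>z. z powi (k + l))"
      by (rule calc_cong, subst power_int_add) auto
    then show ?case by (simp add: calc_powi unitary_power_add)
  next
    case (scale c p)
    have "calc (\<lambda>z. z powi k * (c * p z)) = calc (\<lambda>z. c * (z powi k * p z))"
      by (simp add: mult.left_commute)
    also have "\<dots> = scalar_op c o\<^sub>L calc (\<lambda>z. z powi k * p z)"
      by (intro calc_scale continuous_on_mult continuous_on_powi_circle scale)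
    finally show ?case
      using scale by (simp add: calc_scale scalar_op_left_commute calc_powi)
  next
    case (add p q)
    have "calc (\<lambda>z. z powi k * (p z + q z)) = calc (\<lambda>z. z powi k * p z) + calc (\<lambda>z. z powi k * q z)"
      unfolding distrib_left by (intro calc_add continuous_on_mult continuous_on_powi_circle add)
    then show ?case using add by (simp add: calc_add blinfun_compose.add_right)
  next
    case (approx g p)
    have "uniform_limit (sphere 0 1) (\<lambda>n z. z powi k * p n z) (\<lambda>z. z powi k * g z) sequentially"
      using approx compact_imp_bounded[OF compact_continuous_image[OF approx(1)]]
        compact_imp_bounded[OF compact_continuous_image[OF continuous_on_powi_circle]]
      by (intro uniform_lim_mult uniform_limit_const) auto
    then have "(\<lambda>n. calc (\<lambda>z. z powi k * p n z)) \<longlonglongrightarrow> calc (\<lambda>z. z powi k * g z)"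
      by (intro calc_tendsto continuous_on_mult continuous_on_powi_circle approx)
    moreover have "(\<lambda>n. calc (\<lambda>z. z powi k) o\<^sub>L calc (p n)) \<longlonglongrightarrow> (calc (\<lambda>z. z powi k) o\<^sub>L calc g)"
      by (intro blinfun_compose.tendsto tendsto_const calc_tendsto approx)
    ultimately show ?case unfolding approx(4) by (rule LIMSEQ_unique)
  qed
next
  case (scale c p)
  have "calc (\<lambda>z. c * p z * g z) = scalar_op c o\<^sub>L calc (\<lambda>z. p z * g z)"
    unfolding mult.assoc by (intro calc_scale continuous_on_mult scale assms)
  then show ?case using scale by (simp add: calc_scale blinfun_compose_assoc)
next
  case (add p q)
  have "calc (\<lambda>z. (p z + q z) * g z) = calc (\<lambda>z. p z * g z) + calc (\<lambda>z. q z * g z)"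
    unfolding distrib_right by (intro calc_add continuous_on_mult add assms)
  then show ?case using add by (simp add: calc_add blinfun_compose.add_left)
next
  case (approx f p)
  have "uniform_limit (sphere 0 1) (\<lambda>n z. p n z * g z) (\<lambda>z. f z * g z) sequentially"
    using approx compact_imp_bounded[OF compact_continuous_image[OF approx(1)]]
      compact_imp_bounded[OF compact_continuous_image[OF assms(2)]]
    by (intro uniform_lim_mult uniform_limit_const) auto
  then have "(\<lambda>n. calc (\<lambda>z. p n z * g z)) \<longlonglongrightarrow> calc (\<lambda>z. f z * g z)"
    by (intro calc_tendsto continuous_on_mult assms approx)
  moreover have "(\<lambda>n. calc (p n) o\<^sub>L calc g) \<longlonglongrightarrow> (calc f o\<^sub>L calc g)"
    by (intro blinfun_compose.tendsto tendsto_const calc_tendsto approx)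
  ultimately show ?case unfolding approx(4) by (rule LIMSEQ_unique)
qed

lemma calc_commute:
  assumes "continuous_on (sphere 0 1) f" "continuous_on (sphere 0 1) g"
  shows "calc f o\<^sub>L calc g = calc g o\<^sub>L calc f"
  using calc_mult[OF assms] calc_mult[OF assms(2,1)] by (simp add: mult.commute)

lemma calc_inverse:
  assumes "continuous_on (sphere 0 1) g" "\<And>z. z \<in> sphere 0 1 \<Longrightarrow> g z \<noteq> 0"
  shows "calc (\<lambda>z. inverse (g z)) o\<^sub>L calc g = id_blinfun" "calc g o\<^sub>L calc (\<lambda>z. inverse (g z)) = id_blinfun"
proof -
  have c: "continuous_on (sphere 0 1) (\<lambda>z. inverse (g z))"
    using assms by (intro continuous_intros) auto
  have "calc (\<lambda>z. inverse (g z)) o\<^sub>L calc g = calc (\<lambda>z. inverse (g z) * g z)"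
    by (rule calc_mult[OF c assms(1), symmetric])
  also have "\<dots> = calc (\<lambda>z. 1)"
    by (rule calc_cong) (simp add: assms(2))
  finally show "calc (\<lambda>z. inverse (g z)) o\<^sub>L calc g = id_blinfun" by (simp add: calc_one)
  then show "calc g o\<^sub>L calc (\<lambda>z. inverse (g z)) = id_blinfun"
    by (simp add: calc_commute[OF assms(1) c])
qed

lemma calc_invertible:
  assumes "continuous_on (sphere 0 1) g" "\<And>z. z \<in> sphere 0 1 \<Longrightarrow> g z \<noteq> 0"
  shows "op_invertible (calc g)"
proof (rule op_invertibleI[OF _ calc_inverse[OF assms]])
  show "calc (\<lambda>z. inverse (g z)) \<in> bounded_ops"
    using assms by (intro calc_bounded continuous_intros) auto
qed

text \<open>In this form a single induction covers both commutation with the commutant of \<open>v\<close>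
  and the rotation by a unitary \<open>u\<close> with \<open>v u = \<lambda> u v\<close>.\<close>

lemma calc_intertwine:
  assumes "continuous_on (sphere 0 1) g" "A \<in> bounded_ops" "v o\<^sub>L A = scalar_op c o\<^sub>L (A o\<^sub>L v)" "c \<in> sphere 0 1"
  shows "calc g o\<^sub>L A = A o\<^sub>L calc (\<lambda>z. g (c * z))"
proof -
  have rot: "continuous_on (sphere 0 1) (\<lambda>z. f (c * z))" if "continuous_on (sphere 0 1) f" for f :: "complex \<Rightarrow> complex"
    using assms(4) by (intro continuous_on_compose2[OF that] continuous_intros) (auto simp: norm_mult)
  have pw: "op_power v n o\<^sub>L A = scalar_op (c ^ n) o\<^sub>L (A o\<^sub>L op_power v n)" for n
  proof (induction n)
    case (Suc n)
    have "op_power v (Suc n) o\<^sub>L A = v o\<^sub>L (scalar_op (c ^ n) o\<^sub>L (A o\<^sub>L op_power v n))"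
      by (simp add: blinfun_compose_assoc Suc)
    also have "\<dots> = scalar_op (c ^ n) o\<^sub>L ((v o\<^sub>L A) o\<^sub>L op_power v n)"
      by (simp add: scalar_op_left_commute blinfun_compose_assoc)
    finally show ?case by (simp add: assms(3) blinfun_compose_assoc scalar_op_mult_left mult.commute)
  qed simp
  have c0: "c \<noteq> 0" using assms(4) by auto
  \<comment> \<open>Inserting \<open>v\<close>-powers and their adjoints on both sides of
    \<open>A\<close> turns \<open>pw\<close> into the relation for adjoint powers, because
    \<open>v\<close> is unitary.\<close>
  have pw': "adj (op_power v n) o\<^sub>L A = scalar_op (inverse c ^ n) o\<^sub>L (A o\<^sub>L adj (op_power v n))" for n
  proof -
    have "A o\<^sub>L adj (op_power v n) = adj (op_power v n) o\<^sub>L (op_power v n o\<^sub>L A) o\<^sub>L adj (op_power v n)"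
      by (simp add: adj_op_power_op_power flip: blinfun_compose_assoc)
    also have "\<dots> = scalar_op (c ^ n) o\<^sub>L (adj (op_power v n) o\<^sub>L A)"
      by (simp add: pw scalar_op_left_commute blinfun_compose_assoc op_power_adj_op_power)
    finally show ?thesis
      using c0 by (simp add: scalar_op_mult_left flip: power_mult_distrib)
  qed
  have up: "unitary_power k o\<^sub>L A = A o\<^sub>L (scalar_op (c powi k) o\<^sub>L unitary_power k)" for k
    using assms(2) by (auto simp: unitary_power_def pw pw' power_int_def scalar_op_left_commute)
  show ?thesis
    using assms(1)
  proof (induction rule: continuous_circle_induct)
    case (powi k)
    have "calc (\<lambda>z. (c * z) powi k) = calc (\<lambda>z. c powi k * z powi k)"
      by (rule calc_cong) (simp add: power_int_mult_distrib)
    then show ?case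
      by (simp add: calc_scale continuous_on_powi_circle calc_powi up)
  next
    case (scale a p)
    then show ?case using assms(2)
      by (simp add: calc_scale rot blinfun_compose_assoc scalar_op_left_commute)
  next
    case (add p q)
    then show ?case
      by (simp add: calc_add rot blinfun_compose.add_left blinfun_compose.add_right)
  next
    case (approx g p)
    have "uniform_limit (sphere 0 1) (\<lambda>n z. p n (c * z)) (\<lambda>z. g (c * z)) sequentially"
      using assms(4) by (intro uniform_limit_compose'[OF approx(3)]) (auto simp: norm_mult)
    then have "(\<lambda>n. A o\<^sub>L calc (\<lambda>z. p n (c * z))) \<longlonglongrightarrow> (A o\<^sub>L calc (\<lambda>z. g (c * z)))"
      by (intro blinfun_compose.tendsto tendsto_const calc_tendsto rot approx)
    moreover have "(\<lambda>n. calc (p n) o\<^sub>L A) \<longlonglongrightarrow> (calc g o\<^sub>L A)"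
      by (intro blinfun_compose.tendsto tendsto_const calc_tendsto approx)
    ultimately show ?case unfolding approx(4)[symmetric] by (metis LIMSEQ_unique)
  qed
qed

lemma calc_commute_commutant:
  assumes "continuous_on (sphere 0 1) g" "A \<in> bounded_ops" "v o\<^sub>L A = A o\<^sub>L v"
  shows "calc g o\<^sub>L A = A o\<^sub>L calc g"
  using calc_intertwine[of g A 1] assms by simp

end

section \<open>Circle means\<close>

text \<open>Banach-valued, since it averages real logarithms, complex functions and operator-valued
  resolvents alike.\<close>

definition circle_mean :: "(complex \<Rightarrow> 'a :: banach) \<Rightarrow> 'a"
  where "circle_mean g = integral {0..1} (\<lambda>x. g (cis (2 * pi * x)))"

lemma continuous_on_circle_param:
  assumes "continuous_on (sphere 0 1) g"
  shows "continuous_on S (\<lambda>x. g (cis (2 * pi * x)))"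
  by (rule continuous_on_compose2[OF assms]) (auto intro!: continuous_intros)

lemma circle_mean_has_integral:
  assumes "continuous_on (sphere 0 1) g"
  shows "((\<lambda>x. g (cis (2 * pi * x))) has_integral circle_mean g) {0..1}"
  unfolding circle_mean_def
  by (intro integrable_integral integrable_continuous_real continuous_on_circle_param assms)

lemma circle_mean_eqI: "((\<lambda>x. g (cis (2 * pi * x))) has_integral c) {0..1} \<Longrightarrow> circle_mean g = c"
  by (simp add: circle_mean_def integral_unique)

lemma circle_mean_const: "circle_mean (\<lambda>z. c) = c"
  using has_integral_const_real[of c 0 1] by (intro circle_mean_eqI) simp

lemma circle_mean_add:
  "continuous_on (sphere 0 1) f \<Longrightarrow> continuous_on (sphere 0 1) g \<Longrightarrow>
    circle_mean (\<lambda>z. f z + g z) = circle_mean f + circle_mean g"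
  by (intro circle_mean_eqI has_integral_add circle_mean_has_integral)

lemma circle_mean_diff:
  "continuous_on (sphere 0 1) f \<Longrightarrow> continuous_on (sphere 0 1) g \<Longrightarrow>
    circle_mean (\<lambda>z. f z - g z) = circle_mean f - circle_mean g"
  by (intro circle_mean_eqI has_integral_diff circle_mean_has_integral)

lemma circle_mean_mult:
  fixes g :: "complex \<Rightarrow> 'a :: {banach, real_normed_field}"
  shows "continuous_on (sphere 0 1) g \<Longrightarrow> circle_mean (\<lambda>z. c * g z) = c * circle_mean g"
  by (intro circle_mean_eqI has_integral_mult_right circle_mean_has_integral)

lemma circle_mean_of_real:
  "continuous_on (sphere 0 1) h \<Longrightarrow> circle_mean (\<lambda>z. complex_of_real (h z)) = complex_of_real (circle_mean h)"
  by (intro circle_mean_eqI has_integral_of_real circle_mean_has_integral)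

lemma circle_mean_sum:
  "(\<And>i. i \<in> I \<Longrightarrow> continuous_on (sphere 0 1) (f i)) \<Longrightarrow> finite I \<Longrightarrow>
    circle_mean (\<lambda>z. \<Sum>i\<in>I. f i z) = (\<Sum>i\<in>I. circle_mean (f i))"
  by (intro circle_mean_eqI has_integral_sum circle_mean_has_integral) auto

lemma circle_mean_mono:
  fixes f g :: "complex \<Rightarrow> real"
  assumes "continuous_on (sphere 0 1) f" "continuous_on (sphere 0 1) g"
    "\<And>z. z \<in> sphere 0 1 \<Longrightarrow> f z \<le> g z"
  shows "circle_mean f \<le> circle_mean g"
  by (rule has_integral_le[OF circle_mean_has_integral[OF assms(1)] circle_mean_has_integral[OF assms(2)]])
    (simp add: assms(3))

lemma circle_mean_nonneg:
  fixes f :: "complex \<Rightarrow> real"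
  assumes "continuous_on (sphere 0 1) f" "\<And>z. z \<in> sphere 0 1 \<Longrightarrow> 0 \<le> f z"
  shows "0 \<le> circle_mean f"
  by (rule has_integral_nonneg[OF circle_mean_has_integral[OF assms(1)]]) (simp add: assms(2))

lemma circle_point:
  assumes "z \<in> sphere 0 1"
  obtains x where "x \<in> {0..1}" "z = cis (2 * pi * x)"
proof -
  have "cmod z = 1" using assms by simp
  then have "z = cis (Arg2pi z)" by (metis complex_norm_eq_1_exp cis_conv_exp)
  then show ?thesis
    using that[of "Arg2pi z / (2 * pi)"] Arg2pi_ge_0[of z] Arg2pi_lt_2pi[of z] by simp
qed

lemma circle_mean_pos:
  fixes f :: "complex \<Rightarrow> real"
  assumes "continuous_on (sphere 0 1) f" "\<And>z. z \<in> sphere 0 1 \<Longrightarrow> 0 \<le> f z"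
    "z0 \<in> sphere 0 1" "0 < f z0"
  shows "0 < circle_mean f"
proof (rule ccontr)
  assume "\<not> 0 < circle_mean f"
  with circle_mean_nonneg[OF assms(1,2)] have "circle_mean f = 0" by simp
  then have i: "((\<lambda>x. f (cis (2 * pi * x))) has_integral 0) (cbox 0 1)"
    using circle_mean_has_integral[OF assms(1)] by simp
  obtain x where x: "x \<in> {0..1}" "z0 = cis (2 * pi * x)"
    by (rule circle_point[OF assms(3)])
  have "f (cis (2 * pi * x)) = 0"
    using x(1) by (intro has_integral_0_cbox_imp_0[OF continuous_on_circle_param[OF assms(1)] _ i])
      (auto simp: assms(2))
  then show False using x assms(4) by simp
qed

lemma circle_mean_linear:
  "bounded_linear L \<Longrightarrow> continuous_on (sphere 0 1) g \<Longrightarrow> circle_mean (\<lambda>z. L (g z)) = L (circle_mean g)"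
  using has_integral_linear[OF circle_mean_has_integral, of g L]
  by (intro circle_mean_eqI) (simp add: o_def)

lemma norm_circle_mean_le:
  assumes "continuous_on (sphere 0 1) g" "0 \<le> C" "\<And>z. z \<in> sphere 0 1 \<Longrightarrow> norm (g z) \<le> C"
  shows "norm (circle_mean g) \<le> C"
  using has_integral_bound_real[OF assms(2) finite.emptyI circle_mean_has_integral[OF assms(1)]] assms(3) by simp

text \<open>With \<open>c = cis (2 * pi * s)\<close> the rotation moves the window of integration to
  \<open>{s..1 + s}\<close>; periodicity folds the overhang back.\<close>

lemma circle_mean_rotate:
  assumes g: "continuous_on (sphere 0 1) g" and c: "c \<in> sphere 0 1"
  shows "circle_mean (\<lambda>z. g (c * z)) = circle_mean g"
proof -
  obtain s where s: "s \<in> {0..1}" "c = cis (2 * pi * s)" by (rule circle_point[OF c])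
  define \<phi> where "\<phi> x = g (cis (2 * pi * x))" for x
  have int: "\<phi> integrable_on {a..b}" for a b
    unfolding \<phi>_def by (intro integrable_continuous_real continuous_on_circle_param g)
  have "cis (2 * pi * (1 + x)) = cis (2 * pi * x)" for x
    using cis_multiple_2pi[of 1] by (simp add: distrib_left flip: cis_mult)
  then have per: "\<phi> \<circ> (+) 1 = \<phi>" by (simp add: \<phi>_def fun_eq_iff)
  have "circle_mean (\<lambda>z. g (c * z)) = integral {0..1} (\<phi> \<circ> (+) s)"
    by (simp add: circle_mean_def \<phi>_def o_def s(2) cis_mult distrib_left)
  also have "\<dots> = integral {0 + s..1 + s} \<phi>" by (rule integral_shift_Icc_real)
  also have "\<dots> = integral {s..1} \<phi> + integral {1..1 + s} \<phi>"
    using s(1) by (subst Henstock_Kurzweil_Integration.integral_combine[OF _ _ int]) auto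
  also have "integral {1..1 + s} \<phi> = integral {0..s} \<phi>"
    using integral_shift_Icc_real[of 0 s \<phi> 1] by (simp add: per add.commute)
  also have "integral {s..1} \<phi> + integral {0..s} \<phi> = integral {0..1} \<phi>"
    using s(1) Henstock_Kurzweil_Integration.integral_combine[OF _ _ int, of 0 s 1] by (simp add: add.commute)
  also have "integral {0..1} \<phi> = circle_mean g" by (simp only: circle_mean_def \<phi>_def[abs_def])
  finally show ?thesis .
qed

lemma circle_mean_powi: "circle_mean (\<lambda>z. z powi k) = (if k = 0 then 1 else 0)"
proof (cases "k = 0")
  case True
  then show ?thesis by (simp add: circle_mean_const)
next
  case False
  define a where "a = 2 * of_real pi * of_int k * \<i>"
  have a: "a \<noteq> 0" using False by (simp add: a_def)
  have "((\<lambda>x. cis (2 * pi * x) powi k) has_integral (exp (a * of_real 1) / a - exp (a * of_real 0) / a)) {0..1}"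
  proof (rule fundamental_theorem_of_calculus)
    fix x :: real
    have "((\<lambda>z. exp (a * z) / a) has_field_derivative exp (a * of_real x)) (at (of_real x))"
      using a by (auto intro!: derivative_eq_intros)
    then have "((\<lambda>x. exp (a * of_real x) / a) has_vector_derivative exp (a * of_real x)) (at x within {0..1})"
      by (rule has_vector_derivative_real_field)
    moreover have "exp (a * of_real x) = cis (2 * pi * x) powi k"
      unfolding cis_power_int by (simp add: cis_conv_exp a_def mult_ac)
    ultimately show "((\<lambda>x. exp (a * of_real x) / a) has_vector_derivative cis (2 * pi * x) powi k) (at x within {0..1})"
      by simp
  qed simp
  moreover have "exp a = 1"
    by (auto simp: exp_eq_1 a_def)
  ultimately show ?thesis using False by (intro circle_mean_eqI) simp
qed

lemma circle_mean_tendsto: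
  fixes g :: "complex \<Rightarrow> complex"
  assumes "continuous_on (sphere 0 1) g" "\<And>n :: nat. continuous_on (sphere 0 1) (p n)"
    "uniform_limit (sphere 0 1) p g sequentially"
  shows "(\<lambda>n. circle_mean (p n)) \<longlonglongrightarrow> circle_mean g"
proof -
  have "uniform_limit {0..1} (\<lambda>n x. p n (cis (2 * pi * x))) (\<lambda>x. g (cis (2 * pi * x))) sequentially"
    by (intro uniform_limit_compose'[OF assms(3)]) auto
  then obtain I J where IJ: "\<And>n. ((\<lambda>x. p n (cis (2 * pi * x))) has_integral I n) {0..1}"
    "((\<lambda>x. g (cis (2 * pi * x))) has_integral J) {0..1}" "I \<longlonglongrightarrow> J"
    by (rule uniform_limit_integral[where F = sequentially])
      (auto intro: continuous_on_circle_param assms(2))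
  have "(\<lambda>n. circle_mean (p n)) = I"
    by (rule ext) (rule circle_mean_eqI[OF IJ(1)])
  then show ?thesis using IJ(3) circle_mean_eqI[OF IJ(2)] by simp
qed

section \<open>The rotation factor and its trace\<close>

text \<open>With \<open>c\<close> the square root of \<open>|b|^2 - |a|^2\<close>, the difference of
  the two squared norms is the squared norm of \<open>calc c x\<close>.\<close>

lemma (in unitary_operator) norm_calc_apply_mono:
  assumes "continuous_on (sphere 0 1) a" "continuous_on (sphere 0 1) b"
    "\<And>z. z \<in> sphere 0 1 \<Longrightarrow> cmod (a z) \<le> cmod (b z)"
  shows "norm (blinfun_apply (calc a) x) \<le> norm (blinfun_apply (calc b) x)"
proof -
  have sq: "complex_of_real ((norm (calc a x))\<^sup>2) = cinner x (calc (\<lambda>z. of_real ((cmod (a z))\<^sup>2)) x)"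
    if "continuous_on (sphere 0 1) a" for a
  proof -
    have "calc (\<lambda>z. of_real ((cmod (a z))\<^sup>2)) = adj (calc a) o\<^sub>L calc a"
      using that by (simp only: adj_calc calc_mult[symmetric] continuous_on_cnj complex_norm_square mult.commute)
    then show ?thesis using that by (simp add: cinner_adj_right cinner_self_norm)
  qed
  define c where "c z = complex_of_real (sqrt ((cmod (b z))\<^sup>2 - (cmod (a z))\<^sup>2))" for z
  have c: "continuous_on (sphere 0 1) c" unfolding c_def by (intro continuous_intros assms)
  have "calc (\<lambda>z. of_real ((cmod (c z))\<^sup>2)) = calc (\<lambda>z. of_real ((cmod (b z))\<^sup>2) - of_real ((cmod (a z))\<^sup>2))"
    by (rule calc_cong) (simp add: c_def power_mono assms(3))
  also have "\<dots> = calc (\<lambda>z. of_real ((cmod (b z))\<^sup>2)) - calc (\<lambda>z. of_real ((cmod (a z))\<^sup>2))"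
    by (intro calc_diff continuous_intros assms)
  finally have "complex_of_real ((norm (calc c x))\<^sup>2) = complex_of_real ((norm (calc b x))\<^sup>2 - (norm (calc a x))\<^sup>2)"
    using sq[OF c] sq[OF assms(1)] sq[OF assms(2)] by (simp add: blinfun.diff_left cinner_diff_right)
  then have "(norm (calc a x))\<^sup>2 \<le> (norm (calc b x))\<^sup>2"
    unfolding of_real_eq_iff using zero_le_power2[of "norm (calc c x)"] by linarith
  then show ?thesis by (rule power2_le_imp_le) simp
qed

lemma op_positive_add: "op_positive A \<Longrightarrow> op_positive B \<Longrightarrow> op_positive (A + B)"
  unfolding op_positive_def by (simp add: blinfun.add_left cinner_add_right nonneg_Reals_add_I)

locale rotation_factor = unitary_operator v
  for v :: "'h :: complex_hilbert \<Rightarrow>\<^sub>L 'h" +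
  fixes u :: "'h \<Rightarrow>\<^sub>L 'h" and R :: "('h \<Rightarrow>\<^sub>L 'h) set" and \<tau> :: "('h \<Rightarrow>\<^sub>L 'h) \<Rightarrow> complex" and \<theta> :: real
  assumes unitary_u: "unitary_op u"
    and factor: "factor R"
    and trace: "faithful_normal_tracial_state R \<tau>"
    and irrational: "\<theta> \<notin> \<rat>"
    and generated: "R = commutant (commutant {u, v})"
    and v_u: "v o\<^sub>L u = scalar_op (cis (2 * pi * \<theta>)) o\<^sub>L (u o\<^sub>L v)"
begin

section \<open>The generated algebra, its trace, and the trace of the calculus\<close>

abbreviation "rot \<equiv> cis (2 * pi * \<theta>)"

lemma R_iff: "A \<in> R \<longleftrightarrow> A \<in> bounded_ops \<and> (\<forall>B\<in>commutant {u, v}. A o\<^sub>L B = B o\<^sub>L A)"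
  unfolding generated commutant_def[of "commutant _"] by simp

lemma R_bounded [simp, intro]: "A \<in> R \<Longrightarrow> A \<in> bounded_ops"
  by (simp add: R_iff)

lemma R_compose [simp, intro]: "A \<in> R \<Longrightarrow> B \<in> R \<Longrightarrow> A o\<^sub>L B \<in> R"
  unfolding R_iff by (auto simp: blinfun_compose_assoc) (metis blinfun_compose_assoc)

lemma R_add [simp, intro]: "A \<in> R \<Longrightarrow> B \<in> R \<Longrightarrow> A + B \<in> R"
  unfolding R_iff by (auto simp: blinfun_compose.add_left blinfun_compose.add_right)

lemma R_diff [simp, intro]: "A \<in> R \<Longrightarrow> B \<in> R \<Longrightarrow> A - B \<in> R"
  unfolding R_iff by (auto simp: blinfun_compose.diff_left blinfun_compose.diff_right)

lemma R_scalar [simp, intro]: "scalar_op c \<in> R"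
  unfolding R_iff by (auto simp: commutant_def scalar_op_commute)

lemma R_id [simp, intro]: "id_blinfun \<in> R"
  using R_scalar[of 1] by simp

lemma R_zero [simp, intro]: "0 \<in> R"
  using R_scalar[of 0] by simp

lemma R_adj [simp, intro]: "A \<in> R \<Longrightarrow> adj A \<in> R"
  using factor by (auto simp: factor_def von_neumann_algebra_def)

lemma u_bounded [simp, intro]: "u \<in> bounded_ops"
  and adj_u_u: "adj u o\<^sub>L u = id_blinfun"
  and u_adj_u: "u o\<^sub>L adj u = id_blinfun"
  using unitary_u by (auto simp: unitary_op_def)

lemma u_R [simp, intro]: "u \<in> R" and v_R [simp, intro]: "v \<in> R"
  unfolding R_iff by (auto simp: commutant_def)

lemma calc_R [simp, intro]: "continuous_on (sphere 0 1) g \<Longrightarrow> calc g \<in> R"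
  unfolding R_iff by (auto simp: commutant_def intro!: calc_commute_commutant)

text \<open>Commuting with \<open>u\<close> and \<open>v\<close> places \<open>A\<close> in the
  commutant of the generators, and every element of \<open>R\<close>, the double commutant, commutes
  with that. So \<open>A\<close> is central, and the factor property applies.\<close>

lemma central_if_commutes:
  assumes "A \<in> R" "A o\<^sub>L u = u o\<^sub>L A" "A o\<^sub>L v = v o\<^sub>L A"
  obtains c where "A = scalar_op c"
proof -
  have A: "A \<in> commutant {u, v}" using assms by (auto simp: commutant_def)
  have "A \<in> commutant R"
    unfolding commutant_def[of R] using assms(1) A by (auto simp: R_iff)
  then have "A \<in> range scalar_op" using factor assms(1) by (auto simp: factor_def)
  then show ?thesis using that by blast
qed

lemmas trace_axioms = trace[unfolded faithful_normal_tracial_state_def tracial_state_def faithful_on_def]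

lemma trace_add: "A \<in> R \<Longrightarrow> B \<in> R \<Longrightarrow> \<tau> (A + B) = \<tau> A + \<tau> B"
  by (rule trace_axioms[THEN conjunct1, THEN conjunct1, rule_format])

lemma trace_scalar: "A \<in> R \<Longrightarrow> \<tau> (scalar_op c o\<^sub>L A) = c * \<tau> A"
  by (rule trace_axioms[THEN conjunct1, THEN conjunct2, THEN conjunct1, rule_format])

lemma trace_id [simp]: "\<tau> id_blinfun = 1"
  by (rule trace_axioms[THEN conjunct1, THEN conjunct2, THEN conjunct2, THEN conjunct1])

lemma trace_nonneg: "A \<in> R \<Longrightarrow> \<tau> (adj A o\<^sub>L A) \<in> \<real>\<^sub>\<ge>\<^sub>0"
  by (rule trace_axioms[THEN conjunct1, THEN conjunct2, THEN conjunct2, THEN conjunct2, THEN conjunct1, rule_format])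

lemma trace_commute: "A \<in> R \<Longrightarrow> B \<in> R \<Longrightarrow> \<tau> (A o\<^sub>L B) = \<tau> (B o\<^sub>L A)"
  by (rule trace_axioms[THEN conjunct1, THEN conjunct2, THEN conjunct2, THEN conjunct2, THEN conjunct2, rule_format])

lemma trace_faithful: "A \<in> R \<Longrightarrow> \<tau> (adj A o\<^sub>L A) = 0 \<Longrightarrow> A = 0"
  by (rule trace_axioms[THEN conjunct2, THEN conjunct1, rule_format])

lemma trace_zero [simp]: "\<tau> 0 = 0"
  using trace_add[of 0 0] by simp

lemma trace_diff: "A \<in> R \<Longrightarrow> B \<in> R \<Longrightarrow> \<tau> (A - B) = \<tau> A - \<tau> B"
  using trace_add[of "A - B" B] by simp

text \<open>Polarization: positivity on \<open>1 + c A\<close> makes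
  \<open>c * \<tau> A + cnj c * \<tau> (adj A)\<close> real, and \<open>c = 1\<close> and
  \<open>c = \<i>\<close> give the imaginary and the real part.\<close>

lemma trace_adj:
  assumes "A \<in> R"
  shows "\<tau> (adj A) = cnj (\<tau> A)"
proof -
  have real: "Im (c * \<tau> A + cnj c * \<tau> (adj A)) = 0" for c
  proof -
    have eq: "adj (id_blinfun + (scalar_op c o\<^sub>L A)) o\<^sub>L (id_blinfun + (scalar_op c o\<^sub>L A))
      = (id_blinfun + (adj (scalar_op c o\<^sub>L A) o\<^sub>L (scalar_op c o\<^sub>L A)))
        + ((scalar_op c o\<^sub>L A) + (scalar_op (cnj c) o\<^sub>L adj A))"
      using assms by (simp add: adj_add adj_compose scalar_op_commute blinfun_compose.add_left
          blinfun_compose.add_right)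
    have n: "Im (\<tau> (adj X o\<^sub>L X)) = 0" if "X \<in> R" for X
      using trace_nonneg[OF that] by (auto elim: nonneg_Reals_cases)
    have "\<tau> (adj (id_blinfun + (scalar_op c o\<^sub>L A)) o\<^sub>L (id_blinfun + (scalar_op c o\<^sub>L A)))
      = (1 + \<tau> (adj (scalar_op c o\<^sub>L A) o\<^sub>L (scalar_op c o\<^sub>L A))) + (c * \<tau> A + cnj c * \<tau> (adj A))"
      unfolding eq using assms by (simp add: trace_add trace_scalar)
    then show ?thesis
      using n[of "id_blinfun + (scalar_op c o\<^sub>L A)"] n[of "scalar_op c o\<^sub>L A"] assms by simp
  qed
  show ?thesis
    using real[of 1] real[of \<i>] by (simp add: complex_eq_iff)
qed

text \<open>Normality enters only here, for the directed set \<open>{A, B}\<close>.\<close>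

lemma trace_mono:
  assumes "A \<in> R" "B \<in> R" "op_positive A" "op_le A B"
  shows "Re (\<tau> A) \<le> Re (\<tau> B)"
proof -
  have pB: "op_positive B"
    using op_positive_add[of A "B - A"] assms(3,4) by (simp add: op_le_def)
  have refl: "op_le X X" for X :: "'h \<Rightarrow>\<^sub>L 'h"
    by (simp add: op_le_def op_positive_def cinner.zero_right)
  have "normal_on R \<tau>" using trace by (simp add: faithful_normal_tracial_state_def)
  then have "Re (\<tau> B) = (SUP T\<in>{A, B}. Re (\<tau> T))"
    unfolding normal_on_def using assms pB refl by (elim allE[of _ "{A, B}"] allE[of _ B]) blast
  then show ?thesis
    by (metis cSUP_upper finite.emptyI finite_imageI finite_insert bdd_above_finite insertI1)
qed

lemma op_positive_adj_compose: "A \<in> bounded_ops \<Longrightarrow> op_positive (adj A o\<^sub>L A)"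
  by (simp add: op_positive_def cinner_adj_right cinner_self_norm flip: of_real_power)

text \<open>Left multiplication is bounded in the 2-norm of the trace. The operator inequality is
  \<open>norm (A (B x)) \<le> norm A * norm (B x)\<close>, squared and read as a quadratic
  form.\<close>

lemma trace_norm_square_le:
  assumes "A \<in> R" "B \<in> R"
  shows "Re (\<tau> (adj (A o\<^sub>L B) o\<^sub>L (A o\<^sub>L B))) \<le> (norm A)\<^sup>2 * Re (\<tau> (adj B o\<^sub>L B))"
proof -
  have "op_positive ((scalar_op (of_real ((norm A)\<^sup>2)) o\<^sub>L (adj B o\<^sub>L B)) - (adj (A o\<^sub>L B) o\<^sub>L (A o\<^sub>L B)))"
    unfolding op_positive_def
  proof (intro conjI allI)
    fix x
    have "cinner x (((scalar_op (of_real ((norm A)\<^sup>2)) o\<^sub>L (adj B o\<^sub>L B)) - (adj (A o\<^sub>L B) o\<^sub>L (A o\<^sub>L B))) x)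
      = complex_of_real ((norm A * norm (B x))\<^sup>2 - (norm (A (B x)))\<^sup>2)"
      using assms by (simp add: blinfun.diff_left cinner_diff_right cinner_scaleC_right cinner_adj_right
          adj_compose cinner_self_norm power_mult_distrib)
    moreover have "(norm (A (B x)))\<^sup>2 \<le> (norm A * norm (B x))\<^sup>2"
      by (intro power_mono norm_blinfun) simp
    ultimately show "cinner x (((scalar_op (of_real ((norm A)\<^sup>2)) o\<^sub>L (adj B o\<^sub>L B)) - (adj (A o\<^sub>L B) o\<^sub>L (A o\<^sub>L B))) x) \<in> \<real>\<^sub>\<ge>\<^sub>0"
      by (simp only: nonneg_Reals_of_real_iff diff_ge_0_iff_ge)
  qed (use assms in auto)
  then have "Re (\<tau> (adj (A o\<^sub>L B) o\<^sub>L (A o\<^sub>L B))) \<le> Re (\<tau> (scalar_op (of_real ((norm A)\<^sup>2)) o\<^sub>L (adj B o\<^sub>L B)))"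
    using assms by (intro trace_mono) (auto simp: op_le_def intro!: op_positive_adj_compose)
  then show ?thesis
    using assms by (simp add: trace_scalar flip: of_real_power)
qed

text \<open>Nonnegativity of the variance: subtracting the scalar \<open>\<tau> A\<close> leaves
  \<open>\<tau> (adj A o\<^sub>L A) - |\<tau> A|^2\<close>. The resulting norm continuity lets the
  trace pass to uniform limits.\<close>

lemma norm_trace_le:
  assumes "A \<in> R"
  shows "cmod (\<tau> A) \<le> norm A"
proof -
  define c where "c = \<tau> A"
  have eq: "adj (A - scalar_op c) o\<^sub>L (A - scalar_op c)
    = ((adj A o\<^sub>L A) - (scalar_op c o\<^sub>L adj A)) - ((scalar_op (cnj c) o\<^sub>L A) - scalar_op (cnj c * c))"
    using assms by (simp add: adj_diff blinfun_compose.diff_left blinfun_compose.diff_right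
        scalar_op_commute scalar_op_mult)
  have s: "\<tau> (scalar_op a) = a" for a using trace_scalar[of id_blinfun a] by simp
  have "\<tau> (adj (A - scalar_op c) o\<^sub>L (A - scalar_op c)) = \<tau> (adj A o\<^sub>L A) - cnj c * c"
    unfolding eq using assms by (simp add: trace_diff trace_scalar trace_adj s c_def)
  moreover have "\<tau> (adj (A - scalar_op c) o\<^sub>L (A - scalar_op c)) \<in> \<real>\<^sub>\<ge>\<^sub>0"
    using assms by (intro trace_nonneg) auto
  moreover have "cnj c * c = complex_of_real ((cmod c)\<^sup>2)"
    by (simp only: complex_norm_square mult.commute)
  ultimately have "(cmod c)\<^sup>2 \<le> Re (\<tau> (adj A o\<^sub>L A))"
    by (auto elim!: nonneg_Reals_cases simp: complex_eq_iff)
  also have "\<dots> \<le> (norm A)\<^sup>2"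
    using trace_norm_square_le[of A id_blinfun] assms by simp
  finally show ?thesis unfolding c_def by (rule power2_le_imp_le) simp
qed

lemma rot_powi_neq_1: "k \<noteq> 0 \<Longrightarrow> rot powi k \<noteq> 1"
proof
  assume k: "k \<noteq> 0" and "rot powi k = 1"
  then obtain n :: int where "of_int k * (2 * pi * \<theta>) = 2 * pi * of_int n"
    by (auto simp: cis_power_int cis_eq_1_iff)
  then have "\<theta> = of_int n / of_int k" using k by (simp add: field_simps)
  then show False using irrational by (metis Rats_divide Rats_of_int)
qed

lemma continuous_on_rot:
  "continuous_on (sphere 0 1) g \<Longrightarrow> continuous_on (sphere 0 1) (\<lambda>z. g (rot ^ n * z))"
  by (rule continuous_on_compose2[of "sphere 0 1" g]) (auto intro!: continuous_intros simp: norm_mult norm_power)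

lemma continuous_on_rot1:
  "continuous_on (sphere 0 1) g \<Longrightarrow> continuous_on (sphere 0 1) (\<lambda>z. g (rot * z))"
  using continuous_on_rot[of g 1] by simp

lemma calc_u: "continuous_on (sphere 0 1) g \<Longrightarrow> calc g o\<^sub>L u = u o\<^sub>L calc (\<lambda>z. g (rot * z))"
  by (rule calc_intertwine) (auto simp: v_u)

lemma trace_calc_rot:
  assumes "continuous_on (sphere 0 1) g"
  shows "\<tau> (calc (\<lambda>z. g (rot * z))) = \<tau> (calc g)"
proof -
  have "calc (\<lambda>z. g (rot * z)) = adj u o\<^sub>L (u o\<^sub>L calc (\<lambda>z. g (rot * z)))"
    by (simp add: adj_u_u flip: blinfun_compose_assoc)
  also have "\<tau> \<dots> = \<tau> ((u o\<^sub>L calc (\<lambda>z. g (rot * z))) o\<^sub>L adj u)"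
    using assms by (intro trace_commute) (auto intro: continuous_on_rot1)
  also have "(u o\<^sub>L calc (\<lambda>z. g (rot * z))) o\<^sub>L adj u = calc g"
    using assms by (simp add: u_adj_u blinfun_compose_assoc flip: calc_u)
  finally show ?thesis .
qed

text \<open>Invariance under conjugation by \<open>u\<close> multiplies the trace of the power
  \<open>k\<close> by \<open>rot powi k\<close>, which differs from 1 for
  \<open>k \<noteq> 0\<close>; that trace is therefore 0, as is the mean.\<close>

lemma trace_calc:
  assumes "continuous_on (sphere 0 1) g"
  shows "\<tau> (calc g) = circle_mean g"
  using assms
proof (induction rule: continuous_circle_induct)
  case (powi k)
  show ?case
  proof (cases "k = 0")
    case True
    then show ?thesis by (simp add: calc_one circle_mean_const)
  next
    case False
    have "calc (\<lambda>z. (rot * z) powi k) = calc (\<lambda>z. rot powi k * z powi k)"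
      by (rule calc_cong) (simp add: power_int_mult_distrib)
    then have "\<tau> (calc (\<lambda>z. z powi k)) = rot powi k * \<tau> (calc (\<lambda>z. z powi k))"
      using trace_calc_rot[OF continuous_on_powi_circle[of k]]
      by (simp add: calc_scale continuous_on_powi_circle trace_scalar calc_R)
    then show ?thesis using False rot_powi_neq_1[OF False] by (simp add: circle_mean_powi)
  qed
next
  case (scale c p)
  then show ?case by (simp add: calc_scale trace_scalar circle_mean_mult)
next
  case (add p q)
  then show ?case by (simp add: calc_add trace_add circle_mean_add)
next
  case (approx g p)
  have "(\<lambda>n. calc (p n) - calc g) \<longlonglongrightarrow> 0"
    using calc_tendsto[OF approx(1-3)] by (simp add: LIM_zero)
  then have "(\<lambda>n. \<tau> (calc (p n) - calc g)) \<longlonglongrightarrow> 0"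
    by (rule Lim_null_comparison[rotated, OF tendsto_norm_zero])
      (use approx in \<open>auto intro!: always_eventually norm_trace_le\<close>)
  then have "(\<lambda>n. \<tau> (calc (p n))) \<longlonglongrightarrow> \<tau> (calc g)"
    using approx by (simp add: trace_diff LIM_zero_iff)
  then show ?case
    using circle_mean_tendsto[OF approx(1-3)] unfolding approx(4) by (rule LIMSEQ_unique)
qed

text \<open>The vector is taken from the range of h(v) for a tent \<open>h\<close> around
  \<open>z0\<close>. The tent has positive mean, hence positive trace, so h(v) is not 0; on its
  support \<open>g\<close> is within \<open>e\<close> of \<open>g z0\<close>.\<close>

lemma calc_approximate_eigenvector:
  assumes "continuous_on (sphere 0 1) g" "z0 \<in> sphere 0 1" "0 < e"
  obtains y where "y \<noteq> 0" "norm (blinfun_apply (calc g - scalar_op (g z0)) y) \<le> e * norm y"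
proof -
  obtain d where d: "0 < d" "\<And>z. z \<in> sphere 0 1 \<Longrightarrow> dist z z0 < d \<Longrightarrow> dist (g z) (g z0) < e"
    using assms unfolding continuous_on_iff by metis
  define h where "h z = max 0 (d - dist z z0)" for z
  have h: "continuous_on (sphere 0 1) h" unfolding h_def by (intro continuous_intros)
  have ch: "continuous_on (sphere 0 1) (\<lambda>z. complex_of_real (h z))" using h by (intro continuous_intros)
  have "0 < circle_mean h"
    by (rule circle_mean_pos[OF h _ assms(2)]) (auto simp: h_def d)
  then have "\<tau> (calc (\<lambda>z. complex_of_real (h z))) \<noteq> 0"
    by (simp add: trace_calc ch circle_mean_of_real h)
  then have "calc (\<lambda>z. complex_of_real (h z)) \<noteq> 0" using trace_zero by metis
  then obtain x where x: "calc (\<lambda>z. complex_of_real (h z)) x \<noteq> 0"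
    by (metis blinfun_eqI blinfun.zero_left)
  have "(calc g - scalar_op (g z0)) o\<^sub>L calc (\<lambda>z. complex_of_real (h z))
      = calc (\<lambda>z. (g z - g z0) * complex_of_real (h z))"
    using assms(1) ch by (subst calc_mult) (auto simp: calc_diff calc_const intro!: continuous_intros)
  then have "norm ((calc g - scalar_op (g z0)) (calc (\<lambda>z. complex_of_real (h z)) x))
      = norm (calc (\<lambda>z. (g z - g z0) * complex_of_real (h z)) x)"
    by (metis blinfun_apply_blinfun_compose)
  also have "\<dots> \<le> norm (calc (\<lambda>z. complex_of_real e * complex_of_real (h z)) x)"
  proof (rule norm_calc_apply_mono)
    fix z :: complex assume z: "z \<in> sphere 0 1"
    show "cmod ((g z - g z0) * complex_of_real (h z)) \<le> cmod (complex_of_real e * complex_of_real (h z))"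
    proof (cases "dist z z0 < d")
      case True
      then have "cmod (g z - g z0) \<le> e" using d(2)[OF z] by (simp add: dist_norm less_imp_le)
      then show ?thesis using assms(3) by (simp add: norm_mult mult_right_mono)
    qed (simp add: h_def)
  qed (use assms ch in \<open>auto intro!: continuous_intros\<close>)
  also have "\<dots> = e * norm (calc (\<lambda>z. complex_of_real (h z)) x)"
    using ch assms(3) by (simp add: calc_scale norm_scaleC)
  finally show ?thesis using x that by blast
qed

end

section \<open>Uniqueness of the functional calculus\<close>

text \<open>Two calculi agree on polynomials in \<open>z\<close> and \<open>cnj z\<close>.
  Stone-Weierstrass and the isometry clause extend this to continuous functions, which determines
  the value of the chosen \<open>fcalc\<close>.\<close>

lemma is_fcalc_unique:
  fixes T :: "'h :: complex_hilbert \<Rightarrow>\<^sub>L 'h"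
  assumes \<Phi>: "is_fcalc T \<Phi>" and \<Psi>: "is_fcalc T \<Psi>"
    and spec: "compact (op_spectrum T)" "op_spectrum T \<noteq> {}"
    and h: "continuous_on (op_spectrum T) h"
  shows "\<Phi> h = \<Psi> h"
proof -
  define A where "A f \<longleftrightarrow> continuous_on (op_spectrum T) f \<and> \<Phi> f = \<Psi> f" for f
  have id: "A (\<lambda>z. z)" using \<Phi> \<Psi> by (simp add: A_def is_fcalc_def)
  have const: "A (\<lambda>z. c)" for c using \<Phi> \<Psi> by (simp add: A_def is_fcalc_def)
  have add: "A (\<lambda>z. f z + g z)" if "A f" "A g" for f g
    using that \<Phi> \<Psi> by (simp add: A_def is_fcalc_def continuous_on_add)
  have mult: "A (\<lambda>z. f z * g z)" if "A f" "A g" for f g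
    using that \<Phi> \<Psi> by (simp add: A_def is_fcalc_def continuous_on_mult)
  have cnj: "A (\<lambda>z. cnj (f z))" if "A f" for f
    using that \<Phi> \<Psi> by (simp add: A_def is_fcalc_def continuous_on_cnj)
  have close: "norm (\<Phi> h - \<Psi> h) \<le> 2 * e" if "0 < e" for e :: real
  proof -
    obtain p where p: "polynomial_function p" "\<forall>z\<in>op_spectrum T. cmod (h z - p z) < e"
      using Stone_Weierstrass_polynomial_function[OF spec(1) h \<open>0 < e\<close>] by blast
    have Ap: "A p"
      using p(1) by (induction rule: polynomial_function_complex_induct) (simp_all add: const id cnj[OF id] add mult)
    have *: "norm (\<Xi> h - \<Xi> p) \<le> e" if \<Xi>: "is_fcalc T \<Xi>" for \<Xi>
    proof -
      have cp: "continuous_on (op_spectrum T) p" using Ap by (simp add: A_def)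
      \<comment> \<open>\<open>is_fcalc\<close> has no clause for differences, so
        \<open>h - p\<close> is expressed through a product with the constant -1.\<close>
      have cm: "continuous_on (op_spectrum T) (\<lambda>z. - 1 * p z)" using cp by (intro continuous_intros)
      have "\<Xi> (\<lambda>z. f z * g z) = \<Xi> f o\<^sub>L \<Xi> g"
        if "continuous_on (op_spectrum T) f" "continuous_on (op_spectrum T) g" for f g
        using \<Xi> that unfolding is_fcalc_def by blast
      from this[OF continuous_on_const cp]
      have "\<Xi> (\<lambda>z. - 1 * p z) = \<Xi> (\<lambda>z. - 1) o\<^sub>L \<Xi> p" .
      also have "\<dots> = - \<Xi> p" using \<Xi> by (simp add: is_fcalc_def scalar_op_minus blinfun_compose.minus_left)
      finally have m: "\<Xi> (\<lambda>z. - 1 * p z) = - \<Xi> p" .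
      have "\<Xi> (\<lambda>z. f z + g z) = \<Xi> f + \<Xi> g"
        if "continuous_on (op_spectrum T) f" "continuous_on (op_spectrum T) g" for f g
        using \<Xi> that unfolding is_fcalc_def by blast
      from this[OF h cm] have "\<Xi> (\<lambda>z. h z + - 1 * p z) = \<Xi> h - \<Xi> p"
        unfolding m by simp
      moreover have "norm (\<Xi> (\<lambda>z. h z + - 1 * p z)) = (SUP z\<in>op_spectrum T. cmod (h z + - 1 * p z))"
        using \<Xi> continuous_on_add[OF h cm] by (simp add: is_fcalc_def)
      moreover have "(SUP z\<in>op_spectrum T. cmod (h z + - 1 * p z)) \<le> e"
        using p(2) by (intro cSUP_least spec(2)) (simp add: less_imp_le)
      ultimately show ?thesis by simp
    qed
    have "\<Phi> p = \<Psi> p" using Ap by (simp add: A_def)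
    then have "\<Phi> h - \<Psi> h = (\<Phi> h - \<Phi> p) - (\<Psi> h - \<Psi> p)" by simp
    then show ?thesis
      using *[OF \<Phi>] *[OF \<Psi>] norm_triangle_ineq4[of "\<Phi> h - \<Phi> p" "\<Psi> h - \<Psi> p"] by simp
  qed
  have "norm (\<Phi> h - \<Psi> h) \<le> 0"
  proof (rule field_le_epsilon)
    fix e :: real assume "0 < e"
    then show "norm (\<Phi> h - \<Psi> h) \<le> 0 + e" using close[of "e / 2"] by simp
  qed
  then show ?thesis by simp
qed

lemma fcalc_eqI:
  assumes "is_fcalc T \<Phi>" "compact (op_spectrum T)" "op_spectrum T \<noteq> {}" "continuous_on (op_spectrum T) h"
  shows "fcalc T h = \<Phi> h"
proof (rule is_fcalc_unique[OF _ assms])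
  show "is_fcalc T (fcalc T)" unfolding fcalc_def by (rule someI[of "is_fcalc T" \<Phi>]) (rule assms(1))
qed

section \<open>Determinant of a function on the circle\<close>

definition log_mean :: "(complex \<Rightarrow> complex) \<Rightarrow> real \<Rightarrow> real"
  where "log_mean f e = circle_mean (\<lambda>z. ln (cmod (f z) + e))"

text \<open>An infimum always exists, including the value 0 for a divergent logarithm, and by
  monotonicity in \<open>e\<close> it is also the limit. \<open>fk_det\<close> and
  \<open>exp_circle_log\<close> are both reduced to it.\<close>

definition circle_det :: "(complex \<Rightarrow> complex) \<Rightarrow> real"
  where "circle_det f = (INF e\<in>{0<..}. exp (log_mean f e))"

lemma continuous_on_ln_cmod_plus:
  "continuous_on (sphere 0 1) f \<Longrightarrow> 0 < e \<Longrightarrow> continuous_on (sphere 0 1) (\<lambda>z. ln (cmod (f z) + e))"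
  by (intro continuous_intros) (auto simp: add_nonneg_eq_0_iff intro: less_imp_neq[symmetric])

lemma log_mean_mono:
  assumes f: "continuous_on (sphere 0 1) f" and "0 < d" "d \<le> e"
  shows "log_mean f d \<le> log_mean f e"
  unfolding log_mean_def using assms(2,3)
  by (intro circle_mean_mono continuous_on_ln_cmod_plus f) (auto simp: add_nonneg_pos)

lemma circle_det_le: "0 < e \<Longrightarrow> circle_det f \<le> exp (log_mean f e)"
  unfolding circle_det_def by (rule cINF_lower) (auto intro: bdd_belowI[of _ 0])

lemma circle_det_nonneg: "0 \<le> circle_det f"
  unfolding circle_det_def by (rule cINF_greatest) (auto intro: exI[of _ 1])

lemma circle_det_less:
  assumes "circle_det f < r"
  obtains e where "0 < e" "exp (log_mean f e) < r"
proof -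
  have "bdd_below ((\<lambda>e. exp (log_mean f e)) ` {0<..})" by (auto intro: bdd_belowI[of _ 0])
  moreover have "{0<..} \<noteq> ({} :: real set)" by (auto intro: exI[of _ 1])
  ultimately show ?thesis
    using assms that unfolding circle_det_def by (subst (asm) cINF_less_iff) auto
qed

lemma circle_det_tendsto:
  assumes f: "continuous_on (sphere 0 1) f"
  shows "((\<lambda>e. exp (log_mean f e)) \<longlongrightarrow> circle_det f) (at_right 0)"
proof (rule order_tendstoI)
  fix a assume "a < circle_det f"
  then show "\<forall>\<^sub>F e in at_right 0. a < exp (log_mean f e)"
    by (auto simp: eventually_at_right_less intro!: eventually_mono[OF eventually_at_right_less] less_le_trans[OF _ circle_det_le])
next
  fix a assume "circle_det f < a"
  then obtain e where e: "0 < e" "exp (log_mean f e) < a" by (rule circle_det_less)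
  show "\<forall>\<^sub>F e in at_right 0. exp (log_mean f e) < a"
    unfolding eventually_at_right_field
  proof (intro exI[of _ e] conjI allI impI)
    fix d assume "0 < d" "d < e"
    then have "exp (log_mean f d) \<le> exp (log_mean f e)" using log_mean_mono[OF f] by simp
    then show "exp (log_mean f d) < a" using e(2) by (rule le_less_trans)
  qed (use e in auto)
qed

lemma log_mean_eq_lebesgue:
  assumes f: "continuous_on (sphere 0 1) f" and e: "0 < e"
  shows "set_integrable lborel {0..1} (\<lambda>x. ln (cmod (f (cis (2 * pi * x))) + e))"
    "log_mean f e = set_lebesgue_integral lborel {0..1} (\<lambda>x. ln (cmod (f (cis (2 * pi * x))) + e))"
proof -
  have "continuous_on {0..1} (\<lambda>x. ln (cmod (f (cis (2 * pi * x))) + e))"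
    by (rule continuous_on_circle_param[OF continuous_on_ln_cmod_plus[OF f e]])
  then show *: "set_integrable lborel {0..1} (\<lambda>x. ln (cmod (f (cis (2 * pi * x))) + e))"
    by (rule borel_integrable_atLeastAtMost')
  show "log_mean f e = set_lebesgue_integral lborel {0..1} (\<lambda>x. ln (cmod (f (cis (2 * pi * x))) + e))"
    by (simp add: log_mean_def circle_mean_def set_borel_integral_eq_integral(2)[OF *])
qed

text \<open>If the logarithm is integrable, dominated convergence applies. Otherwise a positive
  infimum would bound the monotone integrals of \<open>ln (F + e n)\<close> from below, and this
  would force both the zero set to be null and \<open>ln F\<close> to be integrable.\<close>

lemma exp_circle_log_eq_det:
  assumes f: "continuous_on (sphere 0 1) f"
  shows "exp_circle_log f = circle_det f"
proof -
  define F where "F x = cmod (f (cis (2 * pi * x)))" for x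
  define e where "e n = 1 / real (Suc n)" for n
  have e0: "0 < e n" and e1: "e n \<le> 1" for n by (simp_all add: e_def)
  have e_tendsto: "e \<longlonglongrightarrow> 0"
    using LIMSEQ_inverse_real_of_nat unfolding e_def by (simp add: inverse_eq_divide)
  then have "filterlim e (at_right 0) sequentially"
    unfolding filterlim_at using e0 by (auto intro!: always_eventually simp: e_def)
  then have circle_det_lim: "(\<lambda>n. exp (log_mean f (e n))) \<longlonglongrightarrow> circle_det f"
    by (rule filterlim_compose[OF circle_det_tendsto[OF f]])
  obtain K where K: "0 < K" "\<And>x. F x \<le> K"
    using continuous_circle_bounded[OF f] unfolding F_def by (metis mem_sphere_0 norm_cis)
  have F0: "0 \<le> F x" for x by (simp add: F_def)
  have up: "ln (F x + e n) \<le> ln (K + 1)" for x n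
    using K(2)[of x] F0[of x] e0[of n] e1[of n] K(1) by (subst ln_le_cancel_iff) auto
  have int: "integrable lborel (\<lambda>x. indicator {0..1} x * ln (F x + e n))" for n
    using log_mean_eq_lebesgue(1)[OF f e0] by (simp add: set_integrable_def F_def)
  have lm: "log_mean f (e n) = (\<integral>x. indicator {0..1} x * ln (F x + e n) \<partial>lborel)" for n
    using log_mean_eq_lebesgue(2)[OF f e0] by (simp add: set_lebesgue_integral_def F_def)
  have contF: "continuous_on S F" for S
    unfolding F_def by (intro continuous_on_norm continuous_on_circle_param f)
  have [measurable]: "F \<in> borel_measurable borel"
    by (rule borel_measurable_continuous_onI[OF contF])
  have ln_lim: "(\<lambda>n. ln (F x + e n)) \<longlonglongrightarrow> ln (F x)" if "F x \<noteq> 0" for x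
  proof -
    have "(\<lambda>n. F x + e n) \<longlonglongrightarrow> F x + 0" by (intro tendsto_add tendsto_const e_tendsto)
    then show ?thesis using that by (intro tendsto_ln) auto
  qed
  show ?thesis
  proof (cases "(AE x in lborel. x \<in> {0..1} \<longrightarrow> F x \<noteq> 0) \<and> set_integrable lborel {0..1} (\<lambda>x. ln (F x))")
    case True
    have "(\<lambda>n. \<integral>x. indicator {0..1} x * ln (F x + e n) \<partial>lborel) \<longlonglongrightarrow> (\<integral>x. indicator {0..1} x * ln (F x) \<partial>lborel)"
    proof (rule integral_dominated_convergence)
      have "integrable lborel (\<lambda>x. indicator {0..1} x * ln (F x))"
        using True by (simp add: set_integrable_def)
      moreover have "integrable lborel (\<lambda>x. indicator {0..1::real} x * ln (K + 1))"
        by (intro integrable_mult_left integrable_real_indicator) auto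
      \<comment> \<open>Off the zeros \<open>ln (F x + e n)\<close> lies between
        \<open>ln (F x)\<close> and \<open>ln (K + 1)\<close>, hence this majorant.\<close>
      ultimately show "integrable lborel (\<lambda>x. \<bar>indicator {0..1} x * ln (F x)\<bar> + indicator {0..1} x * ln (K + 1))"
        by (intro Bochner_Integration.integrable_add integrable_abs)
      show "AE x in lborel. (\<lambda>n. indicator {0..1} x * ln (F x + e n)) \<longlonglongrightarrow> indicator {0..1} x * ln (F x)"
        using conjunct1[OF True] by eventually_elim (auto simp: indicator_def intro: ln_lim)
      show "AE x in lborel. norm (indicator {0..1} x * ln (F x + e n)) \<le> \<bar>indicator {0..1} x * ln (F x)\<bar> + indicator {0..1} x * ln (K + 1)" for n
        using conjunct1[OF True]
      proof eventually_elim
        case (elim x)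
        show ?case
        proof (cases "x \<in> {0..1}")
          case True
          then have "ln (F x) \<le> ln (F x + e n)" using elim F0[of x] e0[of n] by (subst ln_le_cancel_iff) auto
          moreover have "0 \<le> ln (K + 1)" using K(1) by simp
          ultimately show ?thesis using up[of x n] True by simp
        qed simp
      qed
    qed measurable
    then have "(\<lambda>n. exp (log_mean f (e n))) \<longlonglongrightarrow> exp (\<integral>x. indicator {0..1} x * ln (F x) \<partial>lborel)"
      unfolding lm by (rule tendsto_exp)
    then have "circle_det f = exp (\<integral>x. indicator {0..1} x * ln (F x) \<partial>lborel)"
      by (rule LIMSEQ_unique[OF circle_det_lim])
    then show ?thesis
      using True by (simp add: exp_circle_log_def F_def set_lebesgue_integral_def)
  next
    case False
    have "circle_det f = 0"
    proof (rule ccontr)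
      assume "circle_det f \<noteq> 0"
      then have pos: "0 < circle_det f" using circle_det_nonneg[of f] by simp
      \<comment> \<open>Subtracting from the common upper bound gives nonnegative functions that
        increase with \<open>n\<close>, as monotone convergence requires.\<close>
      define g where "g n x = indicator {0..1} x * (ln (K + 1) - ln (F x + e n))" for n x
      have ind: "integrable lborel (\<lambda>x. indicator {0..1::real} x * ln (K + 1))"
        by (intro integrable_mult_left integrable_real_indicator) auto
      have g_int: "integrable lborel (g n)" for n
        unfolding g_def right_diff_distrib by (intro Bochner_Integration.integrable_diff ind int)
      have "integral\<^sup>L lborel (\<lambda>x. indicator {0..1::real} x * ln (K + 1)) = ln (K + 1)"
        by simp
      then have g_integral: "integral\<^sup>L lborel (g n) = ln (K + 1) - log_mean f (e n)" for n
        unfolding g_def right_diff_distrib lm by (subst Bochner_Integration.integral_diff[OF ind int]) simp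
      have g0: "0 \<le> g n x" for n x using up[of x n] by (simp add: g_def)
      have "ln (circle_det f) \<le> log_mean f (e n)" for n
        using circle_det_le[OF e0[of n], of f] pos by (metis exp_gt_zero ln_exp ln_le_cancel_iff)
      then have bound: "integral\<^sup>L lborel (g n) \<le> ln (K + 1) - ln (circle_det f)" for n
        by (simp add: g_integral)
      define Z where "Z = {x \<in> {0..1}. F x = 0}"
      have Zm: "Z \<in> sets lborel" unfolding Z_def by measurable
      have "emeasure lborel Z \<le> emeasure lborel {0..1::real}"
        by (rule emeasure_mono) (auto simp: Z_def)
      then have Zfin: "emeasure lborel Z < \<infinity>" by (simp add: order_le_less_trans)
      \<comment> \<open>On \<open>Z\<close> the logarithm equals \<open>- ln (Suc n)\<close>, so a
        zero set of positive measure would let the integrals of \<open>g n\<close> grow without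
        bound.\<close>
      have Zbound: "ln (real (Suc n)) * measure lborel Z \<le> ln (K + 1) - ln (circle_det f)" for n
      proof -
        have "ln (real (Suc n)) * measure lborel Z = (\<integral>x. indicator Z x * ln (real (Suc n)) \<partial>lborel)"
          using Zm Zfin by simp
        also have "\<dots> \<le> integral\<^sup>L lborel (g n)"
        proof (rule integral_mono)
          show "integrable lborel (\<lambda>x. indicator Z x * ln (real (Suc n)))"
            using Zm Zfin by (intro integrable_mult_left integrable_real_indicator)
          show "indicator Z x * ln (real (Suc n)) \<le> g n x" for x
          proof (cases "x \<in> Z")
            case True
            then show ?thesis using K(1) by (simp add: Z_def g_def e_def ln_div)
          qed (simp add: g0)
        qed (rule g_int)
        finally show ?thesis using bound[of n] by simp
      qed
      have "measure lborel Z = 0"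
      proof (rule ccontr)
        assume "measure lborel Z \<noteq> 0"
        then have mp: "0 < measure lborel Z" by (simp add: zero_less_measure_iff)
        define C where "C = (ln (K + 1) - ln (circle_det f)) / measure lborel Z"
        obtain n :: nat where "exp (C + 1) < real n" using reals_Archimedean2 by blast
        then have "exp (C + 1) < real (Suc n)" by simp
        then have "C + 1 < ln (real (Suc n))" by (metis ln_exp ln_less_cancel_iff exp_gt_zero of_nat_0_less_iff zero_less_Suc)
        moreover have "ln (real (Suc n)) \<le> C" using Zbound[of n] mp by (simp add: C_def pos_le_divide_eq)
        ultimately show False by simp
      qed
      then have "Z \<in> null_sets lborel"
        using Zm Zfin by (auto simp: null_sets_def emeasure_eq_ennreal_measure)
      then have AE: "AE x in lborel. x \<in> {0..1} \<longrightarrow> F x \<noteq> 0"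
        by (rule AE_I'[of Z]) (auto simp: Z_def)
      have "integrable lborel (\<lambda>x. indicator {0..1} x * (ln (K + 1) - ln (F x)))"
      proof (rule integrable_monotone_convergence[OF g_int])
        show "AE x in lborel. mono (\<lambda>n. g n x)"
          using AE
        proof eventually_elim
          case (elim x)
          have "ln (F x + e (Suc n)) \<le> ln (F x + e n)" for n
            using F0[of x] e0[of "Suc n"] by (subst ln_le_cancel_iff) (auto simp: e_def frac_le add_nonneg_pos)
          then show ?case by (auto simp: mono_iff_le_Suc g_def intro!: mult_left_mono)
        qed
        show "AE x in lborel. (\<lambda>n. g n x) \<longlonglongrightarrow> indicator {0..1} x * (ln (K + 1) - ln (F x))"
          using AE by eventually_elim (auto simp: indicator_def g_def intro!: tendsto_intros ln_lim)
        have "(\<lambda>n. ln (exp (log_mean f (e n)))) \<longlonglongrightarrow> ln (circle_det f)"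
          using pos by (intro tendsto_ln circle_det_lim) auto
        then show "(\<lambda>n. integral\<^sup>L lborel (g n)) \<longlonglongrightarrow> ln (K + 1) - ln (circle_det f)"
          unfolding g_integral by (intro tendsto_intros) simp
      qed measurable
      from Bochner_Integration.integrable_diff[OF ind this]
      have "set_integrable lborel {0..1} (\<lambda>x. ln (F x))"
        by (simp add: set_integrable_def algebra_simps)
      then show False using False AE by blast
    qed
    then show ?thesis using False by (auto simp: exp_circle_log_def F_def)
  qed
qed

section \<open>Spectrum and determinant of the calculus\<close>

context rotation_factor
begin

lemma op_spectrum_calc:
  assumes g: "continuous_on (sphere 0 1) g"
  shows "op_spectrum (calc g) = g ` sphere 0 1"
proof (intro set_eqI iffI)
  fix w assume w: "w \<in> op_spectrum (calc g)"
  show "w \<in> g ` sphere 0 1"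
  proof (rule ccontr)
    assume n: "w \<notin> g ` sphere 0 1"
    have "op_invertible (calc (\<lambda>z. g z - w))"
      using n by (intro calc_invertible continuous_intros g) force
    moreover have "calc (\<lambda>z. g z - w) = calc g - scalar_op w"
      by (simp add: calc_diff g calc_const)
    ultimately show False using w by (simp add: op_spectrum_def)
  qed
next
  fix w assume "w \<in> g ` sphere 0 1"
  then obtain z0 where z0: "z0 \<in> sphere 0 1" "w = g z0" by auto
  show "w \<in> op_spectrum (calc g)"
  proof (rule ccontr)
    assume "w \<notin> op_spectrum (calc g)"
    then obtain S where S: "S o\<^sub>L (calc g - scalar_op (g z0)) = id_blinfun"
      by (auto simp: op_spectrum_def op_invertible_def z0)
    \<comment> \<open>A tolerance for which \<open>norm S\<close> times it is still below 1, so a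
      left inverse would shrink its own approximate eigenvector.\<close>
    have "0 < 1 / (norm S + 1)" by (simp add: add_nonneg_pos)
    then obtain y where y: "y \<noteq> 0" "norm ((calc g - scalar_op (g z0)) y) \<le> 1 / (norm S + 1) * norm y"
      by (rule calc_approximate_eigenvector[OF g z0(1)])
    have "y = S ((calc g - scalar_op (g z0)) y)"
      by (metis S blinfun_apply_blinfun_compose blinfun_apply_id_blinfun id_apply)
    then have "norm y \<le> norm S * norm ((calc g - scalar_op (g z0)) y)"
      by (metis norm_blinfun)
    also have "\<dots> \<le> norm S * (1 / (norm S + 1) * norm y)"
      by (intro mult_left_mono y) simp
    also have "\<dots> < norm y"
    proof -
      have "norm S / (norm S + 1) < 1" by (simp add: add_nonneg_pos)
      then have "norm S / (norm S + 1) * norm y < 1 * norm y" using y(1) by (intro mult_strict_right_mono) auto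
      then show ?thesis by simp
    qed
    finally show False by simp
  qed
qed

lemma calc_invertible_iff:
  assumes "continuous_on (sphere 0 1) g"
  shows "op_invertible (calc g) \<longleftrightarrow> (\<forall>z\<in>sphere 0 1. g z \<noteq> 0)"
proof -
  have "op_invertible (calc g) \<longleftrightarrow> 0 \<notin> op_spectrum (calc g)" by (simp add: op_spectrum_def)
  then show ?thesis using op_spectrum_calc[OF assms] by auto
qed

lemma norm_calc_ge:
  assumes g: "continuous_on (sphere 0 1) g" and z: "z \<in> sphere 0 1"
  shows "cmod (g z) \<le> norm (calc g)"
proof (rule field_le_epsilon)
  fix e :: real assume "0 < e"
  then obtain y where y: "y \<noteq> 0" "norm ((calc g - scalar_op (g z)) y) \<le> e * norm y"
    by (rule calc_approximate_eigenvector[OF g z])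
  have "cmod (g z) * norm y = norm (calc g y - (calc g - scalar_op (g z)) y)"
    by (simp add: blinfun.diff_left norm_scaleC)
  also have "\<dots> \<le> norm (calc g y) + norm ((calc g - scalar_op (g z)) y)"
    by (rule norm_triangle_ineq4)
  also have "\<dots> \<le> (norm (calc g) + e) * norm y"
    using norm_blinfun[of "calc g" y] y(2) by (simp add: distrib_right)
  finally show "cmod (g z) \<le> norm (calc g) + e" using y(1) by simp
qed

lemma norm_calc:
  assumes g: "continuous_on (sphere 0 1) g"
  shows "norm (calc g) = (SUP z\<in>sphere 0 1. cmod (g z))"
proof (rule antisym)
  obtain B where B: "\<And>z. z \<in> sphere 0 1 \<Longrightarrow> cmod (g z) \<le> B"
    using continuous_circle_bounded[OF g] by metis
  have bdd: "bdd_above ((\<lambda>z. cmod (g z)) ` sphere 0 1)" using B by (auto intro!: bdd_aboveI[of _ B])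
  have up: "cmod (g z) \<le> (SUP z\<in>sphere 0 1. cmod (g z))" if "z \<in> sphere 0 1" for z
    by (rule cSUP_upper[OF that bdd])
  have "0 \<le> (SUP z\<in>sphere 0 1. cmod (g z))"
    using up[of 1] order_trans[OF norm_ge_zero] by simp
  then show "norm (calc g) \<le> (SUP z\<in>sphere 0 1. cmod (g z))"
    by (rule norm_calc_le[OF g]) (rule up)
  have "(1 :: complex) \<in> sphere 0 1" by simp
  then have "sphere (0 :: complex) 1 \<noteq> {}" by blast
  then show "(SUP z\<in>sphere 0 1. cmod (g z)) \<le> norm (calc g)"
    by (intro cSUP_least norm_calc_ge g)
qed

text \<open>Composition with \<open>g\<close> is a calculus for g(v). The isometry clause takes its
  supremum over the spectrum, which has just been identified with the image of the circle.\<close>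

lemma is_fcalc_calc:
  assumes g: "continuous_on (sphere 0 1) g"
  shows "is_fcalc (calc g) (\<lambda>h. calc (\<lambda>z. h (g z)))"
proof -
  have c: "continuous_on (sphere 0 1) (\<lambda>z. h (g z))" if "continuous_on (op_spectrum (calc g)) h"
    for h :: "complex \<Rightarrow> complex"
    using that by (intro continuous_on_compose2[OF that g]) (simp add: op_spectrum_calc[OF g])
  show ?thesis
    unfolding is_fcalc_def
  proof (intro conjI allI impI; (elim conjE)?)
    fix h h' :: "complex \<Rightarrow> complex"
    assume h: "continuous_on (op_spectrum (calc g)) h"
    show "calc (\<lambda>z. h (g z)) \<in> bounded_ops" by (intro calc_bounded c h)
    show "calc (\<lambda>z. cnj (h (g z))) = adj (calc (\<lambda>z. h (g z)))" by (rule adj_calc[OF c[OF h], symmetric])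
    show "norm (calc (\<lambda>z. h (g z))) = (SUP z\<in>op_spectrum (calc g). cmod (h z))"
      by (simp only: norm_calc[OF c[OF h]] op_spectrum_calc[OF g] image_image)
    assume h': "continuous_on (op_spectrum (calc g)) h'"
    show "calc (\<lambda>z. h (g z) + h' (g z)) = calc (\<lambda>z. h (g z)) + calc (\<lambda>z. h' (g z))"
      by (rule calc_add[OF c[OF h] c[OF h']])
    show "calc (\<lambda>z. h (g z) * h' (g z)) = calc (\<lambda>z. h (g z)) o\<^sub>L calc (\<lambda>z. h' (g z))"
      by (rule calc_mult[OF c[OF h] c[OF h']])
  qed (simp_all add: calc_const)
qed

lemma fcalc_calc:
  assumes g: "continuous_on (sphere 0 1) g" and h: "continuous_on (g ` sphere 0 1) h"
  shows "fcalc (calc g) h = calc (\<lambda>z. h (g z))"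
proof (rule fcalc_eqI[OF is_fcalc_calc[OF g]])
  show "compact (op_spectrum (calc g))"
    unfolding op_spectrum_calc[OF g] by (intro compact_continuous_image g compact_sphere)
  have "(1 :: complex) \<in> sphere 0 1" by simp
  then show "op_spectrum (calc g) \<noteq> {}" unfolding op_spectrum_calc[OF g] by blast
qed (simp add: op_spectrum_calc[OF g] h)

lemma fcalc_v: "continuous_on (sphere 0 1) f \<Longrightarrow> fcalc v f = calc f"
  using fcalc_calc[of "\<lambda>z. z" f] by (simp add: calc_id)

lemma op_abs_calc:
  assumes f: "continuous_on (sphere 0 1) f"
  shows "op_abs (calc f) = calc (\<lambda>z. of_real (cmod (f z)))"
proof -
  have "adj (calc f) o\<^sub>L calc f = calc (\<lambda>z. cnj (f z) * f z)"
    using f by (simp only: adj_calc calc_mult continuous_on_cnj)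
  also have "(\<lambda>z. cnj (f z) * f z) = (\<lambda>z. of_real ((cmod (f z))\<^sup>2))"
    by (simp only: complex_norm_square mult.commute)
  finally have "op_abs (calc f) = fcalc (calc (\<lambda>z. of_real ((cmod (f z))\<^sup>2))) (\<lambda>z. of_real (sqrt (Re z)))"
    by (simp only: op_abs_def)
  also have "\<dots> = calc (\<lambda>z. of_real (sqrt (Re (of_real ((cmod (f z))\<^sup>2)))))"
    by (intro fcalc_calc continuous_intros f)
  finally show ?thesis by simp
qed

lemma fk_det_calc:
  assumes f: "continuous_on (sphere 0 1) f"
  shows "fk_det \<tau> (calc f) = circle_det f"
  unfolding fk_det_def
proof (rule tendsto_Lim)
  have eq: "Re (\<tau> (fcalc (op_abs (calc f)) (\<lambda>z. complex_of_real (ln (Re z + e))))) = log_mean f e" if "0 < e" for e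
  proof -
    have "continuous_on ((\<lambda>z. complex_of_real (cmod (f z))) ` sphere 0 1) (\<lambda>z. complex_of_real (ln (Re z + e)))"
      using that by (intro continuous_intros) (auto simp: add_nonneg_eq_0_iff)
    then have "fcalc (op_abs (calc f)) (\<lambda>z. complex_of_real (ln (Re z + e))) = calc (\<lambda>z. complex_of_real (ln (cmod (f z) + e)))"
      by (subst op_abs_calc[OF f], subst fcalc_calc) (auto intro!: continuous_intros f)
    then show ?thesis
      using continuous_on_ln_cmod_plus[OF f that]
      by (simp add: trace_calc continuous_on_of_real circle_mean_of_real log_mean_def)
  qed
  show "((\<lambda>e. exp (Re (\<tau> (fcalc (op_abs (calc f)) (\<lambda>z. complex_of_real (ln (Re z + e))))))) \<longlongrightarrow> circle_det f) (at_right 0)"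
    by (rule Lim_transform_eventually[OF circle_det_tendsto[OF f]])
      (auto intro!: eventually_mono[OF eventually_at_right_less] simp: eq)
qed simp

end

section \<open>Resolvent set outside the critical circle\<close>

lemma circle_det_nonvanishing:
  assumes f: "continuous_on (sphere 0 1) f" and nz: "\<And>z. z \<in> sphere 0 1 \<Longrightarrow> f z \<noteq> 0"
  shows "circle_det f = exp (circle_mean (\<lambda>z. ln (cmod (f z))))"
proof (rule antisym)
  have c: "continuous_on (sphere 0 1) (\<lambda>z. ln (cmod (f z)))"
    using nz by (intro continuous_intros f) auto
  have "continuous_on (sphere 0 1) (\<lambda>z. - cmod (f z))" by (intro continuous_intros f)
  then obtain z0 where z0: "z0 \<in> sphere 0 1" "\<And>w. w \<in> sphere 0 1 \<Longrightarrow> - cmod (f w) \<le> - cmod (f z0)"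
    by (rule continuous_circle_attains_sup) auto
  define m where "m = cmod (f z0)"
  have m: "0 < m" "\<And>w. w \<in> sphere 0 1 \<Longrightarrow> m \<le> cmod (f w)"
    using nz[OF z0(1)] z0(2) by (auto simp: m_def)
  show "exp (circle_mean (\<lambda>z. ln (cmod (f z)))) \<le> circle_det f"
    unfolding circle_det_def
  proof (rule cINF_greatest)
    show "{0<..} \<noteq> ({} :: real set)" by (auto intro: exI[of _ 1])
    fix e :: real assume "e \<in> {0<..}"
    then have e: "0 < e" by simp
    have "circle_mean (\<lambda>z. ln (cmod (f z))) \<le> log_mean f e"
      unfolding log_mean_def
    proof (intro circle_mean_mono c continuous_on_ln_cmod_plus f e)
      fix z :: complex assume "z \<in> sphere 0 1"
      then have "0 < cmod (f z)" using nz by simp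
      then show "ln (cmod (f z)) \<le> ln (cmod (f z) + e)"
        using e by (subst ln_le_cancel_iff) (auto intro: add_pos_pos)
    qed
    then show "exp (circle_mean (\<lambda>z. ln (cmod (f z)))) \<le> exp (log_mean f e)" by simp
  qed
  show "circle_det f \<le> exp (circle_mean (\<lambda>z. ln (cmod (f z))))"
  proof (rule dense_ge)
    fix r assume r: "exp (circle_mean (\<lambda>z. ln (cmod (f z)))) < r"
    then have r0: "0 < r" by (rule less_trans[OF exp_gt_zero])
    define d where "d = ln r - circle_mean (\<lambda>z. ln (cmod (f z)))"
    have d: "0 < d" using r r0 unfolding d_def by (metis diff_gt_0_iff_gt exp_less_cancel_iff exp_ln)
    \<comment> \<open>Since \<open>m\<close> is the minimum of \<open>cmod (f z)\<close>, adding
      \<open>m * d\<close> multiplies the modulus by at most \<open>1 + d \<le> exp d\<close>,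
      uniformly in \<open>z\<close>.\<close>
    have e: "0 < m * d" using m d by simp
    have "ln (cmod (f z) + m * d) \<le> ln (cmod (f z)) + d" if z: "z \<in> sphere 0 1" for z
    proof -
      have fz: "0 < cmod (f z)" using nz[OF z] by simp
      have "cmod (f z) + m * d \<le> cmod (f z) * (1 + d)"
        using m(2)[OF z] d by (simp add: distrib_left mult_right_mono)
      also have "\<dots> \<le> cmod (f z) * exp d" using d by (intro mult_left_mono) auto
      finally have "ln (cmod (f z) + m * d) \<le> ln (cmod (f z) * exp d)"
        using fz e by (subst ln_le_cancel_iff) (auto intro: add_pos_pos)
      then show ?thesis using fz by (simp add: ln_mult)
    qed
    then have "log_mean f (m * d) \<le> circle_mean (\<lambda>z. ln (cmod (f z)) + d)"
      unfolding log_mean_def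
      by (intro circle_mean_mono continuous_on_ln_cmod_plus f e continuous_on_add c continuous_on_const)
    also have "\<dots> = ln r"
      by (simp add: circle_mean_add c circle_mean_const d_def)
    finally have "exp (log_mean f (m * d)) \<le> r" using r0 by (metis exp_le_cancel_iff exp_ln)
    with circle_det_le[OF e] show "circle_det f \<le> r" by (rule order_trans)
  qed
qed

lemma exp_less_iff_less_ln: "0 < x \<Longrightarrow> exp a < x \<longleftrightarrow> a < ln x" for x :: real
  by (metis exp_less_cancel_iff exp_ln)

lemma less_exp_iff_ln_less: "0 < x \<Longrightarrow> x < exp a \<longleftrightarrow> ln x < a" for x :: real
  by (metis exp_less_cancel_iff exp_ln)

text \<open>The shift costs most when all factors equal \<open>K\<close>. The excess vanishes with
  \<open>e\<close>, which allows a product with zero factors to be compared with its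
  regularization.\<close>

lemma prod_add_le:
  fixes a :: "nat \<Rightarrow> real"
  assumes "\<And>k. 0 \<le> a k" "\<And>k. a k \<le> K" "0 \<le> e"
  shows "(\<Prod>k<n. a k + e) \<le> (\<Prod>k<n. a k) + ((K + e) ^ n - K ^ n)"
proof (induction n)
  case (Suc n)
  have K: "0 \<le> K" using assms(1,2) order_trans by blast
  have P: "(\<Prod>k<n. a k) \<le> K ^ n"
    using prod_mono[of "{..<n}" a "\<lambda>_. K"] assms(1,2) by simp
  have D: "0 \<le> (K + e) ^ n - K ^ n" using K assms(3) by (simp add: power_mono)
  have "(\<Prod>k<Suc n. a k + e) \<le> ((\<Prod>k<n. a k) + ((K + e) ^ n - K ^ n)) * (a n + e)"
    using Suc assms by (simp add: mult_right_mono)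
  also have "\<dots> = (\<Prod>k<Suc n. a k) + ((\<Prod>k<n. a k) * e + ((K + e) ^ n - K ^ n) * (a n + e))"
    by (simp add: algebra_simps)
  also have "\<dots> \<le> (\<Prod>k<Suc n. a k) + (K ^ n * e + ((K + e) ^ n - K ^ n) * (K + e))"
    using P D assms by (intro add_mono mult_right_mono mult_left_mono) auto
  also have "\<dots> = (\<Prod>k<Suc n. a k) + ((K + e) ^ Suc n - K ^ Suc n)"
    by (simp add: algebra_simps)
  finally show ?case .
qed simp

lemma op_invertible_diff_scalar:
  fixes A :: "'h :: complex_hilbert \<Rightarrow>\<^sub>L 'h"
  assumes "A \<in> bounded_ops" "norm A < cmod z"
  shows "op_invertible (A - scalar_op z)"
proof -
  have z: "z \<noteq> 0" using assms(2) norm_ge_zero[of A] by auto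
  have "norm (scalar_op (inverse z) o\<^sub>L A) < 1"
    using assms(2) z by (simp add: norm_scalar_op_compose norm_inverse inverse_eq_divide norm_divide)
  then have "op_invertible (id_blinfun - (scalar_op (inverse z) o\<^sub>L A))"
    using assms(1) by (intro op_invertible_one_minus) auto
  then have "op_invertible (scalar_op (- z) o\<^sub>L (id_blinfun - (scalar_op (inverse z) o\<^sub>L A)))"
    using z by (intro op_invertible_compose op_invertible_scalar_op) auto
  also have "scalar_op (- z) o\<^sub>L (id_blinfun - (scalar_op (inverse z) o\<^sub>L A)) = A - scalar_op z"
  proof -
    have "scalar_op (- z) o\<^sub>L (scalar_op (inverse z) o\<^sub>L A) = - A"
      using z by (simp add: scalar_op_mult_left scalar_op_minus blinfun_compose.minus_left)
    then show ?thesis by (simp add: blinfun_compose.diff_right scalar_op_minus)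
  qed
  finally show ?thesis .
qed

section \<open>Approximate coboundaries and the region free of spectrum\<close>

context rotation_factor
begin

text \<open>For a nonconstant power the equation is solved exactly by division by
  \<open>rot powi k - 1\<close>, nonzero by irrationality. These divisors come arbitrarily close to
  0, so only approximate solutions survive the passage to limits.\<close>

lemma coboundary_approx:
  assumes "continuous_on (sphere 0 1) h" "0 < e"
  shows "\<exists>q. continuous_on (sphere 0 1) q \<and>
    (\<forall>z\<in>sphere 0 1. cmod (h z - circle_mean h - (q (rot * z) - q z)) \<le> e)"
  using assms
proof (induction arbitrary: e rule: continuous_circle_induct)
  case (powi k)
  show ?case
  proof (cases "k = 0")
    case True
    then show ?thesis using powi by (intro exI[of _ "\<lambda>z. 0"]) (simp add: circle_mean_const)
  next
    case False
    have nz: "rot powi k - 1 \<noteq> 0" using rot_powi_neq_1[OF False] by simp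
    define q where "q z = z powi k / (rot powi k - 1)" for z
    have "continuous_on (sphere 0 1) q"
      unfolding q_def using nz by (intro continuous_on_divide continuous_on_powi_circle continuous_on_const) auto
    moreover have "q (rot * z) - q z = z powi k" for z
    proof -
      have "q (rot * z) - q z = (rot powi k - 1) * z powi k / (rot powi k - 1)"
        by (simp add: q_def power_int_mult_distrib left_diff_distrib flip: diff_divide_distrib)
      then show ?thesis using nz by simp
    qed
    ultimately show ?thesis
      using powi False by (intro exI[of _ q]) (simp add: circle_mean_powi)
  qed
next
  case (scale c p)
  \<comment> \<open>The summand 1 covers \<open>c = 0\<close>.\<close>
  have "0 < e / (cmod c + 1)" using scale by (simp add: add_nonneg_pos)
  then obtain q where q: "continuous_on (sphere 0 1) q"
    "\<And>z. z \<in> sphere 0 1 \<Longrightarrow> cmod (p z - circle_mean p - (q (rot * z) - q z)) \<le> e / (cmod c + 1)"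
    using scale.IH by blast
  have "cmod (c * p z - circle_mean (\<lambda>z. c * p z) - (c * q (rot * z) - c * q z)) \<le> e" if "z \<in> sphere 0 1" for z
  proof -
    have "c * p z - circle_mean (\<lambda>z. c * p z) - (c * q (rot * z) - c * q z) = c * (p z - circle_mean p - (q (rot * z) - q z))"
      using scale by (simp add: circle_mean_mult algebra_simps)
    then have "cmod (c * p z - circle_mean (\<lambda>z. c * p z) - (c * q (rot * z) - c * q z)) \<le> cmod c * (e / (cmod c + 1))"
      using q(2)[OF that] by (simp only: norm_mult mult_left_mono norm_ge_zero)
    also have "\<dots> \<le> e"
    proof -
      have "cmod c / (cmod c + 1) \<le> 1" by (simp add: add_nonneg_pos)
      then have "cmod c / (cmod c + 1) * e \<le> 1 * e" using scale.prems by (intro mult_right_mono) auto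
      then show ?thesis by (simp add: mult.commute)
    qed
    finally show ?thesis .
  qed
  moreover have "continuous_on (sphere 0 1) (\<lambda>z. c * q z)" using q(1) by (intro continuous_intros)
  ultimately show ?case by (intro exI[of _ "\<lambda>z. c * q z"]) auto
next
  case (add p p')
  have "0 < e / 2" using add by simp
  then obtain q q' where q: "continuous_on (sphere 0 1) q" "continuous_on (sphere 0 1) q'"
    "\<And>z. z \<in> sphere 0 1 \<Longrightarrow> cmod (p z - circle_mean p - (q (rot * z) - q z)) \<le> e / 2"
    "\<And>z. z \<in> sphere 0 1 \<Longrightarrow> cmod (p' z - circle_mean p' - (q' (rot * z) - q' z)) \<le> e / 2"
    using add.IH by meson
  have "cmod (p z + p' z - circle_mean (\<lambda>z. p z + p' z) - ((q (rot * z) + q' (rot * z)) - (q z + q' z))) \<le> e"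
    if "z \<in> sphere 0 1" for z
  proof -
    have "p z + p' z - circle_mean (\<lambda>z. p z + p' z) - ((q (rot * z) + q' (rot * z)) - (q z + q' z))
      = (p z - circle_mean p - (q (rot * z) - q z)) + (p' z - circle_mean p' - (q' (rot * z) - q' z))"
      using circle_mean_add[OF add(1,2)] by simp
    then show ?thesis
      using norm_triangle_mono[OF q(3)[OF that] q(4)[OF that]] by (simp only: field_sum_of_halves)
  qed
  moreover have "continuous_on (sphere 0 1) (\<lambda>z. q z + q' z)" using q by (intro continuous_intros)
  ultimately show ?case by (intro exI[of _ "\<lambda>z. q z + q' z"]) auto
next
  case (approx g p)
  have e3: "0 < e / 3" using approx by simp
  have "\<forall>\<^sub>F n in sequentially. dist (circle_mean (p n)) (circle_mean g) < e / 3"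
    using circle_mean_tendsto[OF approx(1-3)] e3 by (rule tendstoD)
  moreover have "\<forall>\<^sub>F n in sequentially. \<forall>z\<in>sphere 0 1. dist (p n z) (g z) < e / 3"
    by (rule uniform_limitD[OF approx(3) e3])
  ultimately have "\<forall>\<^sub>F n in sequentially. dist (circle_mean (p n)) (circle_mean g) < e / 3 \<and>
      (\<forall>z\<in>sphere 0 1. dist (p n z) (g z) < e / 3)"
    by (rule eventually_conj)
  then obtain n where n: "dist (circle_mean (p n)) (circle_mean g) < e / 3"
    "\<forall>z\<in>sphere 0 1. dist (p n z) (g z) < e / 3"
    unfolding eventually_sequentially by blast
  obtain q where q: "continuous_on (sphere 0 1) q"
    "\<forall>z\<in>sphere 0 1. cmod (p n z - circle_mean (p n) - (q (rot * z) - q z)) \<le> e / 3"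
    using approx(4)[OF e3, of n] by blast
  have "cmod (g z - circle_mean g - (q (rot * z) - q z)) \<le> e" if z: "z \<in> sphere 0 1" for z
  proof -
    have "g z - circle_mean g - (q (rot * z) - q z)
      = (p n z - circle_mean (p n) - (q (rot * z) - q z)) + ((g z - p n z) + (circle_mean (p n) - circle_mean g))"
      by simp
    also have "cmod \<dots> \<le> e / 3 + (e / 3 + e / 3)"
    proof (intro norm_triangle_mono)
      show "cmod (g z - p n z) \<le> e / 3"
        using n(2) z by (metis dist_commute dist_norm less_imp_le)
      show "cmod (circle_mean (p n) - circle_mean g) \<le> e / 3"
        using n(1) by (simp add: dist_norm)
    qed (use q z in auto)
    finally show ?thesis by simp
  qed
  then show ?case using q(1) by blast
qed

lemma real_coboundary_approx:
  fixes h :: "complex \<Rightarrow> real"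
  assumes "continuous_on (sphere 0 1) h" "0 < e"
  obtains q :: "complex \<Rightarrow> real" where "continuous_on (sphere 0 1) q"
    "\<And>z. z \<in> sphere 0 1 \<Longrightarrow> \<bar>h z - circle_mean h - (q (rot * z) - q z)\<bar> \<le> e"
proof -
  have c: "continuous_on (sphere 0 1) (\<lambda>z. complex_of_real (h z))" using assms by (intro continuous_intros)
  obtain q where q: "continuous_on (sphere 0 1) q"
    "\<And>z. z \<in> sphere 0 1 \<Longrightarrow> cmod (complex_of_real (h z) - circle_mean (\<lambda>z. complex_of_real (h z)) - (q (rot * z) - q z)) \<le> e"
    using coboundary_approx[OF c assms(2)] by blast
  show ?thesis
  proof (rule that[of "\<lambda>z. Re (q z)"])
    show "continuous_on (sphere 0 1) (\<lambda>z. Re (q z))" using q(1) by (intro continuous_intros)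
    show "\<bar>h z - circle_mean h - (Re (q (rot * z)) - Re (q z))\<bar> \<le> e" if "z \<in> sphere 0 1" for z
      using abs_Re_le_cmod[of "complex_of_real (h z) - circle_mean (\<lambda>z. complex_of_real (h z)) - (q (rot * z) - q z)"]
        q(2)[OF that] by (simp add: circle_mean_of_real assms(1))
  qed
qed

text \<open>Conjugating by \<open>exp (q(v))\<close> changes \<open>ln \<bar>f\<bar>\<close> by the coboundary \<open>q - q \<circ> rot\<close>, so up to
  similarity \<open>\<bar>f\<bar>\<close> can be made nearly constant.\<close>

lemma invertible_of_similar:
  assumes f: "continuous_on (sphere 0 1) f" and q: "continuous_on (sphere 0 1) (q :: complex \<Rightarrow> real)"
    and inv: "op_invertible ((u o\<^sub>L calc (\<lambda>z. of_real (exp (q z - q (rot * z))) * f z)) - scalar_op w)"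
  shows "op_invertible ((u o\<^sub>L calc f) - scalar_op w)"
proof -
  let ?W = "calc (\<lambda>z. of_real (exp (q z)))" and ?W' = "calc (\<lambda>z. of_real (exp (- q z)))"
  let ?f = "\<lambda>z. of_real (exp (q z - q (rot * z))) * f z"
  have qr: "continuous_on (sphere 0 1) (\<lambda>z. q (rot * z))"
    using q by (intro continuous_on_compose2[OF q] continuous_intros) (auto simp: norm_mult)
  have cont: "continuous_on (sphere 0 1) (\<lambda>z. complex_of_real (exp (q z)))"
    "continuous_on (sphere 0 1) (\<lambda>z. complex_of_real (exp (- q z)))"
    "continuous_on (sphere 0 1) (\<lambda>z. complex_of_real (exp (q (rot * z))))"
    "continuous_on (sphere 0 1) ?f"
    using q qr f by (auto intro!: continuous_intros)
  have WW': "?W o\<^sub>L ?W' = id_blinfun"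
    using calc_inverse(2)[OF cont(1)] by (simp add: exp_minus)
  \<comment> \<open>Moving \<open>?W\<close> past \<open>u\<close> replaces \<open>q\<close> by its
    rotation; that factor and \<open>?W'\<close> together cancel the exponential in
    \<open>?f\<close>.\<close>
  have "?W o\<^sub>L (u o\<^sub>L calc ?f) o\<^sub>L ?W' = u o\<^sub>L (calc (\<lambda>z. of_real (exp (q (rot * z)))) o\<^sub>L (calc ?f o\<^sub>L ?W'))"
    using calc_u[OF cont(1)] by (simp add: blinfun_compose_assoc[symmetric])
  also have "calc (\<lambda>z. of_real (exp (q (rot * z)))) o\<^sub>L (calc ?f o\<^sub>L ?W')
      = calc (\<lambda>z. of_real (exp (q (rot * z))) * (?f z * of_real (exp (- q z))))"
    using cont by (simp add: calc_mult continuous_on_mult)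
  also have "\<dots> = calc f"
    by (rule calc_cong) (simp add: mult_ac flip: exp_add of_real_mult)
  finally have sim: "?W o\<^sub>L (u o\<^sub>L calc ?f) o\<^sub>L ?W' = u o\<^sub>L calc f" .
  have "?W o\<^sub>L ((u o\<^sub>L calc ?f) - scalar_op w) o\<^sub>L ?W' = (u o\<^sub>L calc f) - (?W o\<^sub>L scalar_op w o\<^sub>L ?W')"
    by (simp only: blinfun_compose.diff_left blinfun_compose.diff_right sim)
  also have "?W o\<^sub>L scalar_op w o\<^sub>L ?W' = scalar_op w"
    using WW' cont by (simp add: scalar_op_commute blinfun_compose_assoc)
  finally have eq: "?W o\<^sub>L ((u o\<^sub>L calc ?f) - scalar_op w) o\<^sub>L ?W' = (u o\<^sub>L calc f) - scalar_op w" .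
  have "op_invertible ?W" by (rule calc_invertible[OF cont(1)]) simp
  moreover have "op_invertible ?W'" by (rule calc_invertible[OF cont(2)]) simp
  ultimately have "op_invertible (?W o\<^sub>L ((u o\<^sub>L calc ?f) - scalar_op w) o\<^sub>L ?W')"
    by (intro op_invertible_compose inv)
  then show ?thesis unfolding eq .
qed

lemma invertible_outside:
  assumes f: "continuous_on (sphere 0 1) f" and w: "circle_det f < cmod w"
  shows "op_invertible ((u o\<^sub>L calc f) - scalar_op w)"
proof -
  obtain e where e: "0 < e" "exp (log_mean f e) < cmod w" by (rule circle_det_less[OF w])
  have w0: "0 < cmod w" using e(2) by (rule less_trans[OF exp_gt_zero])
  define m where "m = log_mean f e"
  \<comment> \<open>Half of the gap, so that the coboundary error still leaves \<open>m + d\<close>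
    strictly below \<open>ln (cmod w)\<close>.\<close>
  define d where "d = (ln (cmod w) - m) / 2"
  have "m < ln (cmod w)" using e(2) by (simp add: exp_less_iff_less_ln[OF w0] m_def)
  then have d: "0 < d" "m + d < ln (cmod w)" by (simp_all add: d_def field_simps)
  obtain q where q: "continuous_on (sphere 0 1) q"
    "\<And>z. z \<in> sphere 0 1 \<Longrightarrow> \<bar>ln (cmod (f z) + e) - m - (q (rot * z) - q z)\<bar> \<le> d"
    using real_coboundary_approx[OF continuous_on_ln_cmod_plus[OF f e(1)] d(1)]
    unfolding m_def log_mean_def by metis
  let ?f = "\<lambda>z. of_real (exp (q z - q (rot * z))) * f z"
  have qr: "continuous_on (sphere 0 1) (\<lambda>z. q (rot * z))"
    by (intro continuous_on_compose2[OF q(1)] continuous_intros) (auto simp: norm_mult)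
  have cf: "continuous_on (sphere 0 1) ?f" using q(1) qr f by (intro continuous_intros)
  have "norm (calc ?f) \<le> exp (m + d)"
  proof (rule norm_calc_le[OF cf])
    fix z :: complex assume z: "z \<in> sphere 0 1"
    have pos: "0 < cmod (f z) + e" using e(1) by (simp add: add_nonneg_pos)
    have "cmod (?f z) \<le> exp (q z - q (rot * z)) * (cmod (f z) + e)"
      using e(1) by (simp add: norm_mult)
    also have "\<dots> = exp (ln (cmod (f z) + e) - (q (rot * z) - q z))"
      using pos by (simp add: exp_diff exp_ln)
    also have "\<dots> \<le> exp (m + d)" using q(2)[OF z] by simp
    finally show "cmod (?f z) \<le> exp (m + d)" .
  qed simp
  also have "\<dots> < cmod w" using d(2) by (simp add: exp_less_iff_less_ln[OF w0])
  finally have "norm (u o\<^sub>L calc ?f) < cmod w" by (simp add: norm_unitary_compose[OF unitary_u])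
  then have "op_invertible ((u o\<^sub>L calc ?f) - scalar_op w)"
    using cf by (intro op_invertible_diff_scalar) auto
  then show ?thesis by (rule invertible_of_similar[OF f q(1)])
qed

text \<open>Here the similarity makes the inverse of the modified operator have norm at most
  \<open>exp (d - m)\<close>, and the Neumann series is taken around that operator instead of around
  the scalar \<open>w\<close>.\<close>

lemma invertible_inside:
  assumes f: "continuous_on (sphere 0 1) f" and nz: "\<And>z. z \<in> sphere 0 1 \<Longrightarrow> f z \<noteq> 0"
    and w: "cmod w < circle_det f"
  shows "op_invertible ((u o\<^sub>L calc f) - scalar_op w)"
proof -
  define m where "m = circle_mean (\<lambda>z. ln (cmod (f z)))"
  have wm: "cmod w < exp m" using w circle_det_nonvanishing[OF f nz] by (simp only: m_def)
  obtain d where d: "0 < d" "cmod w < exp (m - d)"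
  \<comment> \<open>\<open>ln 0\<close> is 0 in HOL and says nothing about \<open>w = 0\<close>,
    hence the separate case.\<close>
  proof (cases "w = 0")
    case True
    then show ?thesis using that[of 1] by simp
  next
    case False
    then have "ln (cmod w) < m" using wm by (simp add: less_exp_iff_ln_less)
    then have "0 < (m - ln (cmod w)) / 2" "ln (cmod w) < m - (m - ln (cmod w)) / 2" by (simp_all add: field_simps)
    then show ?thesis using that[of "(m - ln (cmod w)) / 2"] False by (simp add: less_exp_iff_ln_less)
  qed
  have c: "continuous_on (sphere 0 1) (\<lambda>z. ln (cmod (f z)))"
    using nz by (intro continuous_intros f) auto
  obtain q where q: "continuous_on (sphere 0 1) q"
    "\<And>z. z \<in> sphere 0 1 \<Longrightarrow> \<bar>ln (cmod (f z)) - m - (q (rot * z) - q z)\<bar> \<le> d"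
    using real_coboundary_approx[OF c d(1)] unfolding m_def by metis
  let ?f = "\<lambda>z. of_real (exp (q z - q (rot * z))) * f z"
  have qr: "continuous_on (sphere 0 1) (\<lambda>z. q (rot * z))"
    by (intro continuous_on_compose2[OF q(1)] continuous_intros) (auto simp: norm_mult)
  have cf: "continuous_on (sphere 0 1) ?f" using q(1) qr f by (intro continuous_intros)
  have nzf: "?f z \<noteq> 0" if "z \<in> sphere 0 1" for z using nz[OF that] by simp
  let ?S = "calc (\<lambda>z. inverse (?f z)) o\<^sub>L adj u"
  have cS: "continuous_on (sphere 0 1) (\<lambda>z. inverse (?f z))"
    using nzf by (intro continuous_on_inverse cf) auto
  have "norm (calc (\<lambda>z. inverse (?f z))) \<le> inverse (exp (m - d))"
  proof (rule norm_calc_le[OF cS])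
    fix z :: complex assume z: "z \<in> sphere 0 1"
    have "exp (m - d) \<le> exp (ln (cmod (f z)) - (q (rot * z) - q z))" using q(2)[OF z] by simp
    also have "\<dots> = cmod (?f z)" using nz[OF z] by (simp add: norm_mult norm_divide exp_diff exp_ln)
    finally show "cmod (inverse (?f z)) \<le> inverse (exp (m - d))"
      unfolding norm_inverse by (intro le_imp_inverse_le) auto
  qed simp
  moreover have "norm (adj u) \<le> 1"
    by (rule order_trans[OF norm_adj_le]) (auto intro!: norm_blinfun_bound simp: norm_unitary_apply[OF unitary_u])
  ultimately have "norm ?S \<le> inverse (exp (m - d)) * 1"
    by (intro order_trans[OF norm_blinfun_compose] mult_mono) auto
  then have "norm (scalar_op w o\<^sub>L ?S) \<le> cmod w * inverse (exp (m - d))"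
    by (simp add: norm_scalar_op_compose mult_left_mono)
  also have "\<dots> < 1" using d(2) by (simp add: field_simps)
  finally have "op_invertible (id_blinfun - (scalar_op w o\<^sub>L ?S))"
    using cS by (intro op_invertible_one_minus) auto
  then have "op_invertible ((u o\<^sub>L calc ?f) o\<^sub>L (id_blinfun - (scalar_op w o\<^sub>L ?S)))"
    using calc_invertible[OF cf nzf] unitary_op_invertible[OF unitary_u] by (intro op_invertible_compose) auto
  also have "(u o\<^sub>L calc ?f) o\<^sub>L (id_blinfun - (scalar_op w o\<^sub>L ?S)) = (u o\<^sub>L calc ?f) - scalar_op w"
  proof -
    have "(u o\<^sub>L calc ?f) o\<^sub>L (scalar_op w o\<^sub>L ?S) = scalar_op w o\<^sub>L (u o\<^sub>L (calc ?f o\<^sub>L calc (\<lambda>z. inverse (?f z))) o\<^sub>L adj u)"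
      using cf by (simp add: blinfun_compose_assoc scalar_op_left_commute)
    also have "\<dots> = scalar_op w" by (simp only: calc_inverse(2)[OF cf nzf] blinfun_compose_id u_adj_u)
    finally show ?thesis by (simp add: blinfun_compose.diff_right)
  qed
  finally show ?thesis by (rule invertible_of_similar[OF f q(1)])
qed

section \<open>Powers of the operator and the rotation cocycle\<close>

definition rot_prod :: "(complex \<Rightarrow> complex) \<Rightarrow> nat \<Rightarrow> complex \<Rightarrow> complex"
  where "rot_prod f n z = (\<Prod>k<n. f (rot ^ k * z))"

lemma continuous_on_rot_prod: "continuous_on (sphere 0 1) f \<Longrightarrow> continuous_on (sphere 0 1) (rot_prod f n)"
  unfolding rot_prod_def by (intro continuous_on_prod continuous_on_rot)

text \<open>Collecting the powers of \<open>u\<close> on the left rotates the argument of each f(v)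
  once per factor passed. As powers of \<open>u\<close> are isometric, the growth of powers of the
  operator becomes a question about the function \<open>rot_prod f n\<close>.\<close>

lemma op_power_u_calc:
  assumes f: "continuous_on (sphere 0 1) f"
  shows "op_power (u o\<^sub>L calc f) n = op_power u n o\<^sub>L calc (rot_prod f n)"
proof (induction n)
  case 0
  then show ?case by (simp add: rot_prod_def calc_one)
next
  case (Suc n)
  have pass: "calc f o\<^sub>L op_power u n = op_power u n o\<^sub>L calc (\<lambda>z. f (rot ^ n * z))" for n
  proof (induction n)
    case (Suc n)
    have "calc f o\<^sub>L op_power u (Suc n) = calc f o\<^sub>L op_power u n o\<^sub>L u"
      by (simp add: op_power_commute blinfun_compose_assoc)
    also have "\<dots> = op_power u n o\<^sub>L (calc (\<lambda>z. f (rot ^ n * z)) o\<^sub>L u)"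
      by (simp add: Suc blinfun_compose_assoc)
    also have "\<dots> = op_power u n o\<^sub>L u o\<^sub>L calc (\<lambda>z. f (rot ^ n * (rot * z)))"
      by (simp add: calc_u[OF continuous_on_rot[OF f]] blinfun_compose_assoc)
    finally show ?case by (simp add: op_power_commute mult_ac)
  qed simp
  have "op_power (u o\<^sub>L calc f) (Suc n) = u o\<^sub>L (calc f o\<^sub>L op_power u n) o\<^sub>L calc (rot_prod f n)"
    by (simp add: Suc blinfun_compose_assoc)
  also have "\<dots> = op_power u (Suc n) o\<^sub>L (calc (\<lambda>z. f (rot ^ n * z)) o\<^sub>L calc (rot_prod f n))"
    by (simp add: pass blinfun_compose_assoc)
  also have "calc (\<lambda>z. f (rot ^ n * z)) o\<^sub>L calc (rot_prod f n) = calc (\<lambda>z. f (rot ^ n * z) * rot_prod f n z)"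
    by (rule calc_mult[symmetric, OF continuous_on_rot[OF f] continuous_on_rot_prod[OF f]])
  also have "(\<lambda>z. f (rot ^ n * z) * rot_prod f n z) = rot_prod f (Suc n)"
    by (simp add: rot_prod_def fun_eq_iff mult.commute)
  finally show ?case .
qed

lemma norm_op_power_u: "norm (blinfun_apply (op_power u n) x) = norm x"
  by (induction n) (simp_all add: norm_unitary_apply[OF unitary_u])

lemma norm_op_power_u_calc_apply:
  "continuous_on (sphere 0 1) f \<Longrightarrow>
    norm (blinfun_apply (op_power (u o\<^sub>L calc f) n) x) = norm (blinfun_apply (calc (rot_prod f n)) x)"
  by (simp add: op_power_u_calc norm_op_power_u)

lemma circle_mean_sum_rot:
  fixes h :: "complex \<Rightarrow> real"
  assumes "continuous_on (sphere 0 1) h"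
  shows "circle_mean (\<lambda>z. \<Sum>k<n. h (rot ^ k * z)) = real n * circle_mean h"
proof -
  have c: "continuous_on (sphere 0 1) (\<lambda>z. h (rot ^ k * z))" for k
    by (intro continuous_on_compose2[OF assms] continuous_intros) (auto simp: norm_mult norm_power)
  have "circle_mean (\<lambda>z. h (rot ^ k * z)) = circle_mean h" for k
    by (rule circle_mean_rotate[OF assms]) (simp add: norm_power)
  then show ?thesis by (subst circle_mean_sum) (auto intro: c)
qed

text \<open>A mean is at most a supremum: by rotation invariance \<open>ln\<close> of the
  regularized product has mean \<open>n * log_mean f e\<close>. The shift by \<open>e\<close> keeps
  the logarithms meaningful at zeros of \<open>f\<close> and is removed at the end.\<close>

lemma circle_det_power_le:
  assumes f: "continuous_on (sphere 0 1) f" and B: "\<And>z. z \<in> sphere 0 1 \<Longrightarrow> cmod (rot_prod f n z) \<le> B"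
  shows "circle_det f ^ n \<le> B"
proof -
  obtain K where K: "0 < K" "\<And>z. z \<in> sphere 0 1 \<Longrightarrow> cmod (f z) \<le> K"
    using continuous_circle_bounded[OF f] by metis
  have "circle_det f ^ n \<le> B + ((K + e) ^ n - K ^ n)" if e: "0 < e" for e
  proof -
    define b where "b = B + ((K + e) ^ n - K ^ n)"
    have rz: "rot ^ k * z \<in> sphere 0 1" if "z \<in> sphere 0 1" for k z
      using that by (simp add: norm_mult norm_power)
    have le: "(\<Prod>k<n. cmod (f (rot ^ k * z)) + e) \<le> b" if z: "z \<in> sphere 0 1" for z
    proof -
      have "(\<Prod>k<n. cmod (f (rot ^ k * z)) + e) \<le> (\<Prod>k<n. cmod (f (rot ^ k * z))) + ((K + e) ^ n - K ^ n)"
        using e K(2)[OF rz[OF z]] by (intro prod_add_le) auto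
      also have "(\<Prod>k<n. cmod (f (rot ^ k * z))) \<le> B"
        using B[OF z] by (simp add: rot_prod_def prod_norm)
      finally show ?thesis by (simp add: b_def)
    qed
    have pos: "0 < (\<Prod>k<n. cmod (f (rot ^ k * z)) + e)" for z
      using e by (intro prod_pos) (simp add: add_nonneg_pos)
    have b: "0 < b" using le[of 1] pos[of 1] by simp
    have "real n * log_mean f e = circle_mean (\<lambda>z. \<Sum>k<n. ln (cmod (f (rot ^ k * z)) + e))"
      unfolding log_mean_def by (rule circle_mean_sum_rot[symmetric, OF continuous_on_ln_cmod_plus[OF f e]])
    also have "\<dots> \<le> circle_mean (\<lambda>z. ln b)"
    proof (rule circle_mean_mono)
      have "continuous_on (sphere 0 1) (\<lambda>z. ln (cmod (f (rot ^ k * z)) + e))" for k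
        by (intro continuous_on_compose2[OF continuous_on_ln_cmod_plus[OF f e]] continuous_intros)
          (auto simp: norm_mult norm_power)
      then show "continuous_on (sphere 0 1) (\<lambda>z. \<Sum>k<n. ln (cmod (f (rot ^ k * z)) + e))"
        by (intro continuous_on_sum)
      fix z :: complex assume z: "z \<in> sphere 0 1"
      have "(\<Sum>k<n. ln (cmod (f (rot ^ k * z)) + e)) = ln (\<Prod>k<n. cmod (f (rot ^ k * z)) + e)"
        using e by (subst ln_prod) (auto simp: add_nonneg_eq_0_iff)
      also have "\<dots> \<le> ln b" using le[OF z] pos b by (subst ln_le_cancel_iff) auto
      finally show "(\<Sum>k<n. ln (cmod (f (rot ^ k * z)) + e)) \<le> ln b" .
    qed simp
    finally have "real n * log_mean f e \<le> ln b" by (simp add: circle_mean_const)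
    then have "exp (log_mean f e) ^ n \<le> b"
      using b by (metis exp_le_cancel_iff exp_ln exp_of_nat_mult)
    moreover have "circle_det f ^ n \<le> exp (log_mean f e) ^ n"
      by (intro power_mono circle_det_le e circle_det_nonneg)
    ultimately show ?thesis unfolding b_def by linarith
  qed
  then have "\<forall>\<^sub>F e in at_right 0. circle_det f ^ n \<le> B + ((K + e) ^ n - K ^ n)"
    by (intro eventually_mono[OF eventually_at_right_less]) auto
  moreover have "((\<lambda>e. B + ((K + e) ^ n - K ^ n)) \<longlongrightarrow> B + ((K + 0) ^ n - K ^ n)) (at_right 0)"
    by (intro tendsto_intros)
  ultimately have "circle_det f ^ n \<le> B + ((K + 0) ^ n - K ^ n)"
    by (intro tendsto_lowerbound[where F = "at_right (0 :: real)"]) auto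
  then show ?thesis by simp
qed

end

section \<open>Resolvents on the critical circle\<close>

lemma left_right_inverse_unique:
  assumes "S o\<^sub>L A = id_blinfun" "A o\<^sub>L S' = id_blinfun"
  shows "S = S'"
proof -
  have "S = S o\<^sub>L (A o\<^sub>L S')" by (simp add: assms(2))
  also have "\<dots> = S'" by (simp add: assms(1) flip: blinfun_compose_assoc)
  finally show ?thesis .
qed

lemma inverse_commute:
  assumes "S o\<^sub>L A = id_blinfun" "A o\<^sub>L S = id_blinfun" "B o\<^sub>L A = A o\<^sub>L B"
  shows "B o\<^sub>L S = S o\<^sub>L B"
proof -
  have "B o\<^sub>L S = S o\<^sub>L (A o\<^sub>L B) o\<^sub>L S" by (simp add: assms(1) flip: blinfun_compose_assoc)
  also have "\<dots> = S o\<^sub>L B o\<^sub>L (A o\<^sub>L S)" by (simp add: assms(3)[symmetric] blinfun_compose_assoc)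
  finally show ?thesis by (simp add: assms(2))
qed

text \<open>The resolvent identity bounds \<open>G x - G s\<close> by
  \<open>norm (G x) * d x\<close>; what has to be found is a local bound for
  \<open>norm (G x)\<close> itself.\<close>

lemma continuous_on_op_inverse:
  fixes A :: "'x :: metric_space \<Rightarrow> 'a :: real_normed_vector \<Rightarrow>\<^sub>L 'a"
  assumes A: "continuous_on X A"
    and inv: "\<And>x. x \<in> X \<Longrightarrow> G x o\<^sub>L A x = id_blinfun" "\<And>x. x \<in> X \<Longrightarrow> A x o\<^sub>L G x = id_blinfun"
  shows "continuous_on X G"
  unfolding continuous_on_def
proof
  fix s assume s: "s \<in> X"
  define d where "d x = norm (A s - A x) * norm (G s)" for x
  have "((\<lambda>x. A x) \<longlongrightarrow> A s) (at s within X)" using A s by (simp add: continuous_on_def)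
  then have "((\<lambda>x. norm (A s - A x) * norm (G s)) \<longlongrightarrow> norm (A s - A s) * norm (G s)) (at s within X)"
    by (intro tendsto_intros)
  then have d: "(d \<longlongrightarrow> 0) (at s within X)" by (simp add: d_def[abs_def])
  have key: "norm (G x - G s) \<le> norm (G x) * d x" if "x \<in> X" for x
  proof -
    have "G x - G s = G x o\<^sub>L (A s - A x) o\<^sub>L G s"
      by (simp add: blinfun_compose.diff_left blinfun_compose.diff_right blinfun_compose_assoc inv(2)[OF s])
        (simp add: inv(1)[OF that] flip: blinfun_compose_assoc)
    also have "norm \<dots> \<le> norm (G x o\<^sub>L (A s - A x)) * norm (G s)" by (rule norm_blinfun_compose)
    also have "\<dots> \<le> norm (G x) * norm (A s - A x) * norm (G s)"
      by (intro mult_right_mono norm_blinfun_compose) simp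
    finally show ?thesis by (simp add: d_def mult.assoc)
  qed
  have half: "\<forall>\<^sub>F x in at s within X. d x < 1 / 2" by (rule order_tendstoD(2)[OF d]) simp
  have X: "\<forall>\<^sub>F x in at s within X. x \<in> X" by (simp add: eventually_at_filter)
  have bound: "\<forall>\<^sub>F x in at s within X. norm (G x - G s) \<le> 2 * norm (G s) * d x"
    using half X
  proof eventually_elim
    case (elim x)
    \<comment> \<open>Where \<open>d x\<close> is below 1/2 the last term is absorbed into the
      left-hand side, which bounds \<open>norm (G x)\<close> by
      \<open>2 * norm (G s)\<close>.\<close>
    have "norm (G x) \<le> norm (G s) + norm (G x - G s)" by (rule norm_triangle_sub)
    also have "\<dots> \<le> norm (G s) + norm (G x) * (1/2)"
    proof -
      have "norm (G x) * d x \<le> norm (G x) * (1/2)" using elim by (intro mult_left_mono) auto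
      with key[of x] elim show ?thesis by linarith
    qed
    finally have "norm (G x) \<le> 2 * norm (G s)" by simp
    then have "norm (G x) * d x \<le> 2 * norm (G s) * d x"
      by (intro mult_right_mono) (simp_all add: d_def)
    with key[of x] elim show ?case by simp
  qed
  have "((\<lambda>x. 2 * norm (G s) * d x) \<longlongrightarrow> 2 * norm (G s) * 0) (at s within X)"
    by (intro tendsto_intros d)
  then have "((\<lambda>x. 2 * norm (G s) * d x) \<longlongrightarrow> 0) (at s within X)" by simp
  with bound have "((\<lambda>x. G x - G s) \<longlongrightarrow> 0) (at s within X)" by (rule Lim_null_comparison)
  then show "(G \<longlongrightarrow> G s) (at s within X)" by (simp add: LIM_zero_iff)
qed

lemma op_invertible_open:
  fixes A :: "'h :: complex_hilbert \<Rightarrow>\<^sub>L 'h"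
  assumes "op_invertible A" "A \<in> bounded_ops"
  obtains d where "0 < d" "\<And>B. B \<in> bounded_ops \<Longrightarrow> norm (A - B) < d \<Longrightarrow> op_invertible B"
proof -
  obtain S where S: "S \<in> bounded_ops" "S o\<^sub>L A = id_blinfun" "A o\<^sub>L S = id_blinfun"
    using assms(1) by (auto simp: op_invertible_def)
  have "op_invertible B" if B: "B \<in> bounded_ops" "norm (A - B) < 1 / (norm S + 1)" for B
  proof -
    have "norm (S o\<^sub>L (A - B)) \<le> norm S * norm (A - B)" by (rule norm_blinfun_compose)
    also have "\<dots> \<le> (norm S + 1) * norm (A - B)" by (intro mult_right_mono) auto
    also have "\<dots> < 1" using B(2) by (simp add: pos_less_divide_eq add_nonneg_pos mult.commute)
    finally have "op_invertible (id_blinfun - (S o\<^sub>L (A - B)))"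
      using S B assms by (intro op_invertible_one_minus) auto
    with assms(1) have "op_invertible (A o\<^sub>L (id_blinfun - (S o\<^sub>L (A - B))))"
      by (rule op_invertible_compose)
    also have "A o\<^sub>L (id_blinfun - (S o\<^sub>L (A - B))) = B"
      by (simp add: blinfun_compose.diff_right S(3) flip: blinfun_compose_assoc)
    finally show ?thesis .
  qed
  moreover have "0 < 1 / (norm S + 1)" by (simp add: add_nonneg_pos)
  ultimately show ?thesis using that by blast
qed

text \<open>The integrand approximates the indicator of the zero set of \<open>f\<close>. A positive
  determinant makes the logarithm integrable, so by a Chebyshev-type estimate \<open>f\<close> is
  small only on a set of small measure.\<close>

lemma small_circle_mean:
  assumes f: "continuous_on (sphere 0 1) f" and det: "0 < circle_det f" and e: "0 < e"
  obtains d where "0 < d" "circle_mean (\<lambda>z. d / ((cmod (f z))\<^sup>2 + d)) \<le> e"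
proof -
  obtain K where K: "0 < K" "\<And>z. z \<in> sphere 0 1 \<Longrightarrow> cmod (f z) \<le> K"
    using continuous_circle_bounded[OF f] by metis
  define C where "C = \<bar>ln (K + 1) - ln (circle_det f)\<bar>"
  \<comment> \<open>Chosen to make \<open>C / L\<close> at most \<open>e / 2\<close>; the absolute
    value in \<open>C\<close> keeps \<open>L\<close> positive.\<close>
  define L where "L = 2 * C / e + 1"
  have L: "0 < L" using e by (simp add: L_def C_def add_nonneg_pos)
  \<comment> \<open>Where \<open>s \<le> cmod (f z)\<close>, the first two bounds give
    \<open>s * s \<le> e / 2\<close>. Elsewhere \<open>cmod (f z) + s\<close> is below
    \<open>2 * s\<close>, and the third bound makes the gap to \<open>ln (K + 1)\<close> at least
    \<open>L\<close>.\<close>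
  define s where "s = min 1 (min (e / 2) ((K + 1) / 2 * exp (- L)))"
  have s: "0 < s" "s \<le> 1" "s \<le> e / 2" "s \<le> (K + 1) / 2 * exp (- L)"
    using e K(1) by (auto simp: s_def)
  define d where "d = s ^ 4"
  have d: "0 < d" using s by (simp add: d_def)
  have bound: "d / ((cmod (f z))\<^sup>2 + d) \<le> e / 2 + (ln (K + 1) - ln (cmod (f z) + s)) / L" if z: "z \<in> sphere 0 1" for z
  proof -
    have "cmod (f z) + s \<le> K + 1" using K(2)[OF z] s by linarith
    then have nn: "0 \<le> ln (K + 1) - ln (cmod (f z) + s)"
    proof -
      have "ln (cmod (f z) + s) \<le> ln (K + 1)"
        using \<open>cmod (f z) + s \<le> K + 1\<close> s K(1) by (subst ln_le_cancel_iff) (auto intro: add_nonneg_pos)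
      then show ?thesis by simp
    qed
    show ?thesis
    proof (cases "s \<le> cmod (f z)")
      case True
      have "d / ((cmod (f z))\<^sup>2 + d) \<le> s ^ 4 / s\<^sup>2"
        unfolding d_def
      proof (rule divide_left_mono)
        have "s\<^sup>2 \<le> (cmod (f z))\<^sup>2" using True s by (intro power_mono) auto
        then show "s\<^sup>2 \<le> (cmod (f z))\<^sup>2 + s ^ 4" using s by (simp add: add_increasing2)
        show "0 < ((cmod (f z))\<^sup>2 + s ^ 4) * s\<^sup>2" using s by (intro mult_pos_pos add_nonneg_pos) auto
      qed (use s in auto)
      also have "\<dots> = s * s" using s by (simp add: power4_eq_xxxx power2_eq_square)
      also have "\<dots> \<le> 1 * (e / 2)" using s e by (intro mult_mono) auto
      finally have "d / ((cmod (f z))\<^sup>2 + d) \<le> e / 2" by simp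
      moreover have "0 \<le> (ln (K + 1) - ln (cmod (f z) + s)) / L" using nn L by simp
      ultimately show ?thesis by linarith
    next
      case False
      have "ln (cmod (f z) + s) \<le> ln ((K + 1) * exp (- L))"
        using False s K(1) by (subst ln_le_cancel_iff) (auto simp: add_nonneg_pos)
      also have "\<dots> = ln (K + 1) - L" using K(1) by (simp add: ln_mult)
      finally have "1 \<le> (ln (K + 1) - ln (cmod (f z) + s)) / L" using L by (simp add: pos_le_divide_eq)
      moreover have "d / ((cmod (f z))\<^sup>2 + d) \<le> 1" using d by (simp add: add_nonneg_pos)
      ultimately show ?thesis using e by linarith
    qed
  qed
  have cl: "continuous_on (sphere 0 1) (\<lambda>z. ln (cmod (f z) + s))"
    by (rule continuous_on_ln_cmod_plus[OF f s(1)])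
  have nz: "(cmod (f z))\<^sup>2 + d \<noteq> 0" for z using d by (simp add: add_nonneg_eq_0_iff)
  have "circle_mean (\<lambda>z. d / ((cmod (f z))\<^sup>2 + d)) \<le> circle_mean (\<lambda>z. e / 2 + (ln (K + 1) - ln (cmod (f z) + s)) * inverse L)"
    using nz by (intro circle_mean_mono continuous_intros f cl) (auto simp: bound[unfolded divide_inverse[of _ L]])
  also have "(\<lambda>z. e / 2 + (ln (K + 1) - ln (cmod (f z) + s)) * inverse L)
      = (\<lambda>z. (e / 2 + ln (K + 1) * inverse L) - inverse L * ln (cmod (f z) + s))"
    by (simp add: algebra_simps)
  also have "circle_mean \<dots> = (e / 2 + ln (K + 1) * inverse L) - inverse L * log_mean f s"
    unfolding log_mean_def
    by (subst circle_mean_diff) (auto intro!: continuous_intros cl simp: circle_mean_const circle_mean_mult cl)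
  also have "\<dots> = e / 2 + (ln (K + 1) - log_mean f s) / L"
    by (simp add: diff_divide_distrib inverse_eq_divide)
  also have "\<dots> \<le> e / 2 + C / L"
  proof -
    have "ln (circle_det f) \<le> log_mean f s"
      using circle_det_le[OF s(1), of f] det by (metis exp_gt_zero ln_exp ln_le_cancel_iff)
    then have "ln (K + 1) - log_mean f s \<le> C" by (simp add: C_def)
    then show ?thesis using L by (simp add: divide_right_mono)
  qed
  also have "C / L \<le> e / 2"
  proof -
    have "C \<le> e / 2 * L" using e by (simp add: L_def field_simps)
    then show ?thesis using L by (simp add: pos_divide_le_eq)
  qed
  finally show ?thesis using that[OF d] by simp
qed

context rotation_factor
begin

text \<open>With \<open>b\<close> as a regularized inverse one has \<open>1 = f * b + g\<close>, so
  \<open>D\<close> equals \<open>D\<close> times g(v). The 2-norm of g(v) is arbitrarily small,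
  hence so is that of \<open>D\<close>, and faithfulness of the trace concludes.\<close>

lemma zero_if_compose_calc_zero:
  assumes f: "continuous_on (sphere 0 1) f" and det: "0 < circle_det f"
    and D: "D \<in> R" "D o\<^sub>L calc f = 0"
  shows "D = 0"
proof -
  have le: "Re (\<tau> (adj D o\<^sub>L D)) \<le> (norm D)\<^sup>2 * e" if "0 < e" for e
  proof -
    obtain d where d: "0 < d" "circle_mean (\<lambda>z. d / ((cmod (f z))\<^sup>2 + d)) \<le> e"
      by (rule small_circle_mean[OF f det \<open>0 < e\<close>])
    define g where "g z = d / ((cmod (f z))\<^sup>2 + d)" for z
    have nz: "(cmod (f z))\<^sup>2 + d \<noteq> 0" for z using d(1) by (simp add: add_nonneg_eq_0_iff)
    have g: "continuous_on (sphere 0 1) g" unfolding g_def using nz by (intro continuous_intros f) auto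
    have g01: "0 \<le> g z" "g z \<le> 1" for z
      using d(1) by (simp_all add: g_def add_nonneg_pos)
    define b where "b z = cnj (f z) / complex_of_real ((cmod (f z))\<^sup>2 + d)" for z
    have b: "continuous_on (sphere 0 1) b" unfolding b_def using nz
      by (intro continuous_intros f) (simp del: of_real_add)
    have cg: "continuous_on (sphere 0 1) (\<lambda>z. complex_of_real (g z))" using g by (intro continuous_intros)
    have "1 = f z * b z + complex_of_real (g z)" for z
    proof -
      have "f z * b z + complex_of_real (g z) = complex_of_real ((cmod (f z))\<^sup>2 + d) / complex_of_real ((cmod (f z))\<^sup>2 + d)"
        unfolding b_def g_def times_divide_eq_right complex_norm_square[symmetric]
        by (simp only: add_divide_distrib of_real_add of_real_divide)
      then show ?thesis using nz[of z] by (simp del: of_real_add)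
    qed
    then have "id_blinfun = calc (\<lambda>z. f z * b z + complex_of_real (g z))"
      by (simp add: calc_one flip: calc_one)
    also have "\<dots> = (calc f o\<^sub>L calc b) + calc (\<lambda>z. complex_of_real (g z))"
      using f b cg by (simp add: calc_add calc_mult continuous_on_mult)
    finally have one: "(calc f o\<^sub>L calc b) + calc (\<lambda>z. complex_of_real (g z)) = id_blinfun" ..
    have "D = D o\<^sub>L ((calc f o\<^sub>L calc b) + calc (\<lambda>z. complex_of_real (g z)))"
      by (simp only: one blinfun_compose_id)
    also have "\<dots> = ((D o\<^sub>L calc f) o\<^sub>L calc b) + (D o\<^sub>L calc (\<lambda>z. complex_of_real (g z)))"
      by (simp only: blinfun_compose.add_right blinfun_compose_assoc)
    finally have "D = D o\<^sub>L calc (\<lambda>z. complex_of_real (g z))" using D(2) by simp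
    then have "Re (\<tau> (adj D o\<^sub>L D)) \<le> (norm D)\<^sup>2 * Re (\<tau> (adj (calc (\<lambda>z. complex_of_real (g z))) o\<^sub>L calc (\<lambda>z. complex_of_real (g z))))"
      using trace_norm_square_le[OF D(1) calc_R[OF cg]] by simp
    also have "adj (calc (\<lambda>z. complex_of_real (g z))) o\<^sub>L calc (\<lambda>z. complex_of_real (g z)) = calc (\<lambda>z. complex_of_real (g z * g z))"
      using cg by (simp add: adj_calc calc_mult)
    also have "Re (\<tau> \<dots>) = circle_mean (\<lambda>z. g z * g z)"
    proof -
      have "continuous_on (sphere 0 1) (\<lambda>z. g z * g z)" using g by (intro continuous_intros)
      then show ?thesis by (simp only: trace_calc circle_mean_of_real continuous_on_of_real Re_complex_of_real)
    qed
    also have "(norm D)\<^sup>2 * \<dots> \<le> (norm D)\<^sup>2 * e"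
    proof -
      have "circle_mean (\<lambda>z. g z * g z) \<le> circle_mean g"
        \<comment> \<open>Values in \<open>[0, 1]\<close> are at least their squares.\<close>
        using g g01 by (intro circle_mean_mono continuous_intros) (auto intro: mult_left_le)
      then show ?thesis using d(2) by (intro mult_left_mono) (auto simp: g_def[abs_def])
    qed
    finally show ?thesis .
  qed
  have "Re (\<tau> (adj D o\<^sub>L D)) \<le> 0"
  proof (rule field_le_epsilon)
    fix e :: real assume e: "0 < e"
    have "Re (\<tau> (adj D o\<^sub>L D)) \<le> (norm D)\<^sup>2 * (e / ((norm D)\<^sup>2 + 1))"
      using e by (intro le) (simp add: add_nonneg_pos)
    also have "\<dots> = (norm D)\<^sup>2 / ((norm D)\<^sup>2 + 1) * e" by simp
    also have "\<dots> \<le> 1 * e" using e by (intro mult_right_mono) (auto simp: add_nonneg_pos)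
    finally show "Re (\<tau> (adj D o\<^sub>L D)) \<le> 0 + e" by simp
  qed
  moreover have "\<tau> (adj D o\<^sub>L D) \<in> \<real>\<^sub>\<ge>\<^sub>0" by (rule trace_nonneg[OF D(1)])
  ultimately have "\<tau> (adj D o\<^sub>L D) = 0" by (auto elim!: nonneg_Reals_cases)
  then show ?thesis by (rule trace_faithful[OF D(1)])
qed

lemma v_adjoint_action:
  assumes f: "continuous_on (sphere 0 1) f"
  shows "v o\<^sub>L (u o\<^sub>L calc f) o\<^sub>L adj v = scalar_op rot o\<^sub>L (u o\<^sub>L calc f)"
proof -
  have c: "v o\<^sub>L calc f = calc f o\<^sub>L v"
    using calc_commute[OF continuous_on_id f] by (simp add: calc_id)
  have "v o\<^sub>L (u o\<^sub>L calc f) o\<^sub>L adj v = (v o\<^sub>L u) o\<^sub>L (calc f o\<^sub>L adj v)"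
    by (simp add: blinfun_compose_assoc)
  also have "\<dots> = scalar_op rot o\<^sub>L (u o\<^sub>L ((v o\<^sub>L calc f) o\<^sub>L adj v))"
    by (simp add: v_u blinfun_compose_assoc)
  also have "\<dots> = scalar_op rot o\<^sub>L (u o\<^sub>L (calc f o\<^sub>L (v o\<^sub>L adj v)))"
    by (simp only: c blinfun_compose_assoc)
  finally show ?thesis by (simp add: v_adj_v)
qed

text \<open>Invertibility is an open condition and is invariant under rotation of the scalar, while
  orbits of an irrational rotation are dense; so one resolvent point yields the whole
  circle.\<close>

lemma invertible_on_circle:
  assumes f: "continuous_on (sphere 0 1) f" and r: "0 < r" "cmod w0 = r"
    and inv: "op_invertible ((u o\<^sub>L calc f) - scalar_op w0)" and w: "cmod w = r"
  shows "op_invertible ((u o\<^sub>L calc f) - scalar_op w)"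
proof -
  let ?T = "u o\<^sub>L calc f"
  have T: "?T \<in> bounded_ops" using f by auto
  have pull: "op_invertible (?T - scalar_op a)" if "op_invertible (?T - scalar_op (rot * a))" for a
  proof -
    have "adj v o\<^sub>L (v o\<^sub>L ?T o\<^sub>L adj v) o\<^sub>L v = (adj v o\<^sub>L v) o\<^sub>L ?T o\<^sub>L (adj v o\<^sub>L v)"
      by (simp add: blinfun_compose_assoc)
    then have e1: "adj v o\<^sub>L (scalar_op rot o\<^sub>L ?T) o\<^sub>L v = ?T"
      by (simp add: v_adjoint_action[OF f] adj_v_v)
    have e2: "v o\<^sub>L ?T o\<^sub>L adj v = scalar_op rot o\<^sub>L ?T" by (rule v_adjoint_action[OF f])
    have "v o\<^sub>L scalar_op (rot * a) o\<^sub>L adj v = scalar_op (rot * a)"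
      by (simp add: scalar_op_commute blinfun_compose_assoc v_adj_v)
    then have "v o\<^sub>L (?T - scalar_op (rot * a)) o\<^sub>L adj v = scalar_op rot o\<^sub>L (?T - scalar_op a)"
      by (simp add: blinfun_compose.diff_left blinfun_compose.diff_right e2 scalar_op_mult)
    moreover have "op_invertible v" by (rule unitary_op_invertible[OF unitary])
    moreover have "op_invertible (adj v)"
      by (rule op_invertibleI[of v]) (auto simp: v_adj_v adj_v_v)
    ultimately have "op_invertible (scalar_op rot o\<^sub>L (?T - scalar_op a))"
      using that op_invertible_compose by metis
    then have "op_invertible (scalar_op (inverse rot) o\<^sub>L (scalar_op rot o\<^sub>L (?T - scalar_op a)))"
      by (rule op_invertible_compose[OF op_invertible_scalar_op, rotated]) simp
    then show ?thesis
      by (simp only: scalar_op_mult_left left_inverse[OF cis_neq_zero] scalar_op_one blinfun_compose_id)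
  qed
  have pull_n: "op_invertible (?T - scalar_op a)" if "op_invertible (?T - scalar_op (rot ^ n * a))" for n a
    using that
  proof (induction n arbitrary: a)
    case (Suc n)
    then have "op_invertible (?T - scalar_op (rot ^ n * (rot * a)))" by (simp add: mult_ac)
    then show ?case using Suc.IH pull by blast
  qed simp
  obtain d where d: "0 < d" "\<And>B. B \<in> bounded_ops \<Longrightarrow> norm ((?T - scalar_op w0) - B) < d \<Longrightarrow> op_invertible B"
    using op_invertible_open[OF inv] T by blast
  \<comment> \<open>\<open>pull\<close> leads from \<open>rot * a\<close> back to \<open>a\<close>,
    so the forward orbit of \<open>w\<close> has to come near \<open>w0\<close>.\<close>
  obtain n where n: "cmod (rot ^ n * (w / of_real r) - w0 / of_real r) < d / r"
    using irrational_rotation_orbit_dense[OF irrational, of "w / of_real r" "w0 / of_real r" "d / r"] r w d(1)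
    by (auto simp: norm_divide)
  have "rot ^ n * w - w0 = of_real r * (rot ^ n * (w / of_real r) - w0 / of_real r)"
    using r by (simp add: field_simps)
  then have "cmod (rot ^ n * w - w0) = r * cmod (rot ^ n * (w / of_real r) - w0 / of_real r)"
    using r by (simp add: norm_mult)
  also have "\<dots> < d" using n r by (simp add: pos_less_divide_eq mult.commute)
  finally have "norm (scalar_op (rot ^ n * w - w0) :: 'h \<Rightarrow>\<^sub>L 'h) < d"
    using norm_scalar_op_le by (rule le_less_trans[rotated])
  then have "op_invertible (?T - scalar_op (rot ^ n * w))"
    using T by (intro d(2)) (auto simp: scalar_op_diff)
  then show ?thesis by (rule pull_n)
qed

end

section \<open>Fourier coefficients of the resolvent on a circle\<close>

locale circle_resolvent = rotation_factor v u R \<tau> \<theta>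
  for v :: "'h :: complex_hilbert \<Rightarrow>\<^sub>L 'h" and u R \<tau> \<theta> +
  fixes f :: "complex \<Rightarrow> complex" and r :: real
  assumes f: "continuous_on (sphere 0 1) f"
    and r: "0 < r"
    and resolvent: "\<And>w. cmod w = r \<Longrightarrow> op_invertible ((u o\<^sub>L calc f) - scalar_op w)"
begin

abbreviation T :: "'h \<Rightarrow>\<^sub>L 'h" where "T \<equiv> u o\<^sub>L calc f"

text \<open>On the unit circle \<open>cnj z\<close> is \<open>1 / z\<close>, so this is
  \<open>1 - T / (r z)\<close> written as a continuous function without division by
  \<open>z\<close>.\<close>

definition A :: "complex \<Rightarrow> 'h \<Rightarrow>\<^sub>L 'h"
  where "A z = id_blinfun - (scalar_op (cnj z / of_real r) o\<^sub>L T)"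

definition G :: "complex \<Rightarrow> 'h \<Rightarrow>\<^sub>L 'h"
  where "G z = (SOME S. S \<in> bounded_ops \<and> S o\<^sub>L A z = id_blinfun \<and> A z o\<^sub>L S = id_blinfun)"

lemma T_bounded [simp, intro]: "T \<in> bounded_ops" and T_R [simp, intro]: "T \<in> R"
  using f by auto

lemma A_invertible:
  assumes z: "z \<in> sphere 0 1"
  shows "op_invertible (A z)"
proof -
  have z1: "cnj z * z = 1" "z \<noteq> 0"
    using z complex_norm_square[of z] by (auto simp: mult.commute)
  have "op_invertible (T - scalar_op (of_real r * z))"
    using z r by (intro resolvent) (simp add: norm_mult)
  then have "op_invertible (scalar_op (- (cnj z / of_real r)) o\<^sub>L (T - scalar_op (of_real r * z)))"
    using z1(2) r by (intro op_invertible_compose[OF op_invertible_scalar_op]) auto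
  also have "scalar_op (- (cnj z / of_real r)) o\<^sub>L (T - scalar_op (of_real r * z)) = A z"
    using z1 r by (simp add: A_def blinfun_compose.diff_right scalar_op_mult scalar_op_minus blinfun_compose.minus_left)
  finally show ?thesis .
qed

lemma G:
  assumes "z \<in> sphere 0 1"
  shows "G z \<in> bounded_ops" "G z o\<^sub>L A z = id_blinfun" "A z o\<^sub>L G z = id_blinfun"
proof -
  have "\<exists>S. S \<in> bounded_ops \<and> S o\<^sub>L A z = id_blinfun \<and> A z o\<^sub>L S = id_blinfun"
    using A_invertible[OF assms] by (auto simp: op_invertible_def)
  from someI_ex[OF this]
  show "G z \<in> bounded_ops" "G z o\<^sub>L A z = id_blinfun" "A z o\<^sub>L G z = id_blinfun"
    unfolding G_def by blast+
qed

lemma continuous_on_scalar_op: "continuous_on S g \<Longrightarrow> continuous_on S (\<lambda>z. scalar_op (g z) :: 'h \<Rightarrow>\<^sub>L 'h)"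
  by (rule bounded_linear.continuous_on[OF bounded_linear_scalar_op])

lemma continuous_on_G: "continuous_on (sphere 0 1) G"
proof (rule continuous_on_op_inverse[OF _ G(2,3)])
  show "continuous_on (sphere 0 1) A"
    unfolding A_def[abs_def] using r
    by (intro continuous_on_diff continuous_on_const blinfun_compose.continuous_on continuous_on_scalar_op
        continuous_intros) auto
qed auto

lemma G_commute:
  assumes z: "z \<in> sphere 0 1" and B: "B \<in> bounded_ops" "B o\<^sub>L T = T o\<^sub>L B"
  shows "B o\<^sub>L G z = G z o\<^sub>L B"
proof (rule inverse_commute[OF G(2,3)[OF z]])
  show "B o\<^sub>L A z = A z o\<^sub>L B"
    using B by (simp add: A_def blinfun_compose.diff_left blinfun_compose.diff_right
        scalar_op_left_commute blinfun_compose_assoc)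
qed

text \<open>The zeroth coefficient is the Riesz idempotent of the part of the spectrum inside the circle
  of radius \<open>r\<close>.\<close>

definition fourier :: "int \<Rightarrow> 'h \<Rightarrow>\<^sub>L 'h"
  where "fourier k = circle_mean (\<lambda>z. scalar_op (z powi (- k)) o\<^sub>L G z)"

lemma continuous_on_fourier: "continuous_on (sphere 0 1) (\<lambda>z. scalar_op (z powi k) o\<^sub>L G z)"
  by (intro blinfun_compose.continuous_on continuous_on_scalar_op continuous_on_powi_circle continuous_on_G)

text \<open>Inverses and averages both preserve commutation with \<open>T\<close>. Taking
  \<open>B\<close> scalar gives membership in \<open>bounded_ops\<close>, and taking
  \<open>B\<close> in the commutant of the generators gives membership in \<open>R\<close>.\<close>

lemma fourier_commute:
  assumes B: "B \<in> bounded_ops" "B o\<^sub>L T = T o\<^sub>L B"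
  shows "B o\<^sub>L fourier k = fourier k o\<^sub>L B"
proof -
  have "B o\<^sub>L fourier k = circle_mean (\<lambda>z. B o\<^sub>L (scalar_op (z powi (- k)) o\<^sub>L G z))"
    unfolding fourier_def
    by (rule circle_mean_linear[symmetric, OF blinfun_compose.bounded_linear_right continuous_on_fourier])
  also have "\<dots> = circle_mean (\<lambda>z. (scalar_op (z powi (- k)) o\<^sub>L G z) o\<^sub>L B)"
    unfolding circle_mean_def
    by (intro integral_cong) (simp add: scalar_op_left_commute B G_commute blinfun_compose_assoc)
  also have "\<dots> = fourier k o\<^sub>L B"
    unfolding fourier_def
    by (rule circle_mean_linear[OF blinfun_compose.bounded_linear_left continuous_on_fourier])
  finally show ?thesis .
qed

lemma fourier_bounded [simp, intro]: "fourier k \<in> bounded_ops"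
proof -
  have "scalar_op c o\<^sub>L fourier k = fourier k o\<^sub>L scalar_op c" for c
    by (rule fourier_commute[OF _ scalar_op_commute[OF T_bounded, symmetric]]) simp
  then show ?thesis by (simp add: bounded_ops_eq_commutant)
qed

lemma fourier_R [simp, intro]: "fourier k \<in> R"
  unfolding R_iff
proof (intro conjI ballI)
  fix B assume B: "B \<in> commutant {u, v}"
  then have "T o\<^sub>L B = B o\<^sub>L T" using T_R R_iff by blast
  then show "fourier k o\<^sub>L B = B o\<^sub>L fourier k"
    using B by (intro fourier_commute[symmetric]) (auto simp: commutant_def)
qed auto

definition T' :: "'h \<Rightarrow>\<^sub>L 'h" where "T' = scalar_op (1 / of_real r) o\<^sub>L T"

text \<open>Average \<open>G = 1 + T' G / z\<close> against \<open>z powi (- k)\<close>: the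
  constant term survives only for \<open>k = 0\<close>, and the factor \<open>1 / z\<close> shifts
  the index.\<close>

lemma fourier_rec: "fourier k = (if k = 0 then id_blinfun else 0) + (T' o\<^sub>L fourier (k + 1))"
proof -
  have "scalar_op (z powi (- k)) o\<^sub>L G z = scalar_op (z powi (- k)) + (T' o\<^sub>L (scalar_op (z powi (- (k + 1))) o\<^sub>L G z))"
    if z: "z \<in> sphere 0 1" for z
  proof -
    have z0: "z \<noteq> 0" "cnj z = inverse z" using z cnj_circle by auto
    have "G z = id_blinfun + (scalar_op (cnj z / of_real r) o\<^sub>L (T o\<^sub>L G z))"
      using G(3)[OF z] by (simp add: A_def blinfun_compose.diff_left blinfun_compose_assoc diff_eq_eq)
    then have "scalar_op (z powi (- k)) o\<^sub>L G z
        = scalar_op (z powi (- k)) o\<^sub>L (id_blinfun + (scalar_op (cnj z / of_real r) o\<^sub>L (T o\<^sub>L G z)))"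
      by simp
    also have "\<dots> = scalar_op (z powi (- k)) + (scalar_op (z powi (- k) * (cnj z / of_real r)) o\<^sub>L (T o\<^sub>L G z))"
      by (simp add: blinfun_compose.add_right scalar_op_mult_left)
    also have "z powi (- k) * (cnj z / of_real r) = 1 / of_real r * z powi (- (k + 1))"
    proof -
      have "z powi (- k + - 1) = z powi (- k) * z powi (- 1)" using z0(1) by (intro power_int_add) auto
      then have "z powi (- (k + 1)) = z powi (- k) * inverse z" by (simp add: power_int_minus)
      then show ?thesis by (simp add: z0(2) divide_inverse mult_ac)
    qed
    also have "scalar_op (1 / of_real r * z powi (- (k + 1))) o\<^sub>L (T o\<^sub>L G z) = T' o\<^sub>L (scalar_op (z powi (- (k + 1))) o\<^sub>L G z)"
      unfolding T'_def blinfun_compose_assoc[of "scalar_op (1 / of_real r)" T]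
      by (simp only: scalar_op_left_commute[OF T_bounded] scalar_op_mult_left)
    finally show ?thesis .
  qed
  then have "fourier k = circle_mean (\<lambda>z. scalar_op (z powi (- k)) + (T' o\<^sub>L (scalar_op (z powi (- (k + 1))) o\<^sub>L G z)))"
    unfolding fourier_def circle_mean_def by (intro integral_cong) simp
  also have "\<dots> = circle_mean (\<lambda>z. scalar_op (z powi (- k))) + circle_mean (\<lambda>z. T' o\<^sub>L (scalar_op (z powi (- (k + 1))) o\<^sub>L G z))"
    by (intro circle_mean_add continuous_on_scalar_op continuous_on_powi_circle blinfun_compose.continuous_on
        continuous_on_const continuous_on_G)
  also have "circle_mean (\<lambda>z. scalar_op (z powi (- k)) :: 'h \<Rightarrow>\<^sub>L 'h) = scalar_op (circle_mean (\<lambda>z. z powi (- k)))"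
    by (rule circle_mean_linear[OF bounded_linear_scalar_op continuous_on_powi_circle])
  also have "circle_mean (\<lambda>z. T' o\<^sub>L (scalar_op (z powi (- (k + 1))) o\<^sub>L G z)) = T' o\<^sub>L fourier (k + 1)"
    unfolding fourier_def
    by (rule circle_mean_linear[OF blinfun_compose.bounded_linear_right continuous_on_fourier])
  finally show ?thesis by (auto simp: circle_mean_powi)
qed

lemma fourier_neg: "fourier (- int n) = op_power T' n o\<^sub>L fourier 0"
proof (induction n)
  case (Suc n)
  have "fourier (- int (Suc n)) = T' o\<^sub>L fourier (- int n)"
    using fourier_rec[of "- int (Suc n)"] by simp
  then show ?case by (simp add: Suc blinfun_compose_assoc)
qed simp

lemma fourier_pos: "fourier 0 = id_blinfun + (op_power T' (Suc n) o\<^sub>L fourier (int (Suc n)))"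
proof (induction n)
  case 0
  then show ?case using fourier_rec[of 0] by simp
next
  case (Suc n)
  have "fourier (int (Suc n)) = T' o\<^sub>L fourier (int (Suc (Suc n)))"
    using fourier_rec[of "int (Suc n)"] by (simp add: add.commute)
  then have "op_power T' (Suc n) o\<^sub>L fourier (int (Suc n)) = op_power T' (Suc (Suc n)) o\<^sub>L fourier (int (Suc (Suc n)))"
    using op_power_commute[of T' T' "Suc n"] by (simp add: blinfun_compose_assoc[symmetric] del: op_power.simps) (simp add: blinfun_compose_assoc)
  then show ?case using Suc by simp
qed

text \<open>The Riemann-Lebesgue lemma, by translating with half a period.\<close>

lemma fourier_small:
  assumes e: "0 < e"
  shows "\<exists>N. \<forall>k. N \<le> \<bar>k\<bar> \<longrightarrow> norm (fourier k) \<le> e"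
proof -
  have "uniformly_continuous_on (sphere 0 1) G"
    by (rule compact_uniformly_continuous[OF continuous_on_G compact_sphere])
  then obtain d where d: "0 < d" "\<And>z w. z \<in> sphere 0 1 \<Longrightarrow> w \<in> sphere 0 1 \<Longrightarrow> dist z w < d \<Longrightarrow> dist (G z) (G w) < 2 * e"
    using e unfolding uniformly_continuous_on_def by (metis mult_pos_pos zero_less_numeral)
  \<comment> \<open>For \<open>\<bar>k\<bar>\<close> above \<open>N\<close> the translation by half
    a period, of length at most \<open>pi / \<bar>k\<bar>\<close>, stays below the modulus
    \<open>d\<close> of uniform continuity.\<close>
  obtain N :: nat where N: "pi / d < real N" using reals_Archimedean2 by blast
  have "norm (fourier k) \<le> e" if k: "int N + 1 \<le> \<bar>k\<bar>" for k
  proof -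
    define c where "c = cis (pi / of_int k)"
    have c: "c \<in> sphere 0 1" by (simp add: c_def)
    have k0: "k \<noteq> 0" using k by auto
    have "of_int (- k) * (pi / of_int k) = - pi" using k0 by simp
    then have "c powi (- k) = cis (- pi)" by (simp only: c_def cis_power_int)
    then have ck: "c powi (- k) = - 1" by (simp add: complex_eq_iff)
    have "cmod (c - 1) \<le> \<bar>pi / of_int k\<bar>"
      using dist_exp_i_1[of "pi / of_int k"] abs_sin_x_le_abs_x[of "pi / of_int k / 2"]
      by (simp add: cis_conv_exp c_def)
    also have "\<dots> < d"
    proof -
      have "real N < of_int \<bar>k\<bar>" using k by linarith
      then have "pi / d < of_int \<bar>k\<bar>" using N by linarith
      then show ?thesis using d(1) k0 by (simp add: abs_divide field_simps)
    qed
    finally have cd: "cmod (c - 1) < d" .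
    have cG: "continuous_on (sphere 0 1) (\<lambda>z. G (c * z))"
      by (rule continuous_on_compose2[OF continuous_on_G]) (auto intro!: continuous_intros simp: norm_mult c_def)
    have "fourier k = circle_mean (\<lambda>z. scalar_op ((c * z) powi (- k)) o\<^sub>L G (c * z))"
      unfolding fourier_def by (rule circle_mean_rotate[symmetric, OF continuous_on_fourier c])
    also have "\<dots> = circle_mean (\<lambda>z. - (scalar_op (z powi (- k)) o\<^sub>L G (c * z)))"
      by (simp only: power_int_mult_distrib ck) (simp add: scalar_op_minus blinfun_compose.minus_left)
    finally have "fourier k + fourier k = circle_mean (\<lambda>z. (scalar_op (z powi (- k)) o\<^sub>L G z) + - (scalar_op (z powi (- k)) o\<^sub>L G (c * z)))"
      by (subst circle_mean_add) (auto simp: fourier_def intro!: continuous_on_minus continuous_on_fourier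
          blinfun_compose.continuous_on continuous_on_scalar_op continuous_on_powi_circle cG)
    also have "norm \<dots> \<le> 2 * e"
    proof (rule norm_circle_mean_le)
      fix z :: complex assume z: "z \<in> sphere 0 1"
      have cz: "c * z \<in> sphere 0 1" using z c by (simp add: norm_mult)
      have "dist z (c * z) = cmod ((1 - c) * z)" by (simp add: dist_norm algebra_simps)
      also have "\<dots> < d" using cd z by (simp add: norm_mult norm_minus_commute)
      finally have "dist (G z) (G (c * z)) < 2 * e" by (rule d(2)[OF z cz])
      moreover have "(scalar_op (z powi (- k)) o\<^sub>L G z) + - (scalar_op (z powi (- k)) o\<^sub>L G (c * z)) = scalar_op (z powi (- k)) o\<^sub>L (G z - G (c * z))"
        by (simp add: blinfun_compose.diff_right)
      moreover have "cmod (z powi (- k)) = 1" using z by (simp add: norm_power_int)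
      ultimately show "norm ((scalar_op (z powi (- k)) o\<^sub>L G z) + - (scalar_op (z powi (- k)) o\<^sub>L G (c * z))) \<le> 2 * e"
        by (simp only: norm_scalar_op_compose dist_norm mult_1_left less_imp_le)
    next
      show "continuous_on (sphere 0 1) (\<lambda>z. (scalar_op (z powi (- k)) o\<^sub>L G z) + - (scalar_op (z powi (- k)) o\<^sub>L G (c * z)))"
        by (intro continuous_on_add continuous_on_minus continuous_on_fourier
          blinfun_compose.continuous_on continuous_on_scalar_op continuous_on_powi_circle cG)
    qed (use e in simp)
    finally have "norm (2 *\<^sub>R fourier k) \<le> 2 * e" by (simp add: scaleR_2)
    then show ?thesis by simp
  qed
  then show ?thesis by blast
qed

text \<open>Conjugation by \<open>v\<close> rotates the argument of the resolvent. Only the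
  coefficient of index 0, the plain mean, is unaffected by this.\<close>

lemma fourier_0_commute_v: "v o\<^sub>L fourier 0 = fourier 0 o\<^sub>L v"
proof -
  have vG: "v o\<^sub>L G z o\<^sub>L adj v = G (cnj rot * z)" if z: "z \<in> sphere 0 1" for z
  proof (rule left_right_inverse_unique[OF _ G(3)])
    show cz: "cnj rot * z \<in> sphere 0 1" using z by (simp add: norm_mult)
    have "v o\<^sub>L A z o\<^sub>L adj v = id_blinfun - (scalar_op (cnj z / of_real r) o\<^sub>L (v o\<^sub>L T o\<^sub>L adj v))"
      by (simp add: A_def blinfun_compose.diff_left blinfun_compose.diff_right v_adj_v scalar_op_left_commute blinfun_compose_assoc)
    also have "\<dots> = A (cnj rot * z)"
      unfolding v_adjoint_action[OF f] by (simp add: A_def scalar_op_mult_left mult.commute del: cis_cnj)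
    finally have vA: "A (cnj rot * z) = v o\<^sub>L A z o\<^sub>L adj v" ..
    have "(v o\<^sub>L G z o\<^sub>L adj v) o\<^sub>L (v o\<^sub>L A z o\<^sub>L adj v) = v o\<^sub>L (G z o\<^sub>L ((adj v o\<^sub>L v) o\<^sub>L A z)) o\<^sub>L adj v"
      by (simp only: blinfun_compose_assoc)
    also have "\<dots> = id_blinfun" by (simp add: adj_v_v G(2)[OF z] v_adj_v)
    finally show "(v o\<^sub>L G z o\<^sub>L adj v) o\<^sub>L A (cnj rot * z) = id_blinfun" unfolding vA .
  qed
  have f0: "fourier 0 = circle_mean G" by (simp add: fourier_def)
  have "v o\<^sub>L fourier 0 o\<^sub>L adj v = circle_mean (\<lambda>z. v o\<^sub>L G z o\<^sub>L adj v)"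
    unfolding f0
    by (rule circle_mean_linear[symmetric, OF _ continuous_on_G])
      (intro bounded_linear_compose[OF blinfun_compose.bounded_linear_left blinfun_compose.bounded_linear_right])
  also have "\<dots> = circle_mean (\<lambda>z. G (cnj rot * z))"
    unfolding circle_mean_def by (intro integral_cong vG) simp
  also have "\<dots> = fourier 0"
    unfolding f0 by (rule circle_mean_rotate[OF continuous_on_G]) simp
  finally have "v o\<^sub>L fourier 0 o\<^sub>L adj v = fourier 0" .
  then have "v o\<^sub>L fourier 0 o\<^sub>L (adj v o\<^sub>L v) = fourier 0 o\<^sub>L v" by (simp flip: blinfun_compose_assoc)
  then show ?thesis by (simp add: adj_v_v)
qed

lemma fourier_0_scalar:
  assumes det: "0 < circle_det f"
  obtains c where "fourier 0 = scalar_op c"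
proof -
  let ?E = "fourier 0"
  \<comment> \<open>The coefficient commutes with \<open>u o\<^sub>L calc f\<close> and with
    \<open>calc f\<close>, so its commutator with \<open>u\<close> is annihilated by
    \<open>calc f\<close> on the right.\<close>
  define D where "D = (?E o\<^sub>L u) - (u o\<^sub>L ?E)"
  have cE: "calc f o\<^sub>L ?E = ?E o\<^sub>L calc f"
    by (rule calc_commute_commutant[OF f fourier_bounded fourier_0_commute_v])
  have "T o\<^sub>L ?E = ?E o\<^sub>L T" by (rule fourier_commute) auto
  then have Df: "D o\<^sub>L calc f = 0"
    by (simp add: D_def blinfun_compose.diff_left blinfun_compose_assoc cE)
  have "D \<in> R" unfolding D_def by (intro R_diff R_compose fourier_R u_R)
  then have "D = 0" using Df by (rule zero_if_compose_calc_zero[OF f det])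
  then have "?E o\<^sub>L u = u o\<^sub>L ?E" by (simp add: D_def)
  then show ?thesis
    using that by (rule central_if_commutes[OF fourier_R _ fourier_0_commute_v[symmetric]])
qed

lemma norm_op_power_T'_apply:
  "norm (blinfun_apply (op_power T' n) x) = norm (blinfun_apply (calc (rot_prod f n)) x) / r ^ n"
proof -
  have "op_power T' n = scalar_op (1 / of_real r ^ n) o\<^sub>L op_power T n"
  proof (induction n)
    case (Suc n)
    then show ?case
      by (simp add: T'_def blinfun_compose_assoc scalar_op_left_commute[OF u_bounded]
          scalar_op_left_commute[OF calc_bounded[OF f]] scalar_op_mult_left)
  qed simp
  then show ?thesis
    using r by (simp add: norm_scaleC norm_op_power_u_calc_apply[OF f] norm_divide norm_power)
qed

text \<open>A nonzero scalar would put the spectrum inside the circle and make powers of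
  \<open>T'\<close> small, against the lower bound by the determinant. A zero scalar makes a power
  of \<open>T'\<close> invertible with small inverse, which bounds the rotation product away from 0
  everywhere.\<close>

lemma circle_det_greater:
  assumes det: "r \<le> circle_det f"
  shows "r < circle_det f" "\<And>z. z \<in> sphere 0 1 \<Longrightarrow> f z \<noteq> 0"
proof -
  have dpos: "0 < circle_det f" using r det by simp
  obtain c where c: "fourier 0 = scalar_op c" by (rule fourier_0_scalar[OF dpos])
  have c0: "c = 0"
  proof (rule ccontr)
    assume "c \<noteq> 0"
    then have "0 < cmod c / 2" by simp
    then obtain N where N: "\<And>k. N \<le> \<bar>k\<bar> \<Longrightarrow> norm (fourier k) \<le> cmod c / 2"
      using fourier_small by blast
    define n where "n = nat \<bar>N\<bar>"
    have "norm (fourier (- int n)) \<le> cmod c / 2" by (rule N) (simp add: n_def)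
    also have "fourier (- int n) = scalar_op c o\<^sub>L op_power T' n"
      unfolding fourier_neg c by (rule scalar_op_commute) (simp add: T'_def op_power_in_bounded_ops)
    finally have "norm (op_power T' n) \<le> 1 / 2"
      using \<open>c \<noteq> 0\<close> by (simp add: norm_scalar_op_compose)
    have "norm (calc (rot_prod f n)) \<le> r ^ n / 2"
    proof (rule norm_blinfun_bound)
      fix x
      have "norm (calc (rot_prod f n) x) / r ^ n \<le> norm (op_power T' n) * norm x"
        unfolding norm_op_power_T'_apply[symmetric] by (rule norm_blinfun)
      also have "\<dots> \<le> 1 / 2 * norm x" by (intro mult_right_mono) (fact, simp)
      finally show "norm (calc (rot_prod f n) x) \<le> r ^ n / 2 * norm x"
        using r by (simp add: field_simps)
    qed (use r in simp)
    then have "circle_det f ^ n \<le> r ^ n / 2"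
      by (intro circle_det_power_le[OF f] order_trans[OF norm_calc_ge[OF continuous_on_rot_prod[OF f]]])
    moreover have "r ^ n \<le> circle_det f ^ n" using det r by (intro power_mono) auto
    ultimately show False using zero_less_power[OF r, of n] by linarith
  qed
  have "(0 :: real) < 1 / 2" by simp
  then obtain N where N: "\<And>k. N \<le> \<bar>k\<bar> \<Longrightarrow> norm (fourier k) \<le> 1 / 2"
    using fourier_small by blast
  \<comment> \<open>Positive, as required by \<open>fourier_pos\<close> and by the later division by
    \<open>n\<close>.\<close>
  define n where "n = Suc (nat \<bar>N\<bar>)"
  have En: "norm (fourier (int n)) \<le> 1 / 2" by (rule N) (simp add: n_def)
  have T'c: "T' o\<^sub>L T = T o\<^sub>L T'"
    by (simp only: T'_def scalar_op_left_commute[OF T_bounded]) (rule blinfun_compose_assoc)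
  have "fourier (int n) o\<^sub>L op_power T' n = op_power T' n o\<^sub>L fourier (int n)"
  proof -
    have "T' o\<^sub>L fourier (int n) = fourier (int n) o\<^sub>L T'"
      by (rule fourier_commute[OF _ T'c]) (simp add: T'_def)
    then show ?thesis by (intro op_power_commute) simp
  qed
  also have "op_power T' n o\<^sub>L fourier (int n) = - id_blinfun"
    using fourier_pos[of "nat \<bar>N\<bar>"] unfolding c c0 n_def
    by (simp del: op_power.simps add: eq_neg_iff_add_eq_0 add.commute)
  finally have inv: "fourier (int n) o\<^sub>L op_power T' n = - id_blinfun" .
  \<comment> \<open>The inverse of a power of \<open>T'\<close> has norm at most 1/2. Approximate
    eigenvectors turn this operator bound into a pointwise bound on the product.\<close>
  have low: "2 * r ^ n \<le> cmod (rot_prod f n z)" if z: "z \<in> sphere 0 1" for z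
  proof (rule field_le_epsilon)
    fix e :: real assume e: "0 < e"
    obtain y where y: "y \<noteq> 0" "norm ((calc (rot_prod f n) - scalar_op (rot_prod f n z)) y) \<le> e * norm y"
      by (rule calc_approximate_eigenvector[OF continuous_on_rot_prod[OF f] z e])
    have "norm y = norm (fourier (int n) (op_power T' n y))"
      using arg_cong[OF inv, of "\<lambda>X. norm (blinfun_apply X y)"] by (simp add: blinfun.minus_left)
    also have "\<dots> \<le> norm (fourier (int n)) * norm (op_power T' n y)" by (rule norm_blinfun)
    also have "\<dots> \<le> 1 / 2 * norm (op_power T' n y)" by (intro mult_right_mono En) simp
    finally have "2 * r ^ n * norm y \<le> norm (calc (rot_prod f n) y)"
      using r by (simp add: norm_op_power_T'_apply field_simps)
    also have "\<dots> \<le> norm ((calc (rot_prod f n) - scalar_op (rot_prod f n z)) y) + norm (scaleC (rot_prod f n z) y)"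
      using norm_triangle_ineq[of "(calc (rot_prod f n) - scalar_op (rot_prod f n z)) y" "scaleC (rot_prod f n z) y"]
      by (simp add: blinfun.diff_left)
    also have "\<dots> \<le> (cmod (rot_prod f n z) + e) * norm y"
      using y(2) by (simp add: norm_scaleC distrib_right)
    finally show "2 * r ^ n \<le> cmod (rot_prod f n z) + e" using y(1) by simp
  qed
  have nz: "f z \<noteq> 0" if z: "z \<in> sphere 0 1" for z
  proof
    assume "f z = 0"
    then have "rot_prod f n z = 0"
      unfolding rot_prod_def n_def by (intro prod_zero) (auto intro!: bexI[of _ 0])
    then show False using low[OF z] zero_less_power[OF r, of n] by simp
  qed
  show "\<And>z. z \<in> sphere 0 1 \<Longrightarrow> f z \<noteq> 0" by (rule nz)
  let ?h = "\<lambda>z. ln (cmod (f z))"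
  have h: "continuous_on (sphere 0 1) ?h" using nz by (intro continuous_intros f) auto
  have rz: "rot ^ k * z \<in> sphere 0 1" if "z \<in> sphere 0 1" for k z
    using that by (simp add: norm_mult norm_power)
  have "ln (2 * r ^ n) = circle_mean (\<lambda>z :: complex. ln (2 * r ^ n))" by (simp add: circle_mean_const)
  also have "\<dots> \<le> circle_mean (\<lambda>z. \<Sum>k<n. ?h (rot ^ k * z))"
  proof (rule circle_mean_mono)
    have "continuous_on (sphere 0 1) (\<lambda>z. ?h (rot ^ k * z))" for k
      by (intro continuous_on_compose2[OF h] continuous_intros) (auto simp: norm_mult norm_power)
    then show "continuous_on (sphere 0 1) (\<lambda>z. \<Sum>k<n. ?h (rot ^ k * z))" by (intro continuous_on_sum)
    fix z :: complex assume z: "z \<in> sphere 0 1"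
    have "ln (2 * r ^ n) \<le> ln (cmod (rot_prod f n z))"
      using low[OF z] r by (intro ln_mono) auto
    also have "cmod (rot_prod f n z) = (\<Prod>k<n. cmod (f (rot ^ k * z)))"
      by (simp add: rot_prod_def prod_norm)
    also have "ln \<dots> = (\<Sum>k<n. ?h (rot ^ k * z))"
      using nz[OF rz[OF z]] by (subst ln_prod) auto
    finally show "ln (2 * r ^ n) \<le> (\<Sum>k<n. ?h (rot ^ k * z))" .
  qed simp
  also have "\<dots> = real n * circle_mean ?h" by (rule circle_mean_sum_rot[OF h])
  finally have "ln 2 + real n * ln r \<le> real n * circle_mean ?h"
    using r by (simp add: ln_mult ln_realpow)
  \<comment> \<open>The surplus \<open>ln 2\<close>, coming from the bound 1/2 on the coefficient,
    is what makes the inequality strict.\<close>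
  then have "real n * ln r < real n * circle_mean ?h" using ln_2_less_1 ln_gt_zero[of "2 :: real"] by linarith
  moreover have "0 < real n" by (simp add: n_def)
  ultimately have "ln r < circle_mean ?h" by (simp only: mult_less_cancel_left_pos)
  moreover have "circle_det f = exp (circle_mean ?h)"
    by (rule circle_det_nonvanishing[OF f]) (rule nz)
  ultimately show "r < circle_det f" by (simp add: less_exp_iff_ln_less[OF r])
qed

end

section \<open>The spectrum in the two cases\<close>

context rotation_factor
begin

lemma not_invertible_on_critical_circles:
  assumes f: "continuous_on (sphere 0 1) f" and w: "w \<noteq> 0" "cmod w \<le> circle_det f"
    and crit: "cmod w = circle_det f \<or> (\<exists>z\<in>sphere 0 1. f z = 0)"
  shows "\<not> op_invertible ((u o\<^sub>L calc f) - scalar_op w)"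
proof
  assume inv: "op_invertible ((u o\<^sub>L calc f) - scalar_op w)"
  interpret circle_resolvent v u R \<tau> \<theta> f "cmod w"
  proof
    show "op_invertible ((u o\<^sub>L calc f) - scalar_op w')" if "cmod w' = cmod w" for w'
      using w(1) that by (intro invertible_on_circle[OF f _ refl inv]) auto
  qed (use f w in auto)
  show False using circle_det_greater[OF w(2)] crit by auto
qed

lemma op_spectrum_u_calc_invertible:
  assumes f: "continuous_on (sphere 0 1) f" and inv: "op_invertible (calc f)"
  shows "op_spectrum (u o\<^sub>L calc f) = (\<lambda>z. complex_of_real (circle_det f) * z) ` sphere 0 1"
proof -
  have nz: "f z \<noteq> 0" if "z \<in> sphere 0 1" for z
    using inv that by (simp add: calc_invertible_iff[OF f])
  have "circle_det f = exp (circle_mean (\<lambda>z. ln (cmod (f z))))"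
    by (rule circle_det_nonvanishing[OF f]) (rule nz)
  then have pos: "0 < circle_det f" by simp
  have "op_spectrum (u o\<^sub>L calc f) = {w. cmod w = circle_det f}"
  proof (intro set_eqI iffI)
    fix w assume "w \<in> op_spectrum (u o\<^sub>L calc f)"
    then have "\<not> circle_det f < cmod w" "\<not> cmod w < circle_det f"
      using invertible_outside[OF f, of w] invertible_inside[OF f nz, of w] by (auto simp: op_spectrum_def)
    then show "w \<in> {w. cmod w = circle_det f}" by simp
  next
    fix w assume "w \<in> {w. cmod w = circle_det f}"
    then have "w \<noteq> 0" "cmod w \<le> circle_det f" "cmod w = circle_det f" using pos by auto
    then show "w \<in> op_spectrum (u o\<^sub>L calc f)"
      using not_invertible_on_critical_circles[OF f, of w] by (simp add: op_spectrum_def)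
  qed
  also have "\<dots> = (\<lambda>z. complex_of_real (circle_det f) * z) ` sphere 0 1"
  proof (intro set_eqI iffI)
    fix w assume "w \<in> {w. cmod w = circle_det f}"
    then have "w / of_real (circle_det f) \<in> sphere 0 1" "w = of_real (circle_det f) * (w / of_real (circle_det f))"
      using pos by (auto simp: norm_divide)
    then show "w \<in> (\<lambda>z. complex_of_real (circle_det f) * z) ` sphere 0 1" by blast
  qed (use pos in \<open>auto simp: norm_mult\<close>)
  finally show ?thesis .
qed

lemma op_spectrum_u_calc_not_invertible:
  assumes f: "continuous_on (sphere 0 1) f" and ninv: "\<not> op_invertible (calc f)"
  shows "op_spectrum (u o\<^sub>L calc f) = cball 0 (circle_det f)"
proof (intro set_eqI iffI)
  fix w :: complex assume "w \<in> op_spectrum (u o\<^sub>L calc f)"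
  then show "w \<in> cball 0 (circle_det f)"
    using invertible_outside[OF f, of w] by (force simp: op_spectrum_def)
next
  fix w :: complex assume w: "w \<in> cball 0 (circle_det f)"
  have zero: "\<exists>z\<in>sphere 0 1. f z = 0" using ninv by (simp add: calc_invertible_iff[OF f])
  show "w \<in> op_spectrum (u o\<^sub>L calc f)"
  proof (cases "w = 0")
    case True
    \<comment> \<open>The circle argument needs a positive radius. At 0 the unitary factor is
      cancelled instead, which also settles a disk of radius 0.\<close>
    have "\<not> op_invertible (u o\<^sub>L calc f)"
    proof
      assume "op_invertible (u o\<^sub>L calc f)"
      moreover have "op_invertible (adj u)"
        by (rule op_invertibleI[of u]) (auto simp: u_adj_u adj_u_u)
      ultimately have "op_invertible (adj u o\<^sub>L (u o\<^sub>L calc f))" by (rule op_invertible_compose[rotated])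
      then show False using ninv by (simp add: adj_u_u flip: blinfun_compose_assoc)
    qed
    then show ?thesis using True by (simp add: op_spectrum_def)
  next
    case False
    then show ?thesis
      using not_invertible_on_critical_circles[OF f False] w zero by (simp add: op_spectrum_def)
  qed
qed

end

theorem theorem3p3:
  fixes R :: "('h :: complex_hilbert \<Rightarrow>\<^sub>L 'h) set"
    and \<tau> :: "('h \<Rightarrow>\<^sub>L 'h) \<Rightarrow> complex"
    and \<theta> :: real
    and u v :: "'h \<Rightarrow>\<^sub>L 'h"
    and f :: "complex \<Rightarrow> complex"
  assumes "II1_factor R" and "hyperfinite R"
    and "faithful_normal_tracial_state R \<tau>"
    and "0 < \<theta>" and "\<theta> < 1" and "\<theta> \<notin> \<rat>"
    and "u \<in> R" and "v \<in> R" and "unitary_op u" and "unitary_op v"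
    and "R = commutant (commutant {u, v})"
    and "v o\<^sub>L u = scalar_op (exp (2 * of_real pi * \<i> * of_real \<theta>)) o\<^sub>L (u o\<^sub>L v)"
    and "continuous_on (sphere 0 1) f"
  shows "fk_det \<tau> (fcalc v f) = exp_circle_log f \<and>
    (op_invertible (fcalc v f) \<longrightarrow>
       op_spectrum (u o\<^sub>L fcalc v f)
         = (\<lambda>z. complex_of_real (fk_det \<tau> (fcalc v f)) * z) ` sphere 0 1) \<and>
    (\<not> op_invertible (fcalc v f) \<longrightarrow>
       op_spectrum (u o\<^sub>L fcalc v f) = cball 0 (fk_det \<tau> (fcalc v f)))"
proof -
  have "exp (2 * of_real pi * \<i> * of_real \<theta>) = cis (2 * pi * \<theta>)"
    by (simp add: cis_conv_exp mult_ac)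
  then interpret rotation_factor v u R \<tau> \<theta>
    using assms by unfold_locales (auto simp: II1_factor_def)
  note f = \<open>continuous_on (sphere 0 1) f\<close>
  show ?thesis
    unfolding fcalc_v[OF f] fk_det_calc[OF f] exp_circle_log_eq_det[OF f]
    using op_spectrum_u_calc_invertible[OF f] op_spectrum_u_calc_not_invertible[OF f] by blast
qed

end
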